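(* Let $1\le l<k\le n$ with $l=k-1$ or $l=k-2$, and let $F=\sigma_k/\sigma_l$. Let $K\ge 0$ and $f_0>0$. There exist constants $K_0,K_1\ge 1$ (large) and $\delta,\gamma>0$ (small), depending only on $n,k,l,K$ and $f_0$, such that the following holds. Suppose $\lambda\in\Gamma_k\subset\mathbb{R}^n$ satisfies $\lambda_1\ge\cdots\ge\lambda_n\ge -K$ and $F(\lambda)\ge f_0$. If $$\frac{\lambda_1}{F(\lambda)^{1/(k-l)}}\ge K_0,$$ then every $\zeta\in\mathbb{R}^n$ satisfies $$-\sum_{i,j=1}^nF^{ii,jj}\zeta_i\zeta_j+\frac{K_1}{F}\Big(\sum_{i=1}^nF^{ii}\zeta_i\Big)^2+\frac{2}{(1+\delta)\lambda_1}\sum_{i>1}F^{ii}\zeta_i^2\ \ge\ (1+\gamma)\frac{F^{11}\zeta_1^2}{\lambda_1},$$ where $F$, $F^{ii}$ and $F^{ii,jj}$ are evaluated at $\lambda$.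
   Context: For $\lambda\in\mathbb{R}^n$, $\sigma_m(\lambda)=\sum_{1\le i_1<\dots<i_m\le n}\lambda_{i_1}\cdots\lambda_{i_m}$ is the $m$-th elementary symmetric function. The Garding cone is $\Gamma_k=\{\lambda\in\mathbb{R}^n:\sigma_j(\lambda)>0,\ j=1,\dots,k\}$ (also written $\Gamma_k^n$). $F(\lambda)=\sigma_k(\lambda)/\sigma_l(\lambda)$, $F^{ii}=\partial F/\partial\lambda_i$, $F^{ii,jj}=\partial^2F/\partial\lambda_i\partial\lambda_j$. *)

theory Defs
  imports "HOL-Analysis.Analysis"
begin

text \<open>
  A vector of \<open>\<real>\<^sup>n\<close> is represented by a function \<^typ>\<open>nat \<Rightarrow> real\<close> of which only the
  coordinates \<open>1, \<dots>, n\<close> are relevant: none of the notions below, taken at indices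
  \<open>i, j \<in> {1..n}\<close>, depends on the other values.
\<close>

text \<open>The indices \<open>i\<^sub>1 < \<dots> < i\<^sub>m\<close> are encoded as the \<open>m\<close>-element subset they form.\<close>

definition esym :: "nat \<Rightarrow> nat \<Rightarrow> (nat \<Rightarrow> real) \<Rightarrow> real" where
  "esym n m x = (\<Sum>I | I \<subseteq> {1..n} \<and> card I = m. \<Prod>i\<in>I. x i)"

definition Garding_cone :: "nat \<Rightarrow> nat \<Rightarrow> (nat \<Rightarrow> real) set" where
  "Garding_cone n k = {x. \<forall>j\<in>{1..k}. esym n j x > 0}"

definition esym_quot :: "nat \<Rightarrow> nat \<Rightarrow> nat \<Rightarrow> (nat \<Rightarrow> real) \<Rightarrow> real" where
  "esym_quot n k l x = esym n k x / esym n l x"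

definition partial_deriv :: "nat \<Rightarrow> ((nat \<Rightarrow> real) \<Rightarrow> real) \<Rightarrow> (nat \<Rightarrow> real) \<Rightarrow> real" where
  "partial_deriv i f x = deriv (\<lambda>t. f (x(i := t))) (x i)"

end

theory Submission
  imports Defs "HOL-Computational_Algebra.Formal_Power_Series"
begin

text \<open>
  By homogeneity one may assume \<open>F = 1\<close>. Write \<open>q\<^sub>j = \<sigma>\<^sub>j / \<sigma>\<^sub>j\<^sub>-\<^sub>1\<close>, so that \<open>F = q\<^sub>k\<close> or
  \<open>F = q\<^sub>k q\<^sub>k\<^sub>-\<^sub>1\<close>. The identity \<open>k q\<^sub>k(\<lambda>) = \<Sum>\<^sub>i \<lambda>\<^sub>i q\<^sub>k\<^sub>-\<^sub>1(\<lambda>|i) / (\<lambda>\<^sub>i + q\<^sub>k\<^sub>-\<^sub>1(\<lambda>|i))\<close>, a sum of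
  parallel sums, gives monotonicity and concavity of \<open>q\<^sub>k\<close> with explicit remainders by induction on
  \<open>k\<close>. As a function of \<open>\<lambda>\<^sub>1\<close>, \<open>q\<^sub>k = a - w / (\<lambda>\<^sub>1 + a)\<close> with \<open>a = q\<^sub>k\<^sub>-\<^sub>1(\<lambda>|1)\<close>
  bounded, so the \<open>\<zeta>\<^sub>1\<^sup>2\<close> coefficient of the Hessian form is about twice \<open>F\<^sup>1\<^sup>1 / \<lambda>\<^sub>1\<close> and only the
  mixed terms \<open>\<zeta>\<^sub>1 \<zeta>\<^sub>i\<close> have to be absorbed. If \<open>\<lambda>\<^sub>k\<^sub>-\<^sub>1\<close> is large, they are absorbed by the sum
  over \<open>i > 1\<close>, by passing to the limit \<open>\<lambda>\<^sub>1, \<dots>, \<lambda>\<^sub>k\<^sub>-\<^sub>1 \<rightarrow> \<infinity>\<close>, where it is the inequality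
  \<open>|\<mu>|\<^sup>2 < |\<mu>|\<^sup>2 + 1\<close> for \<open>\<mu> = (\<lambda>\<^sub>k, \<dots>, \<lambda>\<^sub>n)\<close>. If \<open>\<lambda>\<^sub>k\<^sub>-\<^sub>1\<close> stays bounded, \<open>q\<^sub>k\<close> is strictly
  concave modulo the radial direction in the bounded variables. For \<open>l = k - 2\<close> one uses in addition
  that \<open>1 / q\<^sub>k\<^sub>-\<^sub>1\<close> is convex and has the same form in \<open>\<lambda>\<^sub>1\<close>.
\<close>

text \<open>The obstacle is the sharp factor. The \<open>\<zeta>\<^sub>1\<^sup>2\<close> terms alone
  provide a factor close to 2 where \<open>1 + \<gamma>\<close> is required, so the mixed terms may
  consume strictly less than one unit. When the first k - 1 entries are large, a strict inequality
  with no parameter to spare is left in the limit; the margin \<open>\<eta>\<close> is therefore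
  found by contradiction along a subsequence and is not explicit. For l = k - 1 that limit
  inequality is false as it stands: a multiple of the gradient of q_k has to be subtracted from the
  mixed coefficients first, and the term with \<open>K\<^sub>1\<close> pays for it. For l = k - 2
  one writes q_k = F * (1 / q_{k-1}), whose second derivative has a cross term; hence only a
  fraction \<open>\<kappa>\<close> < 1 of the convexity of 1 / q_{k-1} enters the main estimate, and
  the fraction 1 - \<kappa> absorbs the cross term. Newton's inequality comes from the parallel sums
  too: with a fresh index of large value adjoined, it is a lower bound for one partial derivative of
  \<open>q\<close>. Real-rooted polynomials do not occur.\<close>

unbundle no vec_syntax and fps_syntax

section \<open>Elementary symmetric functions over a commutative ring\<close>

text \<open>Integer degrees let the function vanish below degree 0, so the deletion and Euler
  identities hold in every degree; expressions such as \<open>int k - 3\<close> then make sense for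
  k = 2. Values lie in a commutative ring so that the same identities apply to power series.\<close>

definition es :: "('i \<Rightarrow> 'a::comm_ring_1) \<Rightarrow> 'i set \<Rightarrow> int \<Rightarrow> 'a" where
  "es x S m = (\<Sum>I | I \<subseteq> S \<and> int (card I) = m. \<Prod>i\<in>I. x i)"

lemma es_neg [simp]: "m < 0 \<Longrightarrow> es x S m = 0"
proof -
  assume "m < 0"
  then have *: "{I. I \<subseteq> S \<and> int (card I) = m} = {}" by auto
  show ?thesis unfolding es_def * by simp
qed

lemma es_0 [simp]: "finite S \<Longrightarrow> es x S 0 = 1"
proof -
  assume "finite S"
  then have "I \<subseteq> S \<and> int (card I) = 0 \<longleftrightarrow> I = {}" for I
    using finite_subset[of I S] by (cases "I = {}") auto
  then have *: "{I. I \<subseteq> S \<and> int (card I) = 0} = {{}}" by (simp only: singleton_conv)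
  show ?thesis unfolding es_def * by simp
qed

lemma es_empty: "es x {} m = (if m = 0 then 1 else 0)"
proof -
  have *: "{I. I \<subseteq> {} \<and> int (card I) = m} = (if m = 0 then {{}} else {})" by auto
  show ?thesis unfolding es_def * by simp
qed

lemma es_insert:
  assumes "finite S" "i \<notin> S"
  shows "es x (insert i S) m = x i * es x S (m - 1) + es x S m"
proof -
  let ?A = "{I. I \<subseteq> S \<and> int (card I) = m}" and ?B = "{I. I \<subseteq> S \<and> int (card I) = m - 1}"
  have fin: "finite ?A" "finite ?B" using assms(1) by auto
  have split: "{I. I \<subseteq> insert i S \<and> int (card I) = m} = ?A \<union> insert i ` ?B"
  proof (intro set_eqI iffI)
    fix I assume I: "I \<in> {I. I \<subseteq> insert i S \<and> int (card I) = m}"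
    show "I \<in> ?A \<union> insert i ` ?B"
    proof (cases "i \<in> I")
      case True
      have fI: "finite I" using I assms(1) finite_subset by auto
      then have c: "card I = Suc (card (I - {i}))"
        using True card_Suc_Diff1 by metis
      have "I - {i} \<in> ?B" using I c by auto
      moreover have "I = insert i (I - {i})" using True by auto
      ultimately show ?thesis by blast
    next
      case False
      then show ?thesis using I by auto
    qed
  next
    fix I assume "I \<in> ?A \<union> insert i ` ?B"
    then consider "I \<in> ?A" | J where "J \<in> ?B" "I = insert i J" by auto
    then show "I \<in> {I. I \<subseteq> insert i S \<and> int (card I) = m}"
    proof cases
      case 1
      then show ?thesis by auto
    next
      case 2
      then have "finite J" "i \<notin> J" using assms finite_subset by auto
      then show ?thesis using 2 by auto
    qed
  qed
  have inj: "inj_on (insert i) ?B" using assms(2) by (auto simp: inj_on_def)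
  have "es x (insert i S) m = es x S m + (\<Sum>I\<in>insert i ` ?B. prod x I)"
    unfolding es_def split using fin assms(2) by (subst sum.union_disjoint) auto
  also have "(\<Sum>I\<in>insert i ` ?B. prod x I) = (\<Sum>I\<in>?B. prod x (insert i I))"
    using inj by (simp add: sum.reindex)
  also have "\<dots> = (\<Sum>I\<in>?B. x i * prod x I)"
  proof (rule sum.cong[OF refl])
    fix I assume "I \<in> ?B"
    then have "finite I" "i \<notin> I" using assms finite_subset by auto
    then show "prod x (insert i I) = x i * prod x I" by simp
  qed
  finally show ?thesis unfolding es_def by (simp add: sum_distrib_left add.commute)
qed

lemma es_remove:
  assumes "finite S" "i \<in> S"
  shows "es x S m = x i * es x (S - {i}) (m - 1) + es x (S - {i}) m"
  using es_insert[of "S - {i}" i x m] insert_Diff[OF assms(2)] assms(1) by simp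

lemma es_gt_card:
  assumes "finite S" "m > int (card S)"
  shows "es x S m = 0"
proof -
  have *: "{I. I \<subseteq> S \<and> int (card I) = m} = {}"
  proof -
    have "int (card I) \<noteq> m" if "I \<subseteq> S" for I
      using card_mono[OF assms(1) that] assms(2) by linarith
    then show ?thesis by blast
  qed
  show ?thesis unfolding es_def * by simp
qed

lemma es_cong: "(\<And>i. i \<in> S \<Longrightarrow> x i = y i) \<Longrightarrow> es x S m = es y S m"
  unfolding es_def by (intro sum.cong prod.cong refl) auto

lemma es_1: "finite S \<Longrightarrow> es x S 1 = sum x S"
proof (induction S rule: finite_induct)
  case (insert i S)
  then show ?case unfolding es_insert[OF insert(1,2)] by simp
qed (simp add: es_empty)

lemma es_scale: "finite S \<Longrightarrow> es (\<lambda>i. c * x i) S (int m) = c ^ m * es x S (int m)"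
proof (induction S arbitrary: m rule: finite_induct)
  case empty
  then show ?case by (simp add: es_empty)
next
  case (insert i S)
  show ?case
  proof (cases m)
    case 0
    then show ?thesis using insert by simp
  next
    case (Suc k)
    then have k: "int m - 1 = int k" by simp
    have "c * x i * (c ^ k * es x S (int k)) + c ^ m * es x S (int m)
        = c ^ m * (x i * es x S (int k) + es x S (int m))"
      unfolding Suc by (simp add: ring_distribs)
    then show ?thesis
      unfolding es_insert[OF insert(1,2)] k insert(3)[of k] insert(3)[of m] .
  qed
qed

lemma es_euler:
  assumes "finite S"
  shows "of_int m * es x S m = (\<Sum>i\<in>S. x i * es x (S - {i}) (m - 1))"
  using assms
proof (induction S arbitrary: m rule: finite_induct)
  case empty
  then show ?case by (simp add: es_empty)
next
  case (insert j S)
  have eq: "es x (insert j S - {i}) (m - 1) = x j * es x (S - {i}) (m - 2) + es x (S - {i}) (m - 1)"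
    if "i \<in> S" for i
  proof -
    have "insert j S - {i} = insert j (S - {i})" using that insert(2) by auto
    then show ?thesis using insert(1,2) es_insert[of "S - {i}" j x "m - 1"] by auto
  qed
  have "(\<Sum>i\<in>S. x i * es x (insert j S - {i}) (m - 1))
      = (\<Sum>i\<in>S. x j * (x i * es x (S - {i}) (m - 2)) + x i * es x (S - {i}) (m - 1))"
    by (rule sum.cong[OF refl]) (simp add: eq algebra_simps)
  also have "\<dots> = x j * (of_int (m - 1) * es x S (m - 1)) + of_int m * es x S m"
    using insert(3)[of "m - 1", symmetric] unfolding insert(3)[of m]
    by (simp add: sum.distrib flip: sum_distrib_left)
  finally have "(\<Sum>i\<in>S. x i * es x (insert j S - {i}) (m - 1))
      = x j * (of_int (m - 1) * es x S (m - 1)) + of_int m * es x S m" .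
  note sum' = this
  have "insert j S - {j} = S" using insert(2) by auto
  then have "(\<Sum>i\<in>insert j S. x i * es x (insert j S - {i}) (m - 1))
      = x j * es x S (m - 1) + (x j * (of_int (m - 1) * es x S (m - 1)) + of_int m * es x S m)"
    using sum' by (simp only: sum.insert[OF insert(1,2)])
  also have "\<dots> = of_int m * (x j * es x S (m - 1) + es x S m)"
    by (simp add: ring_distribs mult.left_commute)
  finally show ?case by (simp only: es_insert[OF insert(1,2)])
qed

text \<open>
  Power series along the ray \<open>x + t z\<close>: the coefficients \<open>0\<close>, \<open>1\<close>, \<open>2\<close> of a function of \<open>ray x z\<close> are
  its value, its directional derivative and half of its second directional derivative at \<open>x\<close>.
\<close>

definition ray :: "('i \<Rightarrow> real) \<Rightarrow> ('i \<Rightarrow> real) \<Rightarrow> 'i \<Rightarrow> real fps" where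
  "ray x z i = fps_const (x i) + fps_const (z i) * fps_X"

lemma ray_nth [simp]: "ray x z i $ 0 = x i" "ray x z i $ Suc 0 = z i" "ray x z i $ 2 = 0"
  by (auto simp: ray_def numeral_2_eq_2)

lemma fps_mult_nth_2: "(f * g) $ 2 = f $ 0 * g $ 2 + f $ 1 * g $ 1 + f $ 2 * g $ (0::nat)"
  for f g :: "'a::comm_ring_1 fps"
  by (simp add: fps_mult_nth numeral_2_eq_2)

lemma es_ray_nth_0 [simp]: "finite S \<Longrightarrow> es (ray x z) S m $ 0 = es x S m"
proof (induction S arbitrary: m rule: finite_induct)
  case empty
  then show ?case by (simp add: es_empty)
next
  case (insert i S)
  then show ?case unfolding es_insert[OF insert(1,2)] by simp
qed

lemma add3_swap: "q + p + r = p + (q + r)" for p q r :: "'a::comm_ring_1"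
  by simp

lemma es_ray_deriv:
  "finite S \<Longrightarrow> fps_deriv (es (ray x z) S m) = (\<Sum>i\<in>S. fps_const (z i) * es (ray x z) (S - {i}) (m - 1))"
proof (induction S arbitrary: m rule: finite_induct)
  case empty
  then show ?case by (simp add: es_empty)
next
  case (insert j S)
  have eq: "es (ray x z) (insert j S - {i}) (m - 1)
      = ray x z j * es (ray x z) (S - {i}) (m - 2) + es (ray x z) (S - {i}) (m - 1)"
    if "i \<in> S" for i
  proof -
    have "insert j S - {i} = insert j (S - {i})" using that insert(2) by auto
    then show ?thesis using insert(1,2) es_insert[of "S - {i}" j "ray x z" "m - 1"] by auto
  qed
  have d: "fps_deriv (ray x z j) = fps_const (z j)" by (simp add: ray_def)
  have "(\<Sum>i\<in>S. fps_const (z i) * es (ray x z) (insert j S - {i}) (m - 1))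
      = (\<Sum>i\<in>S. ray x z j * (fps_const (z i) * es (ray x z) (S - {i}) (m - 2))
          + fps_const (z i) * es (ray x z) (S - {i}) (m - 1))"
    by (rule sum.cong[OF refl]) (simp only: eq distrib_left mult.left_commute)
  also have "\<dots> = ray x z j * fps_deriv (es (ray x z) S (m - 1)) + fps_deriv (es (ray x z) S m)"
  proof -
    have "m - 1 - 1 = m - 2" by simp
    then show ?thesis using insert(3)[of "m - 1"]
      by (simp only: insert(3)[of m] sum.distrib sum_distrib_left)
  qed
  finally have "(\<Sum>i\<in>S. fps_const (z i) * es (ray x z) (insert j S - {i}) (m - 1))
      = ray x z j * fps_deriv (es (ray x z) S (m - 1)) + fps_deriv (es (ray x z) S m)" .
  note sum' = this
  have "insert j S - {j} = S" using insert(2) by auto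
  then have A: "(\<Sum>i\<in>insert j S. fps_const (z i) * es (ray x z) (insert j S - {i}) (m - 1))
      = fps_const (z j) * es (ray x z) S (m - 1)
        + (ray x z j * fps_deriv (es (ray x z) S (m - 1)) + fps_deriv (es (ray x z) S m))"
    using sum' by (simp only: sum.insert[OF insert(1,2)])
  have B: "fps_deriv (es (ray x z) (insert j S) m)
      = ray x z j * fps_deriv (es (ray x z) S (m - 1)) + fps_const (z j) * es (ray x z) S (m - 1)
        + fps_deriv (es (ray x z) S m)"
    by (simp only: es_insert[OF insert(1,2)] fps_deriv_add fps_deriv_mult d)
  show ?case unfolding A B by (rule add3_swap)
qed

lemma es_ray_nth_1:
  assumes "finite S"
  shows "es (ray x z) S m $ Suc 0 = (\<Sum>i\<in>S. z i * es x (S - {i}) (m - 1))"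
proof -
  have "es (ray x z) S m $ Suc 0 = fps_deriv (es (ray x z) S m) $ 0"
    by (simp only: fps_deriv_nth) simp
  also have "\<dots> = (\<Sum>i\<in>S. z i * es x (S - {i}) (m - 1))"
    using assms by (simp only: es_ray_deriv[OF assms] fps_sum_nth fps_mult_left_const_nth es_ray_nth_0 finite_Diff)
  finally show ?thesis .
qed

lemma es_ray_nth_2:
  assumes "finite S"
  shows "2 * es (ray x z) S m $ 2 = (\<Sum>i\<in>S. \<Sum>j\<in>S - {i}. z i * z j * es x (S - {i} - {j}) (m - 2))"
proof -
  have "2 * es (ray x z) S m $ 2 = fps_deriv (es (ray x z) S m) $ 1"
    by (simp only: fps_deriv_nth one_add_one of_nat_numeral)
  also have "\<dots> = (\<Sum>i\<in>S. z i * es (ray x z) (S - {i}) (m - 1) $ Suc 0)"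
    by (simp only: es_ray_deriv[OF assms] fps_sum_nth fps_mult_left_const_nth One_nat_def)
  also have "\<dots> = (\<Sum>i\<in>S. z i * (\<Sum>j\<in>S - {i}. z j * es x (S - {i} - {j}) (m - 2)))"
  proof (rule sum.cong[OF refl])
    fix i
    have "m - 1 - 1 = m - 2" by simp
    then show "z i * es (ray x z) (S - {i}) (m - 1) $ Suc 0
        = z i * (\<Sum>j\<in>S - {i}. z j * es x (S - {i} - {j}) (m - 2))"
      using es_ray_nth_1[of "S - {i}" x z "m - 1"] assms by (simp only: finite_Diff)
  qed
  also have "\<dots> = (\<Sum>i\<in>S. \<Sum>j\<in>S - {i}. z i * z j * es x (S - {i} - {j}) (m - 2))"
    by (simp only: sum_distrib_left mult.assoc)
  finally show ?thesis .
qed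

section \<open>Quotients of consecutive elementary symmetric functions\<close>

definition cone :: "('i \<Rightarrow> real) \<Rightarrow> 'i set \<Rightarrow> int \<Rightarrow> bool" where
  "cone x S k \<longleftrightarrow> (\<forall>j. 0 \<le> j \<longrightarrow> j \<le> k \<longrightarrow> es x S j > 0)"

definition q :: "('i \<Rightarrow> real) \<Rightarrow> 'i set \<Rightarrow> int \<Rightarrow> real" where
  "q x S k = es x S k / es x S (k - 1)"

definition Q :: "('i \<Rightarrow> real) \<Rightarrow> ('i \<Rightarrow> real) \<Rightarrow> 'i set \<Rightarrow> int \<Rightarrow> real fps" where
  "Q x z S k = es (ray x z) S k * inverse (es (ray x z) S (k - 1))"

text \<open>The partial derivative of \<open>q\<close> in x i. In the numerator of the quotient rule
  the terms containing x i cancel, and what remains is Newton's expression for the other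
  variables.\<close>

definition dq :: "('i \<Rightarrow> real) \<Rightarrow> 'i set \<Rightarrow> int \<Rightarrow> 'i \<Rightarrow> real" where
  "dq x S k i = ((es x (S - {i}) (k - 1))\<^sup>2 - es x (S - {i}) k * es x (S - {i}) (k - 2)) / (es x S (k - 1))\<^sup>2"

lemma coneD: "cone x S k \<Longrightarrow> 0 \<le> j \<Longrightarrow> j \<le> k \<Longrightarrow> es x S j > 0"
  by (simp add: cone_def)

lemma cone_mono: "cone x S k \<Longrightarrow> j \<le> k \<Longrightarrow> cone x S j"
  by (auto simp: cone_def)

lemma fps_mult_coeffs:
  fixes A D N :: "real fps"
  assumes "A * D = N"
  shows "A $ 0 * D $ 0 = N $ 0" "A $ 0 * D $ 1 + A $ 1 * D $ 0 = N $ 1"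
    "A $ 0 * D $ 2 + A $ 1 * D $ 1 + A $ 2 * D $ 0 = N $ 2"
  using assms fps_mult_nth_0[of A D] fps_mult_nth_1[of A D] fps_mult_nth_2[of A D] by simp_all

text \<open>\<open>P\<close> is the parallel sum L A / (L + A). Since L is affine, the second
  coefficient is a nonnegative multiple of that of \<open>A\<close> minus a square over d^3; this is
  the source of all concavity below, with an explicit remainder.\<close>

lemma fps_parallel_coeffs:
  fixes P L A :: "real fps"
  assumes P: "P * (L + A) = L * A" and L2: "L $ 2 = 0" and d: "d = L $ 0 + A $ 0" "d \<noteq> 0"
  shows "P $ 1 = (A $ 0 / d)\<^sup>2 * L $ 1 + (L $ 0 / d)\<^sup>2 * A $ 1"
    and "P $ 2 = (L $ 0 / d)\<^sup>2 * A $ 2 - (A $ 0 * L $ 1 - L $ 0 * A $ 1)\<^sup>2 / d ^ 3"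
proof -
  define l z a b c where defs: "l = L $ 0" "z = L $ 1" "a = A $ 0" "b = A $ 1" "c = A $ 2"
  have z': "L $ Suc 0 = z" "A $ Suc 0 = b" using defs by simp_all
  note e = fps_mult_coeffs[OF P]
  have e0: "P $ 0 * d = l * a" using e(1) d by (simp add: defs)
  have e1: "P $ 0 * (z + b) + P $ 1 * d = l * b + z * a"
    using e(2) d by (simp add: defs)
  have e2: "P $ 0 * c + P $ 1 * (z + b) + P $ 2 * d = l * c + z * b"
    using e(3) d L2 fps_mult_nth_2[of L A] by (simp add: defs)
  have dl: "d = l + a" using d by (simp add: defs)
  have P0: "P $ 0 = l * a / d" using e0 d(2) by (simp add: field_simps)
  have "P $ 1 = (l * b + z * a - P $ 0 * (z + b)) / d" using e1 d(2) by (simp add: field_simps)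
  also have "\<dots> = (a\<^sup>2 * z + l\<^sup>2 * b) / d\<^sup>2"
    unfolding P0 using d(2) by (simp add: field_simps power2_eq_square) (simp add: dl algebra_simps)
  finally have P1: "P $ 1 = (a\<^sup>2 * z + l\<^sup>2 * b) / d\<^sup>2" .
  then show "P $ 1 = (A $ 0 / d)\<^sup>2 * L $ 1 + (L $ 0 / d)\<^sup>2 * A $ 1"
    by (simp add: defs add_divide_distrib power_divide)
  have "P $ 2 = (l * c + z * b - P $ 0 * c - P $ 1 * (z + b)) / d" using e2 d(2) by (simp add: field_simps)
  also have "\<dots> = (l * c * d\<^sup>2 + z * b * d\<^sup>2 - l * a * c * d - (a\<^sup>2 * z + l\<^sup>2 * b) * (z + b)) / d ^ 3"
    unfolding P0 P1 using d(2) by (simp add: field_simps power2_eq_square power3_eq_cube)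
  also have "l * c * d\<^sup>2 + z * b * d\<^sup>2 - l * a * c * d - (a\<^sup>2 * z + l\<^sup>2 * b) * (z + b) = l\<^sup>2 * c * d - (a * z - l * b)\<^sup>2"
    unfolding dl by (simp add: power2_eq_square algebra_simps)
  also have "(l\<^sup>2 * c * d - (a * z - l * b)\<^sup>2) / d ^ 3 = (l / d)\<^sup>2 * c - (a * z - l * b)\<^sup>2 / d ^ 3"
    using d(2) by (simp add: diff_divide_distrib power_divide power3_eq_cube power2_eq_square)
  finally show "P $ 2 = (L $ 0 / d)\<^sup>2 * A $ 2 - (A $ 0 * L $ 1 - L $ 0 * A $ 1)\<^sup>2 / d ^ 3"
    by (simp add: defs)
qed

lemma Q_mult:
  assumes "finite S" "es x S (k - 1) \<noteq> 0"
  shows "Q x z S k * es (ray x z) S (k - 1) = es (ray x z) S k"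
proof -
  have "es (ray x z) S (k - 1) $ 0 \<noteq> 0" using assms by simp
  then have "inverse (es (ray x z) S (k - 1)) * es (ray x z) S (k - 1) = 1" by (rule inverse_mult_eq_1)
  then show ?thesis unfolding Q_def by (simp only: mult.assoc) simp
qed

lemma Q_nth_0: "finite S \<Longrightarrow> Q x z S k $ 0 = q x S k"
  by (simp add: Q_def q_def divide_inverse)

lemma dq_alt:
  assumes "finite S" "i \<in> S"
  shows "dq x S k i = (es x (S - {i}) (k - 1) * es x S (k - 1) - es x S k * es x (S - {i}) (k - 2)) / (es x S (k - 1))\<^sup>2"
proof -
  have k: "k - 1 - 1 = k - 2" by simp
  have "es x S (k - 1) = x i * es x (S - {i}) (k - 2) + es x (S - {i}) (k - 1)"
    using es_remove[OF assms, of x "k - 1"] by (simp only: k)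
  moreover have "es x S k = x i * es x (S - {i}) (k - 1) + es x (S - {i}) k"
    by (rule es_remove[OF assms])
  ultimately have "es x (S - {i}) (k - 1) * es x S (k - 1) - es x S k * es x (S - {i}) (k - 2)
      = (es x (S - {i}) (k - 1))\<^sup>2 - es x (S - {i}) k * es x (S - {i}) (k - 2)"
    by (simp add: power2_eq_square ring_distribs)
  then show ?thesis by (simp only: dq_def)
qed

lemma Q_nth_1:
  assumes S: "finite S" and ne: "es x S (k - 1) \<noteq> 0"
  shows "Q x z S k $ 1 = (\<Sum>i\<in>S. z i * dq x S k i)"
proof -
  let ?e = "es x S (k - 1)" and ?f = "es x S k"
  have k: "k - 1 - 1 = k - 2" by simp
  have "q x S k * es (ray x z) S (k - 1) $ Suc 0 + Q x z S k $ 1 * ?e = es (ray x z) S k $ Suc 0"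
    using fps_mult_coeffs(2)[OF Q_mult[OF S ne, of z]] S by (simp add: Q_nth_0)
  then have "Q x z S k $ 1 = (es (ray x z) S k $ Suc 0 - q x S k * es (ray x z) S (k - 1) $ Suc 0) / ?e"
    using ne by (simp add: field_simps)
  also have "\<dots> = (\<Sum>i\<in>S. (z i * es x (S - {i}) (k - 1) - q x S k * (z i * es x (S - {i}) (k - 2))) / ?e)"
    by (simp only: es_ray_nth_1[OF S] k sum_distrib_left sum_subtractf sum_divide_distrib[symmetric])
  also have "\<dots> = (\<Sum>i\<in>S. z i * dq x S k i)"
  proof (rule sum.cong[OF refl])
    fix i assume i: "i \<in> S"
    show "(z i * es x (S - {i}) (k - 1) - q x S k * (z i * es x (S - {i}) (k - 2))) / ?e = z i * dq x S k i"
      unfolding dq_alt[OF S i] q_def using ne by (simp add: field_simps power2_eq_square)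
  qed
  finally show ?thesis .
qed

lemma q_denom:
  assumes "finite S" "i \<in> S" "es x (S - {i}) (k - 2) \<noteq> 0"
  shows "x i + q x (S - {i}) (k - 1) = es x S (k - 1) / es x (S - {i}) (k - 2)"
proof -
  have k: "k - 1 - 1 = k - 2" by simp
  have "es x S (k - 1) = x i * es x (S - {i}) (k - 2) + es x (S - {i}) (k - 1)"
    using es_remove[OF assms(1,2), of x "k - 1"] by (simp only: k)
  then show ?thesis unfolding q_def k using assms(3) by (simp add: field_simps)
qed

text \<open>An Euler summand x_i sigma_{k-1}(S - i), divided by sigma_{k-1}, is a parallel sum
  because sigma_{k-1} / sigma_{k-2}(S - i) equals x_i + q_{k-1}(S - i). Only nonvanishing
  denominators are assumed, so the recursion is available before the stability of the cone and
  serves to prove Newton's inequality.\<close>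

lemma Q_recursion:
  assumes S: "finite S" and ne: "es x S (k - 1) \<noteq> 0"
    and ne': "\<And>i. i \<in> S \<Longrightarrow> es x (S - {i}) (k - 2) \<noteq> 0"
  shows "of_int k * Q x z S k $ 1 = (\<Sum>i\<in>S. (q x (S - {i}) (k - 1) / (x i + q x (S - {i}) (k - 1)))\<^sup>2 * z i
      + (x i / (x i + q x (S - {i}) (k - 1)))\<^sup>2 * Q x z (S - {i}) (k - 1) $ 1)"
    and "of_int k * Q x z S k $ 2 = (\<Sum>i\<in>S. (x i / (x i + q x (S - {i}) (k - 1)))\<^sup>2 * Q x z (S - {i}) (k - 1) $ 2
      - (q x (S - {i}) (k - 1) * z i - x i * Q x z (S - {i}) (k - 1) $ 1)\<^sup>2 / (x i + q x (S - {i}) (k - 1)) ^ 3)"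
proof -
  let ?e = "es (ray x z)"
  have k: "k - 1 - 1 = k - 2" by simp
  define P where "P i = ray x z i * ?e (S - {i}) (k - 1) * inverse (?e S (k - 1))" for i
  have "of_int k * ?e S k = (\<Sum>i\<in>S. ray x z i * ?e (S - {i}) (k - 1))" by (rule es_euler[OF S])
  then have sumP: "of_int k * Q x z S k = (\<Sum>i\<in>S. P i)"
    unfolding Q_def P_def by (simp only: mult.assoc[symmetric] sum_distrib_right)
  have inv: "inverse (?e S (k - 1)) * ?e S (k - 1) = 1"
    using ne S by (intro inverse_mult_eq_1) simp
  have P: "P i * (ray x z i + Q x z (S - {i}) (k - 1)) = ray x z i * Q x z (S - {i}) (k - 1)" if i: "i \<in> S" for i
  proof -
    let ?g = "?e (S - {i}) (k - 2)"
    have "?g $ 0 \<noteq> 0" using ne'[OF i] S by simp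
    then have g: "?g \<noteq> 0" by auto
    have Qi: "Q x z (S - {i}) (k - 1) * ?g = ?e (S - {i}) (k - 1)"
      using Q_mult[of "S - {i}" x "k - 1" z, unfolded k] ne'[OF i] S by blast
    have "(ray x z i + Q x z (S - {i}) (k - 1)) * ?g = ?e S (k - 1)"
      using es_remove[OF S i, of "ray x z" "k - 1"] by (simp only: distrib_right Qi k)
    then have "P i * (ray x z i + Q x z (S - {i}) (k - 1)) * ?g
        = ray x z i * ?e (S - {i}) (k - 1) * (inverse (?e S (k - 1)) * ?e S (k - 1))"
      unfolding P_def by (simp only: mult.assoc)
    also have "\<dots> = ray x z i * Q x z (S - {i}) (k - 1) * ?g"
      unfolding inv by (simp only: mult.assoc Qi) simp
    finally show ?thesis using g by simp
  qed
  have d: "x i + q x (S - {i}) (k - 1) = ray x z i $ 0 + Q x z (S - {i}) (k - 1) $ 0"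
    "x i + q x (S - {i}) (k - 1) \<noteq> 0" if i: "i \<in> S" for i
    using q_denom[OF S i ne'[OF i]] ne ne'[OF i] S by (simp_all add: Q_nth_0)
  have co: "of_int k * Q x z S k $ n = (\<Sum>i\<in>S. P i $ n)" for n
  proof -
    have "(of_int k :: real fps) = fps_const (of_int k)" by (simp add: fps_of_int)
    then show ?thesis using arg_cong[OF sumP, of "\<lambda>f. f $ n"] by (simp only: fps_mult_left_const_nth fps_sum_nth)
  qed
  show "of_int k * Q x z S k $ 1 = (\<Sum>i\<in>S. (q x (S - {i}) (k - 1) / (x i + q x (S - {i}) (k - 1)))\<^sup>2 * z i
      + (x i / (x i + q x (S - {i}) (k - 1)))\<^sup>2 * Q x z (S - {i}) (k - 1) $ 1)"
    unfolding co
    by (intro sum.cong refl, subst fps_parallel_coeffs(1)[OF P _ d]) (use S in \<open>simp_all add: Q_nth_0\<close>)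
  show "of_int k * Q x z S k $ 2 = (\<Sum>i\<in>S. (x i / (x i + q x (S - {i}) (k - 1)))\<^sup>2 * Q x z (S - {i}) (k - 1) $ 2
      - (q x (S - {i}) (k - 1) * z i - x i * Q x z (S - {i}) (k - 1) $ 1)\<^sup>2 / (x i + q x (S - {i}) (k - 1)) ^ 3)"
    unfolding co
    by (intro sum.cong refl, subst fps_parallel_coeffs(2)[OF P _ d]) (use S in \<open>simp_all add: Q_nth_0\<close>)
qed

section \<open>Newton's inequality and stability of the cone under deletion\<close>

lemma cone_delete_aux:
  fixes x :: "nat \<Rightarrow> real"
  assumes S: "finite S" and i: "i \<in> S" and c: "cone x S (int k)" and k: "k \<ge> 1"
    and newton: "\<And>j. j < k \<Longrightarrow> cone x (S - {i}) (int j - 1) \<Longrightarrow>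
      (es x (S - {i}) (int j))\<^sup>2 \<ge> es x (S - {i}) (int j + 1) * es x (S - {i}) (int j - 1)"
  shows "cone x (S - {i}) (int k - 1)"
proof -
  have "j < k \<Longrightarrow> es x (S - {i}) (int j) > 0" for j
  proof (induction j rule: less_induct)
    case (less j)
    show ?case
    proof (cases "j = 0")
      case True
      then show ?thesis using S by simp
    next
      case False
      define A B C where ABC: "A = es x (S - {i}) (int j - 1)" "B = es x (S - {i}) (int j)" "C = es x (S - {i}) (int j + 1)"
      have cj: "cone x (S - {i}) (int j - 1)" unfolding cone_def
      proof (intro allI impI)
        fix m assume m: "0 \<le> m" "m \<le> int j - 1"
        then show "0 < es x (S - {i}) m" using less.IH[of "nat m"] less.prems by auto
      qed
      have A: "A > 0" using coneD[OF cj, of "int j - 1"] False by (simp add: ABC)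
      have N: "B\<^sup>2 \<ge> C * A" using newton[OF less.prems cj] by (simp add: ABC)
      have e1: "x i * A + B > 0" using coneD[OF c, of "int j"] less.prems es_remove[OF S i, of x "int j"] by (simp add: ABC)
      have e2: "x i * B + C > 0"
      proof -
        have "int j + 1 - 1 = int j" by simp
        then show ?thesis
          using coneD[OF c, of "int j + 1"] less.prems es_remove[OF S i, of x "int j + 1"] by (simp add: ABC)
      qed
      \<comment> \<open>If B \<le> 0, multiply x_i B + C > 0 by A and x_i A + B > 0 by B. This gives
        C A > - x_i A B \<ge> B^2, against Newton's inequality in degree j.\<close>
      show ?thesis
      proof (rule ccontr)
        assume "\<not> ?thesis"
        then have B: "B \<le> 0" by (simp add: ABC)
        have "(x i * B + C) * A > 0" using e2 A by simp
        moreover have "B * (x i * A + B) \<le> 0" using B e1 by (simp add: mult_nonpos_nonneg)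
        ultimately have "C * A > B\<^sup>2"
          by (simp add: power2_eq_square algebra_simps)
        then show False using N by simp
      qed
    qed
  qed
  then show ?thesis unfolding cone_def
  proof (intro allI impI)
    fix m assume *: "\<And>j. j < k \<Longrightarrow> 0 < es x (S - {i}) (int j)" and m: "0 \<le> m" "m \<le> int k - 1"
    then show "0 < es x (S - {i}) m" using *[of "nat m"] by auto
  qed
qed

text \<open>Adjoin a fresh index i of large value. The derivative of q_{j+1} in that direction has
  Newton's expression for \<open>T\<close> as numerator, and the recursion bounds it below by a
  single square, since its other terms are nonnegative by the induction hypothesis; the factor j + 1
  is the one of the recursion. Positivity is assumed only up to degree j - 1 because the deletion
  lemma applies the inequality to a sigma_j of unknown sign.\<close>

lemma newton_nat:
  fixes x :: "nat \<Rightarrow> real"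
  assumes "finite T" "cone x T (int j - 1)"
  shows "(real j + 1) * ((es x T (int j))\<^sup>2 - es x T (int j + 1) * es x T (int j - 1)) \<ge> (es x T (int j))\<^sup>2"
  using assms
proof (induction j arbitrary: T x rule: less_induct)
  case (less j)
  note T = less.prems(1) and c = less.prems(2)
  have IH': "(es y A (int m))\<^sup>2 - es y A (int m + 1) * es y A (int m - 1) \<ge> 0"
    if "m < j" "finite A" "cone y A (int m - 1)" for m A and y :: "nat \<Rightarrow> real"
  proof -
    have "(real m + 1) * ((es y A (int m))\<^sup>2 - es y A (int m + 1) * es y A (int m - 1)) \<ge> 0"
      using less.IH[OF that] zero_le_power2[of "es y A (int m)"] by linarith
    then show ?thesis by (simp add: zero_le_mult_iff)
  qed
  have del: "cone y (A - {l}) (int m - 1)"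
    if "finite A" "l \<in> A" "cone y A (int m)" "1 \<le> m" "m \<le> j" for m A l and y :: "nat \<Rightarrow> real"
    using cone_delete_aux[OF that(1-4)] IH'[of _ "A - {l}" y] that by (simp only: finite_Diff) fastforce
  show ?case
  proof (cases "j = 0")
    case True
    then show ?thesis using T by simp
  next
    case False
    obtain i where i: "i \<notin> T" using T ex_new_if_finite infinite_UNIV_nat by blast
    define S where "S = insert i T"
    \<comment> \<open>Chosen so that t sigma_{j-1}(T) + sigma_j(T) > 0, which puts the enlarged
      vector into the cone of degree j whatever the sign of sigma_j(T).\<close>
    define t where "t = 1 + \<bar>es x T (int j)\<bar> / es x T (int j - 1)"
    define y where "y = x(i := t)"
    have S: "finite S" "i \<in> S" "S - {i} = T" using T i by (auto simp: S_def)
    have eT: "es y T m = es x T m" for m using i by (intro es_cong) (auto simp: y_def)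
    have eTl: "es y (T - {l}) m = es x (T - {l}) m" for m l using i by (intro es_cong) (auto simp: y_def)
    have pos: "es x T (int j - 1) > 0" using coneD[OF c, of "int j - 1"] False by simp
    have t: "t > 0" "t * es x T (int j - 1) + es x T (int j) > 0"
    proof -
      show "t > 0" unfolding t_def using pos by (simp add: add_pos_nonneg)
      have "t * es x T (int j - 1) = es x T (int j - 1) + \<bar>es x T (int j)\<bar>"
        unfolding t_def using pos by (simp add: distrib_right)
      then show "t * es x T (int j - 1) + es x T (int j) > 0" using pos by linarith
    qed
    have cS: "cone y S (int j)" unfolding cone_def
    proof (intro allI impI)
      fix m :: int assume m: "0 \<le> m" "m \<le> int j"
      have e: "es y S m = t * es x T (m - 1) + es x T m"
        using es_remove[OF S(1,2), of y m] by (simp add: S(3) eT) (simp add: y_def)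
      show "0 < es y S m"
      proof (cases "m = int j \<or> m = 0")
        case True
        then show ?thesis using t e S(1) by auto
      next
        case False
        then have "es x T (m - 1) > 0" "es x T m > 0" using coneD[OF c] m by auto
        then show ?thesis using t e by (simp add: add_pos_pos)
      qed
    qed
    have cSl: "cone y (S - {l}) (int j - 1)" if "l \<in> S" for l
      using del[OF S(1) that cS] False by simp
    define k where "k = int j + 1"
    have k: "k - 1 = int j" "k - 2 = int j - 1" by (simp_all add: k_def)
    define z where "z = (\<lambda>l. if l = i then 1 else 0 :: real)"
    have ne: "es y S (k - 1) \<noteq> 0" using coneD[OF cS, of "int j"] by (simp add: k)
    have ne': "es y (S - {l}) (k - 2) \<noteq> 0" if "l \<in> S" for l
      using coneD[OF cSl[OF that], of "int j - 1"] False by (simp add: k)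
    have Q1: "Q y z A m $ 1 = (if i \<in> A then dq y A m i else 0)" if "finite A" "es y A (m - 1) \<noteq> 0" for A m
    proof -
      have "Q y z A m $ 1 = (\<Sum>l\<in>A. if l = i then dq y A m i else 0)"
        unfolding Q_nth_1[OF that] z_def by (intro sum.cong) auto
      then show ?thesis using that(1) by simp
    qed
    \<comment> \<open>For l = i the deleted set does not contain i, so the derivative is 0. For
      other l its sign is that of Newton's expression of degree j - 1 on
      \<open>T - {l}\<close>.\<close>
    have nonneg: "Q y z (S - {l}) (k - 1) $ 1 \<ge> 0" if l: "l \<in> S" for l
    proof (cases "l = i")
      case True
      then show ?thesis using Q1[of "S - {l}" "k - 1"] ne'[OF l] S(1) by (simp add: k)
    next
      case False
      then have lT: "l \<in> T" using l by (simp add: S_def)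
      have "i \<in> S - {l}" using S False by auto
      moreover have "S - {l} - {i} = T - {l}" using S by auto
      moreover have "(es y (T - {l}) (int j - 1))\<^sup>2 - es y (T - {l}) (int j) * es y (T - {l}) (int j - 2) \<ge> 0"
      proof -
        have j1: "1 \<le> j - 1 \<or> j = 1" using \<open>j \<noteq> 0\<close> by auto
        have "cone x (T - {l}) (int (j - 1) - 1)"
          using j1
        proof
          assume "1 \<le> j - 1"
          then show ?thesis using del[OF T lT, of x "j - 1"] c \<open>j \<noteq> 0\<close> by (simp add: of_nat_diff)
        next
          assume "j = 1"
          then show ?thesis by (simp add: cone_def)
        qed
        from IH'[OF _ _ this] show ?thesis using T \<open>j \<noteq> 0\<close> by (simp add: eTl of_nat_diff)
      qed
      ultimately show ?thesis
        using Q1[of "S - {l}" "k - 1"] ne'[OF l] S(1) by (simp add: k dq_def)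
    qed
    have rec: "of_int k * Q y z S k $ 1 = (\<Sum>i\<in>S. (q y (S - {i}) (k - 1) / (y i + q y (S - {i}) (k - 1)))\<^sup>2 * z i
      + (y i / (y i + q y (S - {i}) (k - 1)))\<^sup>2 * Q y z (S - {i}) (k - 1) $ 1)"
      by (rule Q_recursion(1)[OF S(1) ne]) (rule ne')
    have "of_int k * dq y S k i = of_int k * Q y z S k $ 1" using Q1[OF S(1) ne] S by simp
    also have "\<dots> \<ge> (\<Sum>l\<in>S. if l = i then (q y (S - {i}) (k - 1) / (y i + q y (S - {i}) (k - 1)))\<^sup>2 else 0)"
      unfolding rec
    proof (rule sum_mono)
      fix l assume "l \<in> S"
      then have "Q y z (S - {l}) (k - 1) $ 1 \<ge> 0" by (rule nonneg)
      then have "(y l / (y l + q y (S - {l}) (k - 1)))\<^sup>2 * Q y z (S - {l}) (k - 1) $ 1 \<ge> 0" by simp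
      then show "(if l = i then (q y (S - {i}) (k - 1) / (y i + q y (S - {i}) (k - 1)))\<^sup>2 else 0)
          \<le> (q y (S - {l}) (k - 1) / (y l + q y (S - {l}) (k - 1)))\<^sup>2 * z l
            + (y l / (y l + q y (S - {l}) (k - 1)))\<^sup>2 * Q y z (S - {l}) (k - 1) $ 1"
        by (cases "l = i") (auto simp: z_def)
    qed
    finally have "of_int k * dq y S k i \<ge> (q y T (k - 1) / (y i + q y T (k - 1)))\<^sup>2"
      using S by simp
    moreover have "q y T (k - 1) / (y i + q y T (k - 1)) = es y T (int j) / es y S (int j)"
    proof -
      have "y i + q y T (k - 1) = es y S (int j) / es y T (int j - 1)"
        using q_denom[OF S(1,2) ne'[OF S(2)]] by (simp add: S(3) k)
      moreover have "q y T (k - 1) = es y T (int j) / es y T (int j - 1)" by (simp add: q_def k)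
      ultimately show ?thesis using pos by (simp add: eT)
    qed
    ultimately have "(es y T (int j) / es y S (int j))\<^sup>2 \<le>
        (real j + 1) * (((es y T (int j))\<^sup>2 - es y T (int j + 1) * es y T (int j - 1)) / (es y S (int j))\<^sup>2)"
      by (simp add: dq_def S(3) k) (simp add: k_def)
    moreover have "es y S (int j) > 0" using coneD[OF cS, of "int j"] by simp
    ultimately show ?thesis by (simp add: eT power_divide divide_le_cancel)
  qed
qed

lemma newton:
  fixes x :: "nat \<Rightarrow> real"
  assumes "finite T" "0 \<le> j" "cone x T (j - 1)"
  shows "(of_int j + 1) * ((es x T j)\<^sup>2 - es x T (j + 1) * es x T (j - 1)) \<ge> (es x T j)\<^sup>2"
  using newton_nat[of T x "nat j"] assms by simp

lemma newton_weak:
  fixes x :: "nat \<Rightarrow> real"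
  assumes "finite T" "0 \<le> j" "cone x T (j - 1)"
  shows "es x T (j + 1) * es x T (j - 1) \<le> (es x T j)\<^sup>2"
proof -
  have "(of_int j + 1) * ((es x T j)\<^sup>2 - es x T (j + 1) * es x T (j - 1)) \<ge> 0"
    using newton[OF assms] zero_le_power2[of "es x T j"] by linarith
  moreover have "(of_int j + 1 :: real) > 0" using assms(2) by simp
  ultimately show ?thesis by (simp add: zero_le_mult_iff)
qed

lemma cone_delete:
  fixes x :: "nat \<Rightarrow> real"
  assumes "finite S" "i \<in> S" "cone x S k"
  shows "cone x (S - {i}) (k - 1)"
proof (cases "k \<ge> 1")
  case True
  define n where "n = nat k"
  have n: "k = int n" "n \<ge> 1" using True by (auto simp: n_def)
  show ?thesis
    using cone_delete_aux[OF assms(1,2) assms(3)[unfolded n] n(2)] newton_weak[of "S - {i}" "int _" x] assms(1)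
    by (simp add: n)
next
  case False
  then show ?thesis by (simp add: cone_def)
qed

text \<open>The square kept in \<open>newton\<close> becomes an explicit lower bound for the
  derivative. It is the origin of the lower bound for \<open>G\<close>, which has to compete with
  the mixed terms.\<close>

lemma dq_lower:
  fixes x :: "nat \<Rightarrow> real"
  assumes S: "finite S" "i \<in> S" and c: "cone x S (k - 1)" and k: "k \<ge> 1"
  shows "of_int k * dq x S k i \<ge> (es x (S - {i}) (k - 1) / es x S (k - 1))\<^sup>2"
proof -
  have "cone x (S - {i}) (k - 1 - 1)" by (rule cone_delete[OF S c])
  from newton[OF _ _ this] have "of_int k * ((es x (S - {i}) (k - 1))\<^sup>2 - es x (S - {i}) k * es x (S - {i}) (k - 2))
      \<ge> (es x (S - {i}) (k - 1))\<^sup>2" using S k by simp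
  then have "(es x (S - {i}) (k - 1))\<^sup>2 / (es x S (k - 1))\<^sup>2
    \<le> (of_int k * ((es x (S - {i}) (k - 1))\<^sup>2 - es x (S - {i}) k * es x (S - {i}) (k - 2))) / (es x S (k - 1))\<^sup>2"
    by (rule divide_right_mono) simp
  then show ?thesis by (simp add: dq_def power_divide)
qed

lemma dq_nonneg:
  fixes x :: "nat \<Rightarrow> real"
  assumes "finite S" "i \<in> S" "cone x S (k - 1)" "k \<ge> 1"
  shows "dq x S k i \<ge> 0"
proof -
  have "of_int k * dq x S k i \<ge> 0"
    using dq_lower[OF assms] zero_le_power2[of "es x (S - {i}) (k - 1) / es x S (k - 1)"] by linarith
  then show ?thesis using assms(4) by (simp add: zero_le_mult_iff)
qed

section \<open>Concavity, monotonicity and size of the quotients q_k\<close>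

lemma cone_pos2:
  fixes x :: "nat \<Rightarrow> real"
  assumes "finite S" "cone x S (k - 1)" "k \<ge> 2"
  shows "es x S (k - 1) > 0" "\<And>i. i \<in> S \<Longrightarrow> es x (S - {i}) (k - 2) > 0"
    "\<And>i. i \<in> S \<Longrightarrow> x i + q x (S - {i}) (k - 1) > 0"
proof -
  show 1: "es x S (k - 1) > 0" using coneD[OF assms(2), of "k - 1"] assms(3) by simp
  show 2: "es x (S - {i}) (k - 2) > 0" if "i \<in> S" for i
    using coneD[OF cone_delete[OF assms(1) that assms(2)], of "k - 2"] assms(3) by simp
  show "x i + q x (S - {i}) (k - 1) > 0" if "i \<in> S" for i
    using q_denom[OF assms(1) that] 1 2[OF that] by simp
qed

lemma Q_one:
  assumes "finite S"
  shows "Q x z S 1 = es (ray x z) S 1"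
  using assms by (simp add: Q_def)

lemma Q_one_nth_2: "finite S \<Longrightarrow> Q x z S 1 $ 2 = 0"
  using es_ray_nth_2[of S x z 1] by (simp add: Q_one)

lemma q_one: "finite S \<Longrightarrow> q x S 1 = sum x S"
  by (simp add: q_def es_1)

lemma Q_concave_nat:
  fixes x :: "nat \<Rightarrow> real"
  shows "finite S \<Longrightarrow> cone x S (int k) \<Longrightarrow> Q x z S (int k + 1) $ 2 \<le> 0"
proof (induction k arbitrary: S)
  case 0
  then show ?case by (simp add: Q_one_nth_2)
next
  case (Suc k)
  let ?k = "int (Suc k) + 1"
  have k: "?k - 1 = int (Suc k)" "?k - 2 = int k" "?k - 1 = int k + 1" by simp_all
  have c: "cone x S (?k - 1)" using Suc.prems k by simp
  note pos = cone_pos2[OF Suc.prems(1) c]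
  have "of_int ?k * Q x z S ?k $ 2 = (\<Sum>i\<in>S. (x i / (x i + q x (S - {i}) (?k - 1)))\<^sup>2 * Q x z (S - {i}) (?k - 1) $ 2
      - (q x (S - {i}) (?k - 1) * z i - x i * Q x z (S - {i}) (?k - 1) $ 1)\<^sup>2 / (x i + q x (S - {i}) (?k - 1)) ^ 3)"
    by (rule Q_recursion(2)[OF Suc.prems(1)]) (use pos in \<open>fastforce+\<close>)
  also have "\<dots> \<le> 0"
  proof (rule sum_nonpos)
    fix i assume i: "i \<in> S"
    have "cone x (S - {i}) (int k)" using cone_delete[OF Suc.prems(1) i c] by simp
    then have "Q x z (S - {i}) (?k - 1) $ 2 \<le> 0" using Suc.IH[of "S - {i}"] Suc.prems(1) unfolding k(3) by blast
    then have "(x i / (x i + q x (S - {i}) (?k - 1)))\<^sup>2 * Q x z (S - {i}) (?k - 1) $ 2 \<le> 0"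
      by (simp add: mult_nonneg_nonpos)
    moreover have "(q x (S - {i}) (?k - 1) * z i - x i * Q x z (S - {i}) (?k - 1) $ 1)\<^sup>2 / (x i + q x (S - {i}) (?k - 1)) ^ 3 \<ge> 0"
    proof -
      have "x i + q x (S - {i}) (?k - 1) > 0" using pos(3)[OF _ i] by simp
      then show ?thesis by (intro divide_nonneg_pos zero_le_power2 zero_less_power)
    qed
    ultimately show "(x i / (x i + q x (S - {i}) (?k - 1)))\<^sup>2 * Q x z (S - {i}) (?k - 1) $ 2
      - (q x (S - {i}) (?k - 1) * z i - x i * Q x z (S - {i}) (?k - 1) $ 1)\<^sup>2 / (x i + q x (S - {i}) (?k - 1)) ^ 3 \<le> 0"
      by linarith
  qed
  finally have "of_int ?k * Q x z S ?k $ 2 \<le> 0" .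
  moreover have "(0::real) < of_int ?k" by simp
  ultimately show ?case by (simp only: mult_le_0_iff) linarith
qed

lemma Q_concave:
  fixes x :: "nat \<Rightarrow> real"
  assumes "finite S" "cone x S (k - 1)" "k \<ge> 1"
  shows "Q x z S k $ 2 \<le> 0"
  using Q_concave_nat[of S x "nat (k - 1)" z] assms by simp

text \<open>All summands of the recursion are nonpositive: keep the one of \<open>i\<close> and drop
  its square. Deleting one variable thus costs an explicit factor, and
  \<open>Q_concave_chain\<close> iterates this.\<close>

lemma Q_concave_delete:
  fixes x :: "nat \<Rightarrow> real"
  assumes S: "finite S" and c: "cone x S (k - 1)" and k2: "k \<ge> 2" and i: "i \<in> S"
  shows "of_int k * Q x z S k $ 2 \<le> (x i / (x i + q x (S - {i}) (k - 1)))\<^sup>2 * Q x z (S - {i}) (k - 1) $ 2"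
proof -
  note pos = cone_pos2[OF S c k2]
  define f where "f l = (x l / (x l + q x (S - {l}) (k - 1)))\<^sup>2 * Q x z (S - {l}) (k - 1) $ 2
      - (q x (S - {l}) (k - 1) * z l - x l * Q x z (S - {l}) (k - 1) $ 1)\<^sup>2 / (x l + q x (S - {l}) (k - 1)) ^ 3" for l
  have le: "f l \<le> (x l / (x l + q x (S - {l}) (k - 1)))\<^sup>2 * Q x z (S - {l}) (k - 1) $ 2" if l: "l \<in> S" for l
  proof -
    have "(q x (S - {l}) (k - 1) * z l - x l * Q x z (S - {l}) (k - 1) $ 1)\<^sup>2 / (x l + q x (S - {l}) (k - 1)) ^ 3 \<ge> 0"
      using pos(3)[OF l] by (intro divide_nonneg_pos zero_le_power2 zero_less_power)
    then show ?thesis by (simp only: f_def)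
  qed
  have np: "f l \<le> 0" if l: "l \<in> S" for l
  proof -
    have "Q x z (S - {l}) (k - 1) $ 2 \<le> 0"
      by (rule Q_concave) (use S cone_delete[OF S l c] k2 in simp_all)
    then have "(x l / (x l + q x (S - {l}) (k - 1)))\<^sup>2 * Q x z (S - {l}) (k - 1) $ 2 \<le> 0"
      by (simp add: mult_nonneg_nonpos)
    then show ?thesis using le[OF l] by linarith
  qed
  have "of_int k * Q x z S k $ 2 = sum f S"
    unfolding f_def by (rule Q_recursion(2)[OF S]) (use pos in \<open>fastforce+\<close>)
  also have "\<dots> = f i + sum f (S - {i})" by (rule sum.remove[OF S i])
  also have "\<dots> \<le> f i" using sum_nonpos[of "S - {i}" f] np by simp
  finally show ?thesis using le[OF i] by linarith
qed

text \<open>The right-hand side is the limit of the left-hand side as x i tends to infinity, and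
  \<open>q\<close> does not decrease in x i. Algebraically it is \<open>dq\<close> \<ge> 0 in the
  form \<open>dq_alt\<close>, with denominators cleared.\<close>

lemma q_le_delete:
  fixes x :: "nat \<Rightarrow> real"
  assumes S: "finite S" and c: "cone x S (k - 1)" and k2: "k \<ge> 2" and i: "i \<in> S"
  shows "q x S k \<le> q x (S - {i}) (k - 1)"
proof -
  note pos = cone_pos2[OF S c k2]
  have "dq x S k i \<ge> 0" using dq_nonneg[OF S i c] k2 by simp
  then have "es x S k * es x (S - {i}) (k - 2) \<le> es x (S - {i}) (k - 1) * es x S (k - 1)"
    using pos(1) unfolding dq_alt[OF S i] by (simp add: zero_le_divide_iff)
  moreover have "k - 1 - 1 = k - 2" by simp
  ultimately show ?thesis using pos(1) pos(2)[OF i] unfolding q_def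
    by (simp add: field_simps)
qed

lemma q_Suc_le:
  fixes x :: "nat \<Rightarrow> real"
  assumes "finite S" "cone x S k" "k \<ge> 1"
  shows "q x S (k + 1) \<le> q x S k"
proof -
  have "es x S (k + 1) * es x S (k - 1) \<le> es x S k * es x S k"
    using newton_weak[of S k x] assms cone_mono[OF assms(2), of "k - 1"] by (simp add: power2_eq_square)
  moreover have "es x S k > 0" "es x S (k - 1) > 0" using coneD[OF assms(2)] assms(3) by simp_all
  ultimately show ?thesis by (simp add: q_def field_simps)
qed

lemma q_anti_nat:
  fixes x :: "nat \<Rightarrow> real"
  assumes S: "finite S" and j: "j \<ge> 1"
  shows "cone x S (j + int m - 1) \<Longrightarrow> q x S (j + int m) \<le> q x S j"
proof (induction m)
  case (Suc m)
  have c: "cone x S (j + int m)" using Suc.prems by (simp add: algebra_simps)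
  have "q x S (j + int m + 1) \<le> q x S (j + int m)" by (rule q_Suc_le[OF S c]) (use j in simp)
  also have "\<dots> \<le> q x S j" by (rule Suc.IH) (rule cone_mono[OF c], simp)
  finally show ?case by (simp add: algebra_simps)
qed simp

lemma q_anti:
  fixes x :: "nat \<Rightarrow> real"
  assumes "finite S" "1 \<le> j" "j \<le> k" "cone x S (k - 1)"
  shows "q x S k \<le> q x S j"
  using q_anti_nat[OF assms(1,2), of x "nat (k - j)"] assms by simp

lemma q_pos: "cone x S k \<Longrightarrow> k \<ge> 1 \<Longrightarrow> q x S k > 0"
  unfolding q_def by (intro divide_pos_pos) (simp_all add: coneD)

lemma q_sum_parallel:
  fixes x :: "nat \<Rightarrow> real"
  assumes S: "finite S" and c: "cone x S (k - 1)" and k2: "k \<ge> 2"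
  shows "of_int k * q x S k = (\<Sum>i\<in>S. x i * q x (S - {i}) (k - 1) / (x i + q x (S - {i}) (k - 1)))"
proof -
  note pos = cone_pos2[OF S c k2]
  have k: "k - 1 - 1 = k - 2" by simp
  have "of_int k * q x S k = (\<Sum>i\<in>S. x i * es x (S - {i}) (k - 1) / es x S (k - 1))"
    using es_euler[OF S, of k x] by (simp add: q_def sum_divide_distrib)
  also have "\<dots> = (\<Sum>i\<in>S. x i * q x (S - {i}) (k - 1) / (x i + q x (S - {i}) (k - 1)))"
  proof (rule sum.cong[OF refl])
    fix i assume i: "i \<in> S"
    have "x i + q x (S - {i}) (k - 1) = es x S (k - 1) / es x (S - {i}) (k - 2)"
      using q_denom[OF S i] pos(2)[OF i] by simp
    then show "x i * es x (S - {i}) (k - 1) / es x S (k - 1) = x i * q x (S - {i}) (k - 1) / (x i + q x (S - {i}) (k - 1))"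
      using pos(1) pos(2)[OF i] unfolding q_def k by simp
  qed
  finally show ?thesis .
qed

lemma parallel_le: "a + b > 0 \<Longrightarrow> a * b / (a + b) \<le> a" "a + b > 0 \<Longrightarrow> a * b / (a + b) \<le> b" for a b :: real
  by (simp_all add: field_simps)

text \<open>A parallel sum is at most each of its two terms. Outside \<open>T\<close> use x i \<le>
  L; inside \<open>T\<close> use the quotient with i deleted, which has one exceptional index fewer.
  Hence k arbitrarily large entries cannot make q_{k+1} large.\<close>

lemma q_upper:
  fixes x :: "nat \<Rightarrow> real"
  assumes "finite S" "cone x S (int k)" "T \<subseteq> S" "card T = k" "L \<ge> 0" "\<And>i. i \<in> S - T \<Longrightarrow> x i \<le> L"
  shows "q x S (int k + 1) \<le> real (card S) * L"
  using assms
proof (induction k arbitrary: S T)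
  case 0
  then have "T = {}" using finite_subset[of T S] by simp
  then have "sum x S \<le> (\<Sum>i\<in>S. L)" using 0 by (intro sum_mono) auto
  then show ?case using 0 by (simp add: q_one)
next
  case (Suc k)
  let ?k = "int (Suc k) + 1"
  have c: "cone x S (?k - 1)" using Suc.prems(2) by simp
  have k2: "?k \<ge> 2" by simp
  have finT: "finite T" using Suc.prems finite_subset by blast
  note pos = cone_pos2[OF Suc.prems(1) c k2]
  let ?f = "\<lambda>i. x i * q x (S - {i}) (?k - 1) / (x i + q x (S - {i}) (?k - 1))"
  have T: "?f i \<le> real (card S) * L" if i: "i \<in> T" for i
  proof -
    have iS: "i \<in> S" using i Suc.prems by auto
    have "?f i \<le> q x (S - {i}) (?k - 1)" by (rule parallel_le(2)) (rule pos(3)[OF iS])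
    also have k1: "?k - 1 = int k + 1" by simp
    also have "q x (S - {i}) (int k + 1) \<le> real (card (S - {i})) * L"
    proof (rule Suc.IH[of _ "T - {i}"])
      show "cone x (S - {i}) (int k)" using cone_delete[OF Suc.prems(1) iS c] by simp
      show "card (T - {i}) = k" using Suc.prems(4) i finT by simp
    qed (use Suc.prems in auto)
    also have "\<dots> \<le> real (card S) * L" using Suc.prems(1,5) by (intro mult_right_mono) (simp_all add: card_mono)
    finally show ?thesis unfolding k1 .
  qed
  have U: "?f i \<le> L" if i: "i \<in> S - T" for i
  proof -
    have "?f i \<le> x i" by (rule parallel_le(1)) (use pos(3) i in blast)
    then show ?thesis using Suc.prems(6)[OF i] by linarith
  qed
  have "of_int ?k * q x S ?k = (\<Sum>i\<in>S - T. ?f i) + (\<Sum>i\<in>T. ?f i)"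
    unfolding q_sum_parallel[OF Suc.prems(1) c k2] by (rule sum.subset_diff[OF Suc.prems(3,1)])
  also have "\<dots> \<le> (\<Sum>i\<in>S - T. L) + (\<Sum>i\<in>T. real (card S) * L)"
    by (intro add_mono sum_mono T U)
  also have "\<dots> = real (card (S - T)) * L + real (Suc k) * (real (card S) * L)" using Suc.prems by simp
  also have "\<dots> \<le> real (card S) * L + real (Suc k) * (real (card S) * L)"
    using Suc.prems(1,5) by (intro add_mono mult_right_mono order_refl) (simp_all add: card_mono)
  also have "\<dots> = of_int ?k * (real (card S) * L)" by (simp add: algebra_simps)
  finally have "of_int ?k * q x S ?k \<le> of_int ?k * (real (card S) * L)" .
  then show ?case by (rule mult_left_le_imp_le) simp
qed

lemma q_denom_step:
  fixes x :: "nat \<Rightarrow> real"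
  assumes S: "finite S" and i: "i \<in> S" and c: "cone x S j" and j: "j \<ge> 2"
  shows "x i + q x (S - {i}) j = q x S j / q x (S - {i}) (j - 1) * (x i + q x (S - {i}) (j - 1))"
    and "x i + q x (S - {i}) j = q x S j * (1 + x i / q x (S - {i}) (j - 1))"
proof -
  have d: "cone x (S - {i}) (j - 1)" by (rule cone_delete[OF S i c])
  have k: "j - 1 - 1 = j - 2" "j + 1 - 2 = j - 1" "j + 1 - 1 = j" by simp_all
  have p: "es x S j > 0" "es x S (j - 1) > 0" "es x (S - {i}) (j - 1) > 0" "es x (S - {i}) (j - 2) > 0"
    using coneD[OF c] coneD[OF d] j by simp_all
  have a: "x i + q x (S - {i}) j = es x S j / es x (S - {i}) (j - 1)"
    using q_denom[OF S i, of x "j + 1"] p unfolding k by simp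
  have b: "x i + q x (S - {i}) (j - 1) = es x S (j - 1) / es x (S - {i}) (j - 2)"
    using q_denom[OF S i, of x "j"] p by simp
  show 1: "x i + q x (S - {i}) j = q x S j / q x (S - {i}) (j - 1) * (x i + q x (S - {i}) (j - 1))"
    unfolding a b unfolding q_def k using p by (simp add: field_simps)
  have "q x (S - {i}) (j - 1) > 0" using d j by (intro q_pos) simp_all
  then show "x i + q x (S - {i}) j = q x S j * (1 + x i / q x (S - {i}) (j - 1))"
    unfolding 1 by (simp add: field_simps)
qed

text \<open>The denominator sigma_{m+1} / sigma_m(S - i) must stay away from 0 even for negative x
  i. \<open>q_denom_step\<close> writes it in two ways. If the deleted quotient \<open>?a\<close> is
  at least 2K + 2c, a negative x i destroys at most half of the factor; otherwise the degree is
  lowered at the price of a factor c / (2K + 2c).\<close>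

lemma q_denom_lower:
  fixes x :: "nat \<Rightarrow> real"
  assumes S: "finite S" and i: "i \<in> S" and c0: "c > 0" and K: "K \<ge> 0" "x i \<ge> - K"
  shows "cone x S (int m + 1) \<Longrightarrow> q x S (int m + 1) \<ge> c \<Longrightarrow>
    x i + q x (S - {i}) (int m + 1) \<ge> c / 2 * (c / (2 * K + 2 * c)) ^ m"
proof (induction m)
  case 0
  then have "x i + q x (S - {i}) 1 = q x S 1" using S i by (simp add: q_one sum.remove)
  then show ?case using 0 c0 by simp
next
  case (Suc m)
  let ?j = "int (Suc m) + 1"
  let ?r = "c / (2 * K + 2 * c)"
  have r: "0 < ?r" "?r \<le> 1" using c0 K by (simp_all add: field_simps)
  have j: "?j - 1 = int m + 1" "?j \<ge> 2" by simp_all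
  let ?a = "q x (S - {i}) (?j - 1)"
  have cm: "cone x S (?j - 1)" by (rule cone_mono[OF Suc.prems(1)]) simp
  have a: "?a \<ge> c" using q_le_delete[OF S cm j(2) i] Suc.prems(2) by linarith
  note step = q_denom_step[OF S i Suc.prems(1) j(2)]
  have rm: "c / 2 * ?r ^ Suc m \<le> c / 2" 
    using mult_left_mono[OF power_le_one[of ?r "Suc m"], of "c / 2"] r c0 by linarith
  show ?case
  proof (cases "?a \<ge> 2 * K + 2 * c")
    case True
    then have "x i / ?a \<ge> - (1 / 2)" using K c0 by (simp add: field_simps)
    then have "1 / 2 \<le> 1 + x i / ?a" by linarith
    then have "c * (1 / 2) \<le> q x S ?j * (1 + x i / ?a)" using Suc.prems(2) c0 by (intro mult_mono) simp_all
    then show ?thesis using rm unfolding step(2) by linarith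
  next
    case False
    have "c \<le> q x S (int m + 1)" using q_anti[OF S, of "int m + 1" ?j x] cm Suc.prems(2) by simp
    then have IH: "x i + ?a \<ge> c / 2 * ?r ^ m" using cm unfolding j(1) by (rule Suc.IH[rotated])
    have "?r \<le> q x S ?j / ?a" using False a c0 Suc.prems(2) by (intro frac_le) simp_all
    then have "?r * (c / 2 * ?r ^ m) \<le> q x S ?j / ?a * (x i + ?a)"
      using IH r c0 Suc.prems(2) a by (intro mult_mono) (simp_all add: divide_nonneg_nonneg)
    then show ?thesis unfolding step(1) by (simp add: mult_ac)
  qed
qed

section \<open>A priori estimates\<close>

text \<open>\<open>T\<close> collects the entries that may be arbitrarily large; the estimates below
  are uniform in them. The lower bound c keeps the vector away from the boundary of the cone of
  degree \<open>card T\<close>. It is guarded because for empty \<open>T\<close> the quotient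
  sigma_0 / sigma_{-1} is 1 / 0 = 0.\<close>

definition nondeg :: "nat \<Rightarrow> real \<Rightarrow> real \<Rightarrow> real \<Rightarrow> (nat \<Rightarrow> real) \<Rightarrow> nat set \<Rightarrow> nat set \<Rightarrow> bool" where
  "nondeg N c K L x S T \<longleftrightarrow> finite S \<and> card S \<le> N \<and> T \<subseteq> S \<and> cone x S (int (card T)) \<and>
     (card T \<ge> 1 \<longrightarrow> q x S (int (card T)) \<ge> c) \<and> (\<forall>i\<in>S. x i \<ge> - K) \<and> (\<forall>i\<in>S - T. x i \<le> L)"

lemma nondeg_denom:
  assumes "c > 0" "K \<ge> 0" "nondeg N c K L x S T" "card T = Suc m" "i \<in> S"
  shows "x i + q x (S - {i}) (int (card T)) \<ge> c / 2 * (c / (2 * K + 2 * c)) ^ m"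
  using q_denom_lower[of S i c K x m] assms by (simp add: nondeg_def add.commute)

lemma nondeg_remove:
  assumes "nondeg N c K L x S T" "i \<in> T"
  shows "nondeg N c K L x (S - {i}) (T - {i})"
proof -
  have S: "finite S" "i \<in> S" "finite T" and c: "cone x S (int (card T))" "card T \<ge> 1"
    using assms finite_subset by (auto simp: nondeg_def Suc_le_eq card_gt_0_iff)
  have cT: "card (T - {i}) = card T - 1" "int (card T - 1) = int (card T) - 1"
    using S(3) assms(2) c(2) by simp_all
  have "card (S - {i}) \<le> card S" using S by (intro card_mono) auto
  moreover have "q x (S - {i}) (int (card T - 1)) \<ge> q x S (int (card T))" if "card T - 1 \<ge> 1"
    unfolding cT(2) using that by (intro q_le_delete[OF S(1)] S(2) cone_mono[OF c(1)]) linarith+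
  moreover have "cone x (S - {i}) (int (card T - 1))"
    unfolding cT(2) by (rule cone_delete[OF S(1,2) c(1)])
  ultimately show ?thesis using assms unfolding nondeg_def cT(1) by force
qed

text \<open>Degree j = card T dominates: higher degrees exceed it at most by a factor that does not
  see the large entries. The clause with a bounded index removed is included because the induction
  on s needs both statements together.\<close>

definition ebd :: "nat \<Rightarrow> real \<Rightarrow> real \<Rightarrow> real \<Rightarrow> nat \<Rightarrow> nat \<Rightarrow> real \<Rightarrow> bool" where
  "ebd N c K L j s C \<longleftrightarrow> C \<ge> 0 \<and> (\<forall>x S T. nondeg N c K L x S T \<longrightarrow> card T = j \<longrightarrow>
     \<bar>es x S (int j + int s)\<bar> \<le> C * es x S (int j) \<and>
     (\<forall>i\<in>S - T. \<bar>es x (S - {i}) (int j + int s - 1)\<bar> \<le> C * es x S (int j)))"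

text \<open>Induction on j, then on s. A bounded index is removed by \<open>es_remove\<close>, which
  passes from s to s + 1. An index of \<open>T\<close> is removed by lowering j, and the factor x i
  is paid for by |x_i| sigma_{j-1}(S - i) \<le> const * sigma_j. Euler's identity adds up the
  summands.\<close>

lemma ebd_exists:
  assumes cKL: "c > 0" "K \<ge> 0" "L \<ge> 0"
  shows "\<exists>C. ebd N c K L j s C"
proof (induction j arbitrary: s rule: less_induct)
  case (less j)
  note IHj = less.IH
  show ?case
  proof (induction s)
    case 0
    \<comment> \<open>The bound of \<open>nondeg_denom\<close>; for j \<ge> 1 it says d
      sigma_{j-1}(S - i) \<le> sigma_j(S).\<close>
    define d where "d = c / 2 * (c / (2 * K + 2 * c)) ^ (j - 1)"
    have d: "d > 0" unfolding d_def using cKL by simp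
    have "ebd N c K L j 0 (1 + 1 / d)" unfolding ebd_def
    proof (intro conjI allI impI ballI)
      show "0 \<le> 1 + 1 / d" using d by simp
    next
      fix x S T assume H: "nondeg N c K L x S T" and T: "card T = j"
      have p: "es x S (int j) > 0" using coneD[of x S "int j" "int j"] H T by (simp add: nondeg_def)
      then have p': "1 / d * es x S (int j) \<ge> 0" using d by simp
      show "\<bar>es x S (int j + int 0)\<bar> \<le> (1 + 1 / d) * es x S (int j)"
        using p p' by (simp add: distrib_right)
      fix i assume i: "i \<in> S - T"
      show "\<bar>es x (S - {i}) (int j + int 0 - 1)\<bar> \<le> (1 + 1 / d) * es x S (int j)"
      proof (cases "j = 0")
        case True
        then show ?thesis using p p' by (simp add: distrib_right)
      next
        case False
        have S: "finite S" "i \<in> S" and c: "cone x S (int j)" using H T i by (auto simp: nondeg_def)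
        have pi: "es x (S - {i}) (int j - 1) > 0"
          using coneD[OF cone_delete[OF S c], of "int j - 1"] False by simp
        have k: "int j + 1 - 2 = int j - 1" "int j + 1 - 1 = int j" by simp_all
        have "d \<le> x i + q x (S - {i}) (int j)"
          using nondeg_denom[OF cKL(1,2) H, of "j - 1" i] S T False by (simp add: d_def)
        also have "\<dots> = es x S (int j) / es x (S - {i}) (int j - 1)"
          using q_denom[OF S, of x "int j + 1"] pi unfolding k by simp
        finally have "d * es x (S - {i}) (int j - 1) \<le> es x S (int j)" using pi by (simp add: field_simps)
        then have "es x (S - {i}) (int j - 1) \<le> 1 / d * es x S (int j)" using d by (simp add: field_simps)
        then show ?thesis using pi p by (simp add: distrib_right)
      qed
    qed
    then show ?case by blast
  next
    case (Suc s)
    then obtain C where C: "ebd N c K L j s C" by blast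
    define C1 where "C1 = C + (K + L) * C"
    have C0: "C \<ge> 0" "C1 \<ge> 0" using C cKL by (auto simp: ebd_def C1_def)
    have part2: "\<bar>es x (S - {i}) (int j + int (Suc s) - 1)\<bar> \<le> C1 * es x S (int j)"
      if H: "nondeg N c K L x S T" and T: "card T = j" and i: "i \<in> S - T" for x S T i
    proof -
      have S: "finite S" "i \<in> S" using H i by (auto simp: nondeg_def)
      have xi: "\<bar>x i\<bar> \<le> K + L" 
      proof -
        have "- K \<le> x i" "x i \<le> L" using H i by (auto simp: nondeg_def)
        then show ?thesis using cKL by (simp add: abs_le_iff)
      qed
      have b: "\<bar>es x S (int j + int s)\<bar> \<le> C * es x S (int j)"
        "\<bar>es x (S - {i}) (int j + int s - 1)\<bar> \<le> C * es x S (int j)"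
        using C H T i by (auto simp: ebd_def)
      have "es x (S - {i}) (int j + int s) = es x S (int j + int s) - x i * es x (S - {i}) (int j + int s - 1)"
        using es_remove[OF S, of x "int j + int s"] by simp
      also have "\<bar>\<dots>\<bar> \<le> \<bar>es x S (int j + int s)\<bar> + \<bar>x i\<bar> * \<bar>es x (S - {i}) (int j + int s - 1)\<bar>"
        using abs_triangle_ineq4 by (simp flip: abs_mult)
      also have "\<dots> \<le> C * es x S (int j) + (K + L) * (C * es x S (int j))"
        using b xi cKL by (intro add_mono mult_mono) auto
      finally show ?thesis by (simp add: C1_def algebra_simps)
    qed
    define d where "d = c / 2 * (c / (2 * K + 2 * c)) ^ (j - 1)"
    have d: "d > 0" unfolding d_def using cKL by simp
    obtain A B where AB: "j \<ge> 1 \<Longrightarrow> ebd N c K L (j - 1) 1 A" "j \<ge> 1 \<Longrightarrow> ebd N c K L (j - 1) (Suc s) B"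
      "A \<ge> 0" "B \<ge> 0"
    proof (cases "j \<ge> 1")
      case True
      then obtain A B where "ebd N c K L (j - 1) 1 A" "ebd N c K L (j - 1) (Suc s) B"
        using IHj[of "j - 1"] by (metis diff_less less_le_trans zero_less_one)
      moreover from this have "A \<ge> 0" "B \<ge> 0" unfolding ebd_def by blast+
      ultimately show ?thesis using that[of A B] by blast
    next
      case False
      then show ?thesis using that[of 0 0] by auto
    qed
    define C2 where "C2 = (K + L) * C1 + B * (1 + A / d)"
    have C20: "(K + L) * C1 \<ge> 0" "B * (1 + A / d) \<ge> 0" using C0 cKL AB d by simp_all
    have part1: "\<bar>es x S (int j + int (Suc s))\<bar> \<le> N * C2 * es x S (int j)"
      if H: "nondeg N c K L x S T" and T: "card T = j" for x S T
    proof -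
      let ?e = "es x S (int j)"
      have S: "finite S" and TS: "T \<subseteq> S" and cn: "card S \<le> N" and c: "cone x S (int j)"
        using H T by (auto simp: nondeg_def)
      have p: "?e > 0" using coneD[OF c] by simp
      have each: "\<bar>x i * es x (S - {i}) (int j + int (Suc s) - 1)\<bar> \<le> C2 * ?e" if i: "i \<in> S" for i
      proof (cases "i \<in> T")
        case False
        then have iT: "i \<in> S - T" using i by simp
        have xi: "\<bar>x i\<bar> \<le> K + L" 
        proof -
          have "- K \<le> x i" "x i \<le> L" using H iT by (auto simp: nondeg_def)
          then show ?thesis using cKL by (simp add: abs_le_iff)
        qed
        have "\<bar>x i * es x (S - {i}) (int j + int (Suc s) - 1)\<bar> \<le> (K + L) * (C1 * ?e)"
          unfolding abs_mult using part2[OF H T iT] xi cKL by (intro mult_mono) auto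
        also have "\<dots> \<le> C2 * ?e" using C20(2) p by (simp add: C2_def distrib_right)
        finally show ?thesis .
      next
        case True
        have finT: "finite T" using TS S finite_subset by blast
        then have j1: "j \<ge> 1" using True T by (auto simp: Suc_le_eq card_gt_0_iff)
        have jj: "int (j - 1) = int j - 1" using j1 by simp
        have H': "nondeg N c K L x (S - {i}) (T - {i})" by (rule nondeg_remove[OF H True])
        have T': "card (T - {i}) = j - 1" using True T finT by simp
        let ?g = "es x (S - {i}) (int j - 1)"
        have pg: "?g > 0" using coneD[OF cone_delete[OF S i c], of "int j - 1"] j1 by simp
        have k1: "int j - 1 + int 1 = int j" by simp
        have b1: "\<bar>es x (S - {i}) (int j)\<bar> \<le> A * ?g"
          using AB(1)[OF j1] H' T' unfolding ebd_def jj k1 by blast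
        have b2: "\<bar>es x (S - {i}) (int j - 1 + int (Suc s))\<bar> \<le> B * ?g"
          using AB(2)[OF j1] H' T' unfolding ebd_def jj by blast
        have k: "int j + 1 - 2 = int j - 1" "int j + 1 - 1 = int j" by simp_all
        have "d \<le> x i + q x (S - {i}) (int j)"
          using nondeg_denom[OF cKL(1,2) H, of "j - 1" i] i T j1 by (simp add: d_def)
        also have "\<dots> = ?e / ?g"
          using q_denom[OF S i, of x "int j + 1"] pg unfolding k by simp
        finally have dg: "d * ?g \<le> ?e" using pg by (simp add: field_simps)
        have "x i * ?g = ?e - es x (S - {i}) (int j)" using es_remove[OF S i, of x "int j"] by simp
        then have "\<bar>x i * ?g\<bar> \<le> ?e + A * ?g" using b1 p by linarith
        also have "A * ?g \<le> A / d * ?e"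
          using mult_left_mono[OF dg, of "A / d"] AB(3) d by simp
        finally have xg: "\<bar>x i\<bar> * ?g \<le> (1 + A / d) * ?e" using pg by (simp add: abs_mult distrib_right)
        have "int j + int (Suc s) - 1 = int j - 1 + int (Suc s)" by simp
        then have "\<bar>x i * es x (S - {i}) (int j + int (Suc s) - 1)\<bar> \<le> \<bar>x i\<bar> * (B * ?g)"
          unfolding abs_mult using b2 by (intro mult_left_mono) auto
        also have "\<dots> = B * (\<bar>x i\<bar> * ?g)" by simp
        also have "\<dots> \<le> B * ((1 + A / d) * ?e)" by (rule mult_left_mono[OF xg AB(4)])
        also have "\<dots> \<le> C2 * ?e"
          using mult_right_mono[of "B * (1 + A / d)" C2 ?e] C20(1) p by (simp add: C2_def mult.assoc)
        finally show ?thesis .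
      qed
      have "real j + real (Suc s) \<ge> 1" by simp
      have "\<bar>es x S (int j + int (Suc s))\<bar> \<le> (real j + real (Suc s)) * \<bar>es x S (int j + int (Suc s))\<bar>"
        using mult_right_mono[of 1 "real j + real (Suc s)" "\<bar>es x S (int j + int (Suc s))\<bar>"] by simp
      also have "\<dots> = \<bar>of_int (int j + int (Suc s)) * es x S (int j + int (Suc s))\<bar>"
        by (simp add: abs_mult)
      also have "\<dots> = \<bar>\<Sum>i\<in>S. x i * es x (S - {i}) (int j + int (Suc s) - 1)\<bar>"
        by (simp only: es_euler[OF S])
      also have "\<dots> \<le> (\<Sum>i\<in>S. C2 * ?e)"
        by (rule order_trans[OF sum_abs]) (rule sum_mono[OF each])
      also have "\<dots> = card S * (C2 * ?e)" by simp
      also have "\<dots> \<le> N * (C2 * ?e)" using cn C20 p by (intro mult_right_mono) (simp_all add: C2_def)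
      finally show ?thesis by (simp only: mult.assoc)
    qed
    have "ebd N c K L j (Suc s) (C1 + N * C2)" unfolding ebd_def
    proof (intro conjI allI impI ballI)
      have nC: "N * C2 \<ge> 0" using C20 by (simp add: C2_def)
      then show "0 \<le> C1 + N * C2" using C0 by simp
      fix x S T assume H: "nondeg N c K L x S T" and T: "card T = j"
      have p: "es x S (int j) > 0" using coneD[of x S "int j" "int j"] H T by (simp add: nondeg_def)
      have pp: "C1 * es x S (int j) \<ge> 0" "N * C2 * es x S (int j) \<ge> 0" using p C0 nC by simp_all
      show "\<bar>es x S (int j + int (Suc s))\<bar> \<le> (C1 + N * C2) * es x S (int j)"
        using part1[OF H T] pp by (simp only: distrib_right)
      fix i assume i: "i \<in> S - T"
      show "\<bar>es x (S - {i}) (int j + int (Suc s) - 1)\<bar> \<le> (C1 + N * C2) * es x S (int j)"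
        using part2[OF H T i] pp by (simp only: distrib_right)
    qed
    then show ?case by blast
  qed
qed

text \<open>Counterpart of \<open>q_upper\<close>: m + 1 entries of size t force q_{m+1} to be of
  order t once t dominates K. In the parallel sum identity each index of \<open>T\<close>
  contributes at least c t / 2, and every other index at least -2K, because the deleted quotients
  are already at least 2K.\<close>

lemma q_lower:
  "\<exists>c>0. c \<le> 1 \<and> (\<exists>C\<ge>0. \<forall>(x :: nat \<Rightarrow> real) S T t (K :: real). finite S \<longrightarrow> card S \<le> N \<longrightarrow> T \<subseteq> S \<longrightarrow> card T = Suc m \<longrightarrow>
     cone x S (int m + 1) \<longrightarrow> K \<ge> 0 \<longrightarrow> t > 0 \<longrightarrow> t \<ge> C * K \<longrightarrow> (\<forall>i\<in>S. x i \<ge> - K) \<longrightarrow> (\<forall>i\<in>T. x i \<ge> t) \<longrightarrow>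
     q x S (int m + 1) \<ge> c * t)"
proof (induction m)
  case 0
  have base: "q x S 1 \<ge> 1 / 2 * t" if S: "finite S" "card S \<le> N" "T \<subseteq> S" "card T = Suc 0"
    and K: "K \<ge> 0" "t \<ge> 2 * real N * K" and x: "\<forall>i\<in>S. x i \<ge> - K" "\<forall>i\<in>T. x i \<ge> t"
    for x :: "nat \<Rightarrow> real" and S T and t K :: real
  proof -
    obtain i where i: "T = {i}" using S(4) by (metis card_1_singletonE One_nat_def)
    have "(\<Sum>j\<in>S - {i}. - K) \<le> sum x (S - {i})" by (rule sum_mono) (use x in auto)
    moreover have "real (card (S - {i})) * K \<le> real N * K"
      using S K(1) card_mono[OF S(1), of "S - {i}"] by (intro mult_right_mono) auto
    moreover have "sum x S = x i + sum x (S - {i})" using S i by (intro sum.remove) auto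
    moreover have "x i \<ge> t" using x i by auto
    ultimately show ?thesis using K(2) S(1) by (simp add: q_one)
  qed
  show ?case
  proof (rule exI[of _ "1/2 :: real"], intro conjI)
    have "(0::real) \<le> 2 * real N" by simp
    with base show "\<exists>C\<ge>0. \<forall>(x :: nat \<Rightarrow> real) S T t (K :: real). finite S \<longrightarrow> card S \<le> N \<longrightarrow> T \<subseteq> S \<longrightarrow>
      card T = Suc 0 \<longrightarrow> cone x S (int 0 + 1) \<longrightarrow> K \<ge> 0 \<longrightarrow> t > 0 \<longrightarrow> t \<ge> C * K \<longrightarrow>
      (\<forall>i\<in>S. x i \<ge> - K) \<longrightarrow> (\<forall>i\<in>T. x i \<ge> t) \<longrightarrow> q x S (int 0 + 1) \<ge> 1 / 2 * t"
      unfolding of_nat_0 add_0 by blast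
  qed simp_all
next
  case (Suc m)
  then obtain c C where cC: "c > 0" "c \<le> 1" "C \<ge> 0" and IH:
    "\<And>(x :: nat \<Rightarrow> real) S T t (K :: real). \<lbrakk>finite S; card S \<le> N; T \<subseteq> S; card T = Suc m;
     cone x S (int m + 1); K \<ge> 0; t > 0; t \<ge> C * K; \<forall>i\<in>S. x i \<ge> - K; \<forall>i\<in>T. x i \<ge> t\<rbrakk> \<Longrightarrow>
     q x S (int m + 1) \<ge> c * t" by blast
  \<comment> \<open>The three summands respectively make the induction hypothesis applicable, give c
    t \<ge> 2K, and keep the total loss 2 N K below half of the gain from \<open>T\<close>.\<close>
  define D where "D = C + 2 / c + 8 * real N / c"
  have D: "D \<ge> 0" unfolding D_def using cC by simp
  have main: "q x S (int (Suc m) + 1) \<ge> c / 4 * t" if S: "finite S" "card S \<le> N" "T \<subseteq> S" "card T = Suc (Suc m)"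
    and cn: "cone x S (int (Suc m) + 1)"
    and K: "K \<ge> 0" "t > 0" "t \<ge> D * K" and x: "\<forall>i\<in>S. x i \<ge> - K" "\<forall>i\<in>T. x i \<ge> t"
    for x :: "nat \<Rightarrow> real" and S T and t K :: real
  proof -
    let ?k = "int (Suc m) + 1"
    have k1: "?k - 1 = int m + 1" and k2: "?k \<ge> 2" by simp_all
    have finT: "finite T" using S finite_subset by blast
    have c1: "cone x S (?k - 1)" by (rule cone_mono[OF cn]) simp
    note pos = cone_pos2[OF S(1) c1 k2]
    have tK: "t \<ge> C * K" "c * t \<ge> 2 * K" "c * t \<ge> 8 * real N * K"
    proof -
      have "D * K = C * K + 2 / c * K + 8 * real N / c * K" by (simp add: D_def distrib_right)
      moreover have "C * K \<ge> 0" "2 / c * K \<ge> 0" "8 * real N / c * K \<ge> 0" using cC K by simp_all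
      ultimately have *: "t \<ge> C * K" "t \<ge> 2 / c * K" "t \<ge> 8 * real N / c * K" using K(3) by linarith+
      then show "t \<ge> C * K" "c * t \<ge> 2 * K" "c * t \<ge> 8 * real N * K" using cC(1) by (simp_all add: field_simps)
    qed
    have qi: "q x (S - {i}) (?k - 1) \<ge> c * t" if i: "i \<in> S" for i
    proof -
      obtain T' where T': "T' \<subseteq> T - {i}" "card T' = Suc m"
        using obtain_subset_with_card_n[of "Suc m" "T - {i}"] S(4) finT
        by (metis card_Diff_singleton_if diff_Suc_1 le_SucI order_refl)
      show ?thesis unfolding k1
      proof (rule IH[of _ T' _ K])
        show "card (S - {i}) \<le> N" using S card_mono[OF S(1), of "S - {i}"] by auto
        show "cone x (S - {i}) (int m + 1)" using cone_delete[OF S(1) i cn] by (simp add: add.commute)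
      qed (use S T' K tK x in auto)
    qed
    let ?f = "\<lambda>i. x i * q x (S - {i}) (?k - 1) / (x i + q x (S - {i}) (?k - 1))"
    have ct: "c * t > 0" using cC K by simp
    have fT: "?f i \<ge> c / 2 * t" if i: "i \<in> T" for i
    proof -
      have iS: "i \<in> S" using i S by auto
      define a b where ab: "a = x i" "b = q x (S - {i}) (?k - 1)"
      have a: "a \<ge> c * t" 
      proof -
        have "c * t \<le> 1 * t" using cC K by (intro mult_right_mono) auto
        moreover have "t \<le> x i" using x i by blast
        ultimately show ?thesis by (simp add: ab)
      qed
      have b: "b \<ge> c * t" using qi[OF iS] by (simp add: ab)
      have ab0: "0 \<le> a" "0 \<le> b" using a b ct by linarith+
      have "c * t * (a + b) \<le> 2 * (a * b)"
        using mult_right_mono[OF a ab0(2)] mult_right_mono[OF b ab0(1)] by (simp add: algebra_simps)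
      then have "c / 2 * t \<le> a * b / (a + b)" using a b ct by (simp add: field_simps)
      then show ?thesis by (simp add: ab)
    qed
    have fU: "?f i \<ge> - (2 * K)" if iS: "i \<in> S" for i
    proof -
      define a b where ab: "a = x i" "b = q x (S - {i}) (?k - 1)"
      have b: "b \<ge> 2 * K" "b > 0" using qi[OF iS] tK ct by (simp_all add: ab)
      have a: "a \<ge> - K" using x iS by (simp add: ab)
      have p: "a + b > 0" using pos(3)[OF iS] by (simp add: ab)
      have "a * b / (a + b) \<ge> - (2 * K)"
      proof (cases "a \<ge> 0")
        case True
        then have "a * b / (a + b) \<ge> 0" using b p by (intro divide_nonneg_pos mult_nonneg_nonneg) auto
        then show ?thesis using K by linarith
      next
        case False
        have "- (a * b) \<le> K * b" using a b mult_right_mono[of "- a" K b] by simp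
        also have "\<dots> \<le> 2 * K * (a + b)"
        proof -
          have "K * (2 * a + b) \<ge> 0" using a b K by (intro mult_nonneg_nonneg) auto
          then show ?thesis by (simp add: algebra_simps)
        qed
        finally show ?thesis using p by (simp add: field_simps)
      qed
      then show ?thesis by (simp add: ab)
    qed
    have "real (card (S - T)) * K \<le> real N * K"
      using S(1,2) K(1) card_mono[OF S(1), of "S - T"] by (intro mult_right_mono) auto
    then have "(\<Sum>i\<in>S - T. - (2 * K)) \<ge> - (2 * real N * K)" by simp
    moreover have "(\<Sum>i\<in>S - T. - (2 * K)) \<le> (\<Sum>i\<in>S - T. ?f i)" by (rule sum_mono[OF fU]) simp
    moreover have "(\<Sum>i\<in>T. c / 2 * t) \<le> (\<Sum>i\<in>T. ?f i)" by (rule sum_mono[OF fT])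
    moreover have "of_int ?k * q x S ?k = (\<Sum>i\<in>S - T. ?f i) + (\<Sum>i\<in>T. ?f i)"
      unfolding q_sum_parallel[OF S(1) c1 k2] by (rule sum.subset_diff[OF S(3,1)])
    ultimately have "of_int ?k * q x S ?k \<ge> of_int ?k * (c / 2 * t) - 2 * real N * K"
      using S(4) by simp
    moreover have "2 * real N * K \<le> of_int ?k * (c / 4 * t)"
    proof -
      have "2 * real N * K \<le> 1 * (c / 4 * t)" using tK(3) by simp
      also have "\<dots> \<le> of_int ?k * (c / 4 * t)" using ct by (intro mult_right_mono) auto
      finally show ?thesis .
    qed
    ultimately have "of_int ?k * (c / 4 * t) \<le> of_int ?k * q x S ?k" by (simp add: algebra_simps)
    then show ?thesis by (rule mult_left_le_imp_le) simp
  qed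
  show ?case
  proof (rule exI[of _ "c / 4"], intro conjI)
    show "0 < c / 4" "c / 4 \<le> 1" using cC by simp_all
    show "\<exists>C\<ge>0. \<forall>(x :: nat \<Rightarrow> real) S T t (K :: real). finite S \<longrightarrow> card S \<le> N \<longrightarrow> T \<subseteq> S \<longrightarrow>
      card T = Suc (Suc m) \<longrightarrow> cone x S (int (Suc m) + 1) \<longrightarrow> K \<ge> 0 \<longrightarrow> t > 0 \<longrightarrow> t \<ge> C * K \<longrightarrow>
      (\<forall>i\<in>S. x i \<ge> - K) \<longrightarrow> (\<forall>i\<in>T. x i \<ge> t) \<longrightarrow> q x S (int (Suc m) + 1) \<ge> c / 4 * t"
      using D main by blast
  qed
qed

section \<open>General quotients sigma_p / sigma_r and the decay of their derivatives\<close>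

definition Rt :: "('i \<Rightarrow> real) \<Rightarrow> ('i \<Rightarrow> real) \<Rightarrow> 'i set \<Rightarrow> int \<Rightarrow> int \<Rightarrow> real fps" where
  "Rt x z S p r = es (ray x z) S p * inverse (es (ray x z) S r)"

definition dr :: "('i \<Rightarrow> real) \<Rightarrow> 'i set \<Rightarrow> int \<Rightarrow> int \<Rightarrow> 'i \<Rightarrow> real" where
  "dr x S p r i = (es x (S - {i}) (p - 1) * es x S r - es x S p * es x (S - {i}) (r - 1)) / (es x S r)\<^sup>2"

lemma dr_alt:
  assumes "finite S" "i \<in> S"
  shows "dr x S p r i = (es x (S - {i}) (p - 1) * es x (S - {i}) r - es x (S - {i}) p * es x (S - {i}) (r - 1)) / (es x S r)\<^sup>2"
proof -
  have "es x (S - {i}) (p - 1) * es x S r - es x S p * es x (S - {i}) (r - 1)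
      = es x (S - {i}) (p - 1) * es x (S - {i}) r - es x (S - {i}) p * es x (S - {i}) (r - 1)"
    unfolding es_remove[OF assms, of x p] es_remove[OF assms, of x r] by (simp add: ring_distribs)
  then show ?thesis by (simp only: dr_def)
qed

lemma dq_eq_dr: "finite S \<Longrightarrow> i \<in> S \<Longrightarrow> dq x S k i = dr x S k (k - 1) i"
proof -
  have k: "k - 1 - 1 = k - 2" by simp
  show "finite S \<Longrightarrow> i \<in> S \<Longrightarrow> dq x S k i = dr x S k (k - 1) i" by (simp only: dq_alt dr_def k)
qed

lemma Rt_mult:
  assumes "finite S" "es x S r \<noteq> 0"
  shows "Rt x z S p r * es (ray x z) S r = es (ray x z) S p"
proof -
  have "es (ray x z) S r $ 0 \<noteq> 0" using assms by simp
  then have "inverse (es (ray x z) S r) * es (ray x z) S r = 1" by (rule inverse_mult_eq_1)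
  then show ?thesis unfolding Rt_def by (simp only: mult.assoc) simp
qed

lemma Rt_nth_0: "finite S \<Longrightarrow> Rt x z S p r $ 0 = es x S p / es x S r"
  by (simp add: Rt_def divide_inverse)

lemma Rt_nth_1:
  assumes S: "finite S" and ne: "es x S r \<noteq> 0"
  shows "Rt x z S p r $ 1 = (\<Sum>i\<in>S. z i * dr x S p r i)"
proof -
  let ?e = "es x S r" and ?f = "es x S p"
  have "?f / ?e * es (ray x z) S r $ Suc 0 + Rt x z S p r $ 1 * ?e = es (ray x z) S p $ Suc 0"
    using fps_mult_coeffs(2)[OF Rt_mult[OF S ne, of z p]] S by (simp add: Rt_nth_0)
  then have "Rt x z S p r $ 1 = (es (ray x z) S p $ Suc 0 - ?f / ?e * es (ray x z) S r $ Suc 0) / ?e"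
    using ne by (simp add: field_simps)
  also have "\<dots> = (\<Sum>i\<in>S. (z i * es x (S - {i}) (p - 1) - ?f / ?e * (z i * es x (S - {i}) (r - 1))) / ?e)"
    by (simp only: es_ray_nth_1[OF S] sum_distrib_left sum_subtractf sum_divide_distrib[symmetric])
  also have "\<dots> = (\<Sum>i\<in>S. z i * dr x S p r i)"
  proof (rule sum.cong[OF refl])
    fix i assume i: "i \<in> S"
    show "(z i * es x (S - {i}) (p - 1) - ?f / ?e * (z i * es x (S - {i}) (r - 1))) / ?e = z i * dr x S p r i"
      unfolding dr_def using ne by (simp add: field_simps power2_eq_square)
  qed
  finally show ?thesis .
qed

text \<open>By \<open>dr_alt\<close> the numerators of the derivatives needed later are differences
  of such products, so the weight 1 + x_i^2 yields decay of order x_i^{-2}, the order of the lower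
  bound for \<open>G\<close>. Outside \<open>T\<close> the entry is bounded anyway; inside
  \<open>T\<close> the gain is the square of x_i sigma_{j-1}(S - i) \<le> const * sigma_j.\<close>

lemma prod_bound:
  assumes cKL: "c > 0" "K \<ge> 0" "L \<ge> 0"
  shows "\<exists>B\<ge>0. \<forall>x S T i. nondeg N c K L x S T \<longrightarrow> card T = j \<longrightarrow> i \<in> S \<longrightarrow>
    \<bar>es x (S - {i}) (int j - 1 + int s) * es x (S - {i}) (int j - 1 + int t)\<bar> * (1 + (x i)\<^sup>2) \<le> B * (es x S (int j))\<^sup>2"
proof -
  obtain C1 C2 where C: "ebd N c K L j s C1" "ebd N c K L j t C2" using ebd_exists[OF cKL] by blast
  obtain A1 A2 A3 where A: "j \<ge> 1 \<Longrightarrow> ebd N c K L (j - 1) s A1" "j \<ge> 1 \<Longrightarrow> ebd N c K L (j - 1) t A2"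
    "j \<ge> 1 \<Longrightarrow> ebd N c K L (j - 1) 1 A3" using ebd_exists[OF cKL] by metis
  have C0: "C1 \<ge> 0" "C2 \<ge> 0" using C by (auto simp: ebd_def)
  define d where "d = c / 2 * (c / (2 * K + 2 * c)) ^ (j - 1)"
  have d: "d > 0" unfolding d_def using cKL by simp
  define B1 where "B1 = C1 * C2 * (1 + (K + L)\<^sup>2)"
  define B2 where "B2 = \<bar>A1\<bar> * \<bar>A2\<bar> * (1 / d\<^sup>2 + (1 + \<bar>A3\<bar> / d)\<^sup>2)"
  have B0: "B1 \<ge> 0" "B2 \<ge> 0" using C0 by (simp_all add: B1_def B2_def)
  have main: "\<bar>es x (S - {i}) (int j - 1 + int s) * es x (S - {i}) (int j - 1 + int t)\<bar> * (1 + (x i)\<^sup>2) \<le> (B1 + B2) * (es x S (int j))\<^sup>2"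
    if H: "nondeg N c K L x S T" and T: "card T = j" and i: "i \<in> S" for x S T i
  proof (cases "i \<in> T")
    case False
    then have iT: "i \<in> S - T" using i by simp
    let ?e = "es x S (int j)"
    have "- K \<le> x i" "x i \<le> L" using H iT by (auto simp: nondeg_def)
    then have "\<bar>x i\<bar> \<le> K + L" using cKL by (simp add: abs_le_iff)
    then have x2: "(x i)\<^sup>2 \<le> (K + L)\<^sup>2" by (metis abs_ge_zero power2_abs power_mono)
    have "int j + int s - 1 = int j - 1 + int s" "int j + int t - 1 = int j - 1 + int t" by simp_all
    then have "\<bar>es x (S - {i}) (int j - 1 + int s)\<bar> \<le> C1 * ?e" "\<bar>es x (S - {i}) (int j - 1 + int t)\<bar> \<le> C2 * ?e"
      using C H T iT unfolding ebd_def by metis+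
    then have "\<bar>es x (S - {i}) (int j - 1 + int s) * es x (S - {i}) (int j - 1 + int t)\<bar> \<le> (C1 * ?e) * (C2 * ?e)"
      unfolding abs_mult by (intro mult_mono) auto
    also have "\<dots> = C1 * C2 * ?e\<^sup>2" by (simp add: power2_eq_square)
    finally have "\<bar>es x (S - {i}) (int j - 1 + int s) * es x (S - {i}) (int j - 1 + int t)\<bar> * (1 + (x i)\<^sup>2)
      \<le> C1 * C2 * ?e\<^sup>2 * (1 + (K + L)\<^sup>2)"
      using x2 C0 by (intro mult_mono) auto
    also have "\<dots> = B1 * ?e\<^sup>2" by (simp add: B1_def)
    also have "\<dots> \<le> (B1 + B2) * ?e\<^sup>2" using B0 by (intro mult_right_mono) auto
    finally show ?thesis .
  next
    case True
    let ?e = "es x S (int j)" and ?g = "es x (S - {i}) (int j - 1)"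
    have S: "finite S" and TS: "T \<subseteq> S" and c: "cone x S (int j)" using H T by (auto simp: nondeg_def)
    have finT: "finite T" using TS S finite_subset by blast
    then have j1: "j \<ge> 1" using True T by (auto simp: Suc_le_eq card_gt_0_iff)
    have jj: "int (j - 1) = int j - 1" using j1 by simp
    have H': "nondeg N c K L x (S - {i}) (T - {i})" by (rule nondeg_remove[OF H True])
    have T': "card (T - {i}) = j - 1" using True T finT by simp
    have pg: "?g > 0" using coneD[OF cone_delete[OF S i c], of "int j - 1"] j1 by simp
    have p: "?e > 0" using coneD[OF c] by simp
    have k1: "int j - 1 + int 1 = int j" by simp
    have b: "\<bar>es x (S - {i}) (int j - 1 + int s)\<bar> \<le> A1 * ?g" "\<bar>es x (S - {i}) (int j - 1 + int t)\<bar> \<le> A2 * ?g"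
      using A(1,2)[OF j1] H' T' unfolding ebd_def jj by blast+
    have b3: "\<bar>es x (S - {i}) (int j)\<bar> \<le> A3 * ?g" using A(3)[OF j1] H' T' unfolding ebd_def jj k1 by blast
    have k: "int j + 1 - 2 = int j - 1" "int j + 1 - 1 = int j" by simp_all
    have "d \<le> x i + q x (S - {i}) (int j)"
      using nondeg_denom[OF cKL(1,2) H, of "j - 1" i] i T j1 by (simp add: d_def)
    also have "\<dots> = ?e / ?g" using q_denom[OF S i, of x "int j + 1"] pg unfolding k by simp
    finally have "d * ?g \<le> ?e" using pg by (simp add: field_simps)
    then have g: "?g \<le> ?e / d" using d by (simp add: field_simps)
    have "x i * ?g = ?e - es x (S - {i}) (int j)" using es_remove[OF S i, of x "int j"] by simp
    then have "\<bar>x i * ?g\<bar> \<le> ?e + \<bar>A3\<bar> * ?g" using b3 p pg mult_right_mono[of A3 "\<bar>A3\<bar>" ?g] by linarith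
    also have "\<bar>A3\<bar> * ?g \<le> \<bar>A3\<bar> * (?e / d)" by (rule mult_left_mono[OF g]) simp
    finally have "\<bar>x i * ?g\<bar> \<le> (1 + \<bar>A3\<bar> / d) * ?e" by (simp add: distrib_right)
    then have "\<bar>x i * ?g\<bar>\<^sup>2 \<le> ((1 + \<bar>A3\<bar> / d) * ?e)\<^sup>2" by (intro power_mono) auto
    then have "(x i)\<^sup>2 * ?g\<^sup>2 \<le> (1 + \<bar>A3\<bar> / d)\<^sup>2 * ?e\<^sup>2"
      by (simp only: power2_abs power_mult_distrib)
    moreover have "?g\<^sup>2 \<le> 1 / d\<^sup>2 * ?e\<^sup>2" using power_mono[OF g, of 2] pg by (simp add: power_divide)
    moreover have "?g\<^sup>2 * (1 + (x i)\<^sup>2) = ?g\<^sup>2 + (x i)\<^sup>2 * ?g\<^sup>2"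
      "(1 / d\<^sup>2 + (1 + \<bar>A3\<bar> / d)\<^sup>2) * ?e\<^sup>2 = 1 / d\<^sup>2 * ?e\<^sup>2 + (1 + \<bar>A3\<bar> / d)\<^sup>2 * ?e\<^sup>2"
      by (simp_all only: distrib_left distrib_right mult_1_right mult.commute)
    ultimately have gg: "?g\<^sup>2 * (1 + (x i)\<^sup>2) \<le> (1 / d\<^sup>2 + (1 + \<bar>A3\<bar> / d)\<^sup>2) * ?e\<^sup>2"
      by linarith
    have "\<bar>es x (S - {i}) (int j - 1 + int s) * es x (S - {i}) (int j - 1 + int t)\<bar> \<le> (\<bar>A1\<bar> * ?g) * (\<bar>A2\<bar> * ?g)"
      unfolding abs_mult
      by (intro mult_mono order_trans[OF b(1)] order_trans[OF b(2)] mult_right_mono abs_ge_self) (use pg in auto)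
    then have "\<bar>es x (S - {i}) (int j - 1 + int s) * es x (S - {i}) (int j - 1 + int t)\<bar> * (1 + (x i)\<^sup>2)
        \<le> (\<bar>A1\<bar> * ?g) * (\<bar>A2\<bar> * ?g) * (1 + (x i)\<^sup>2)" by (intro mult_right_mono) auto
    also have "\<dots> = \<bar>A1\<bar> * \<bar>A2\<bar> * (?g\<^sup>2 * (1 + (x i)\<^sup>2))" by (simp add: power2_eq_square)
    also have "\<dots> \<le> \<bar>A1\<bar> * \<bar>A2\<bar> * ((1 / d\<^sup>2 + (1 + \<bar>A3\<bar> / d)\<^sup>2) * ?e\<^sup>2)"
      by (rule mult_left_mono[OF gg]) simp
    also have "\<dots> = B2 * ?e\<^sup>2" by (simp add: B2_def)
    also have "\<dots> \<le> (B1 + B2) * ?e\<^sup>2" using B0 by (intro mult_right_mono) auto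
    finally show ?thesis .
  qed
  have "B1 + B2 \<ge> 0" using B0 by simp
  then show ?thesis using main by blast
qed

text \<open>Here the recursion is explicit, since q_1 is linear. The form vanishes only if z is
  proportional to x, so q_2 is strictly concave modulo the radial direction; this is the end point
  of the chain of deletions.\<close>

lemma Q_two_nth_2:
  fixes x :: "nat \<Rightarrow> real"
  assumes A: "finite A" and c: "cone x A 1"
  shows "2 * Q x z A 2 $ 2 = - (\<Sum>i\<in>A. (z i - x i * (sum z A / sum x A))\<^sup>2) / sum x A"
proof -
  let ?s = "sum x A"
  have s: "?s > 0" using coneD[OF c, of 1] A by (simp add: es_1)
  have c': "cone x A (2 - 1)" using c by simp
  note pos = cone_pos2[OF A c']
  have "of_int 2 * Q x z A 2 $ 2 = (\<Sum>i\<in>A. (x i / (x i + q x (A - {i}) (2 - 1)))\<^sup>2 * Q x z (A - {i}) (2 - 1) $ 2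
      - (q x (A - {i}) (2 - 1) * z i - x i * Q x z (A - {i}) (2 - 1) $ 1)\<^sup>2 / (x i + q x (A - {i}) (2 - 1)) ^ 3)"
    by (rule Q_recursion(2)[OF A]) (use pos in \<open>fastforce+\<close>)
  also have "\<dots> = (\<Sum>i\<in>A. - ((z i - x i * (sum z A / ?s))\<^sup>2 / ?s))"
  proof (rule sum.cong[OF refl])
    fix i assume i: "i \<in> A"
    have q1: "q x (A - {i}) 1 = ?s - x i" using A i by (simp add: q_one sum_diff1)
    have Q1: "Q x z (A - {i}) 1 $ 1 = sum z A - z i"
      using A i es_ray_nth_1[of "A - {i}" x z 1] by (simp add: Q_one sum_diff1)
    have Q2: "Q x z (A - {i}) 1 $ 2 = 0" using A by (simp add: Q_one_nth_2)
    have o: "(2::int) - 1 = 1" by simp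
    have e: "(?s - x i) * z i - x i * (sum z A - z i) = ?s * (z i - x i * (sum z A / ?s))"
      using s by (simp add: field_simps)
    have "(?s * (z i - x i * (sum z A / ?s)))\<^sup>2 / ?s ^ 3 = (z i - x i * (sum z A / ?s))\<^sup>2 / ?s"
      using s by (simp add: power_mult_distrib power2_eq_square power3_eq_cube)
    then show "(x i / (x i + q x (A - {i}) (2 - 1)))\<^sup>2 * Q x z (A - {i}) (2 - 1) $ 2
      - (q x (A - {i}) (2 - 1) * z i - x i * Q x z (A - {i}) (2 - 1) $ 1)\<^sup>2 / (x i + q x (A - {i}) (2 - 1)) ^ 3
      = - ((z i - x i * (sum z A / ?s))\<^sup>2 / ?s)"
      unfolding o q1 Q1 Q2 e by simp
  qed
  also have "\<dots> = - (\<Sum>i\<in>A. (z i - x i * (sum z A / ?s))\<^sup>2) / ?s"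
    by (simp add: sum_negf sum_divide_distrib)
  finally show ?thesis by simp
qed

text \<open>Delete the indices of \<open>J\<close> one after the other by
  \<open>Q_concave_delete\<close>. Each factor x_i / (x_i + q) stays away from 0 because x_i \<ge> c
  while q is bounded by \<open>q_upper\<close>; so r does not depend on how large the entries of
  \<open>J\<close> are.\<close>

lemma Q_concave_chain:
  assumes c0: "c > 0" and M: "M \<ge> 0"
  shows "\<exists>r>0. \<forall>(x :: nat \<Rightarrow> real) z A J. finite A \<longrightarrow> card A \<le> N \<longrightarrow> J \<subseteq> A \<longrightarrow> card J = p \<longrightarrow> cone x A (int p + 1) \<longrightarrow>
    (\<forall>i\<in>J. x i \<ge> c) \<longrightarrow> (\<forall>i\<in>A - J. x i \<le> M) \<longrightarrow> Q x z A (int p + 2) $ 2 \<le> r * Q x z (A - J) 2 $ 2"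
proof (induction p)
  case 0
  show ?case
  proof (intro exI[of _ "1::real"] conjI allI impI)
    fix x z :: "nat \<Rightarrow> real" and A J :: "nat set"
    assume "finite A" "J \<subseteq> A" "card J = 0"
    then have "J = {}" using finite_subset[of J A] by simp
    then show "Q x z A (int 0 + 2) $ 2 \<le> 1 * Q x z (A - J) 2 $ 2" by simp
  qed simp
next
  case (Suc p)
  then obtain r where r: "r > 0" and IH: "\<And>(x :: nat \<Rightarrow> real) z A J. \<lbrakk>finite A; card A \<le> N; J \<subseteq> A; card J = p;
    cone x A (int p + 1); \<forall>i\<in>J. x i \<ge> c; \<forall>i\<in>A - J. x i \<le> M\<rbrakk> \<Longrightarrow> Q x z A (int p + 2) $ 2 \<le> r * Q x z (A - J) 2 $ 2"
    by blast
  define t where "t = (c / (c + N * M))\<^sup>2"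
  have "c + N * M > 0" using c0 M by (intro add_pos_nonneg mult_nonneg_nonneg) auto
  then have t: "t > 0" unfolding t_def using c0 by simp
  have main: "Q x z A (int (Suc p) + 2) $ 2 \<le> t * r / (real p + 3) * Q x z (A - J) 2 $ 2"
    if A: "finite A" "card A \<le> N" "J \<subseteq> A" "card J = Suc p" and cn: "cone x A (int (Suc p) + 1)"
      and x: "\<forall>i\<in>J. x i \<ge> c" "\<forall>i\<in>A - J. x i \<le> M" for x z :: "nat \<Rightarrow> real" and A J :: "nat set"
  proof -
    let ?k = "int (Suc p) + 2"
    have finJ: "finite J" using A finite_subset by blast
    obtain i where i: "i \<in> J" using A(4) by fastforce
    then have iA: "i \<in> A" using A by auto
    have k1: "?k - 1 = int p + 2" "?k \<ge> 2" by simp_all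
    have cn': "cone x A (?k - 1)" using cn by (simp add: k1 algebra_simps)
    have cd: "cone x (A - {i}) (int p + 1)" using cone_delete[OF A(1) iA cn'] by (simp add: algebra_simps)
    have cJ: "card (J - {i}) = p" using A(4) i finJ by simp
    have dd: "A - {i} - (J - {i}) = A - J" using i by auto
    have cA: "card (A - {i}) \<le> N" using A card_mono[OF A(1), of "A - {i}"] by auto
    let ?q = "q x (A - {i}) (int p + 2)"
    have a: "Q x z (A - {i}) (int p + 2) $ 2 \<le> r * Q x z (A - J) 2 $ 2"
      using IH[of "A - {i}" "J - {i}" x z] A cA cJ cd x i unfolding dd by auto
    have qu: "?q \<le> N * M"
    proof -
      \<comment> \<open>In this degree \<open>q_upper\<close> needs p + 1 exceptional indices, but
        \<open>J - {i}\<close> has only p; any further index l is added. If there is none, then A =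
        J and the degree p + 2 exceeds the number of variables, so the quotient is 0.\<close>
      have "q x (A - {i}) (int (p + 1) + 1) \<le> real (card (A - {i})) * M" if "\<exists>l. l \<in> A - J"
      proof -
        from that obtain l where l: "l \<in> A - J" by blast
        show ?thesis
        proof (rule q_upper[where T = "insert l (J - {i})"])
          show "card (insert l (J - {i})) = p + 1" using l cJ finJ by simp
          show "cone x (A - {i}) (int (p + 1))" using cd by (simp add: algebra_simps)
        qed (use A M x l i in auto)
      qed
      moreover have "q x (A - {i}) (int p + 2) = 0" if "A - J = {}"
      proof -
        have "A - {i} = J - {i}" using that A by auto
        then have "es x (A - {i}) (int p + 2) = 0" using cJ finJ by (intro es_gt_card) auto
        then show ?thesis by (simp add: q_def)
      qed
      moreover have "real (card (A - {i})) * M \<le> N * M" using cA M by (intro mult_right_mono) auto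
      moreover have "0 \<le> N * M" using M by simp
      moreover have "int (p + 1) + 1 = int p + 2" by simp
      ultimately show ?thesis by (metis (mono_tags) all_not_in_conv order_trans)
    qed
    have pos: "x i + ?q > 0" using cone_pos2(3)[OF A(1) cn' k1(2) iA] by (simp only: k1)
    have xi: "x i \<ge> c" using x i by simp
    have "c / (c + N * M) \<le> x i / (x i + ?q)"
    proof -
      have "c * (x i + ?q) \<le> x i * (c + N * M)"
        using mult_left_mono[OF qu less_imp_le[OF c0]] mult_right_mono[OF xi, of "N * M"] M by (simp add: algebra_simps)
      moreover have "c + N * M > 0" using c0 M by (simp add: add_pos_nonneg)
      ultimately show ?thesis using pos by (simp add: field_simps)
    qed
    then have tt: "t \<le> (x i / (x i + ?q))\<^sup>2" unfolding t_def using c0 M by (intro power_mono) auto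
    have "cone x (A - J) 1"
    proof -
      have "cone x (A - J) (int p + 2 - int (card J))" if "finite B" "B \<subseteq> A" "J = B" for B
        using finJ A(3) cn' unfolding k1
      proof (induction J rule: finite_induct)
        case (insert j F)
        have "A - insert j F = A - F - {j}" by auto
        moreover have "int p + 2 - int (card (insert j F)) = int p + 2 - int (card F) - 1" using insert by simp
        ultimately show ?case using cone_delete[of "A - F" j x "int p + 2 - int (card F)"] insert A(1) by auto
      qed simp
      from this[OF finJ A(3) refl] show ?thesis using A(4) by simp
    qed
    then have np: "Q x z (A - J) 2 $ 2 \<le> 0" by (intro Q_concave) (use A in simp_all)
    have np': "Q x z (A - {i}) (int p + 2) $ 2 \<le> 0" using a np r by (smt (verit) mult_nonneg_nonpos)
    have "of_int ?k * Q x z A ?k $ 2 \<le> (x i / (x i + ?q))\<^sup>2 * Q x z (A - {i}) (int p + 2) $ 2"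
      using Q_concave_delete[OF A(1) cn' k1(2) iA, of z] by (simp only: k1)
    also have "\<dots> \<le> t * Q x z (A - {i}) (int p + 2) $ 2" by (rule mult_right_mono_neg[OF tt np'])
    also have "\<dots> \<le> t * (r * Q x z (A - J) 2 $ 2)" using a t by simp
    finally show ?thesis by (simp add: field_simps)
  qed
  have "t * r / (real p + 3) > 0" using t r by simp
  then show ?case using main by blast
qed

section \<open>Limits along sequences with some entries tending to infinity\<close>

lemma es_div_prod_tendsto:
  fixes X :: "nat \<Rightarrow> nat \<Rightarrow> real"
  assumes T: "finite T" and U: "finite U" "T \<inter> U = {}"
    and XT: "\<And>i. i \<in> T \<Longrightarrow> filterlim (\<lambda>n. X n i) at_top sequentially"
    and XU: "\<And>i. i \<in> U \<Longrightarrow> (\<lambda>n. X n i) \<longlonglongrightarrow> \<mu> i"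
  shows "(\<lambda>n. es (X n) (T \<union> U) (int (card T) + s) / prod (X n) T) \<longlonglongrightarrow> es \<mu> U s"
  using T U(2) XT
proof (induction T arbitrary: s rule: finite_induct)
  case empty
  have "(\<lambda>n. es (X n) U s) \<longlonglongrightarrow> es \<mu> U s"
    unfolding es_def by (intro tendsto_sum tendsto_prod XU) auto
  then show ?case by simp
next
  case (insert i T)
  have i: "i \<notin> T \<union> U" "finite (T \<union> U)" using insert U by auto
  have IH: "(\<lambda>n. es (X n) (T \<union> U) (int (card T) + s') / prod (X n) T) \<longlonglongrightarrow> es \<mu> U s'" for s'
    using insert by auto
  have inv: "(\<lambda>n. inverse (X n i)) \<longlonglongrightarrow> 0"
    using insert.prems(2)[of i] by (intro tendsto_inverse_0_at_top) auto
  \<comment> \<open>This is \<open>es_insert\<close> divided by the enlarged product: the part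
    without i carries the factor 1 / X n i and disappears in the limit.\<close>
  have "(\<lambda>n. es (X n) (T \<union> U) (int (card T) + s) / prod (X n) T
      + es (X n) (T \<union> U) (int (card T) + (s + 1)) / prod (X n) T * inverse (X n i)) \<longlonglongrightarrow> es \<mu> U s + es \<mu> U (s + 1) * 0"
    by (intro tendsto_intros IH inv)
  moreover have "eventually (\<lambda>n. es (X n) (T \<union> U) (int (card T) + s) / prod (X n) T
      + es (X n) (T \<union> U) (int (card T) + (s + 1)) / prod (X n) T * inverse (X n i)
    = es (X n) (insert i T \<union> U) (int (card (insert i T)) + s) / prod (X n) (insert i T)) sequentially"
  proof -
    have "eventually (\<lambda>n. X n i > 0) sequentially"
      using insert.prems(2)[of i] by (simp add: filterlim_at_top_dense)
    then show ?thesis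
    proof eventually_elim
      case (elim n)
      have m: "int (card (insert i T)) + s - 1 = int (card T) + s" "int (card (insert i T)) + s = int (card T) + (s + 1)" "int (card T) + (s + 1) - 1 = int (card T) + s"
        using insert(1,2) by simp_all
      have "insert i T \<union> U = insert i (T \<union> U)" by simp
      then have "es (X n) (insert i T \<union> U) (int (card (insert i T)) + s)
        = X n i * es (X n) (T \<union> U) (int (card T) + s) + es (X n) (T \<union> U) (int (card T) + (s + 1))"
        using es_insert[OF i(2,1), of "X n" "int (card (insert i T)) + s"] by (simp only: m)
      moreover have "A / p + B / p * inverse c = (c * A + B) / (c * p)" if "c > 0" for A B c p :: real
        using that by (cases "p = 0") (simp_all add: field_simps)
      ultimately show ?case using elim insert(1,2) by simp
    qed
  qed
  ultimately show ?case using Lim_transform_eventually by fastforce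
qed

lemma finite_convergent_subseq:
  fixes X :: "nat \<Rightarrow> 'i \<Rightarrow> real"
  assumes "finite U" "\<And>n i. i \<in> U \<Longrightarrow> \<bar>X n i\<bar> \<le> B"
  shows "\<exists>r \<mu>. strict_mono r \<and> (\<forall>i\<in>U. (\<lambda>n. X (r n) i) \<longlonglongrightarrow> \<mu> i)"
  using assms
proof (induction U rule: finite_induct)
  case empty
  show ?case by (intro exI[of _ id]) (simp add: strict_mono_def)
next
  case (insert i U)
  then obtain r \<mu> where r: "strict_mono r" "\<And>j. j \<in> U \<Longrightarrow> (\<lambda>n. X (r n) j) \<longlonglongrightarrow> \<mu> j" by force
  have "bounded (range (\<lambda>n. X (r n) i))"
    by (rule boundedI[of _ B]) (use insert in auto)
  then obtain l s where s: "strict_mono s" "((\<lambda>n. X (r n) i) \<circ> s) \<longlonglongrightarrow> l"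
    using bounded_imp_convergent_subsequence by blast
  have "(\<lambda>n. X ((r \<circ> s) n) j) \<longlonglongrightarrow> (\<mu>(i := l)) j" if "j \<in> insert i U" for j
  proof (cases "j = i")
    case True
    then show ?thesis using s by (simp add: o_def)
  next
    case False
    then show ?thesis using that LIMSEQ_subseq_LIMSEQ[OF r(2)[of j] s(1)] by (simp add: o_def)
  qed
  moreover have "strict_mono (r \<circ> s)" using r s by (simp add: strict_mono_o)
  ultimately show ?case by blast
qed

section \<open>The normalized problem\<close>

declare One_nat_def [simp del]

lemma inv_mult_le: "k > 0 \<Longrightarrow> A \<le> k * D \<Longrightarrow> 1 / k * A \<le> D" for k A D :: real
  by (simp add: field_simps)

lemma inv_le_frac: "A > 0 \<Longrightarrow> C > 0 \<Longrightarrow> A \<le> 2 * (B * C) \<Longrightarrow> 1 / (2 * C) \<le> B / A" for A B C :: real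
  by (simp add: field_simps)

text \<open>A class that contains both normalizations: since q_k \<le> q_{k-1}, each of q_k = 1 and
  q_k q_{k-1} = 1 forces q_k \<le> 1 \<le> q_{k-1}.\<close>

definition adm :: "nat \<Rightarrow> nat \<Rightarrow> real \<Rightarrow> (nat \<Rightarrow> real) \<Rightarrow> bool" where
  "adm n k K x \<longleftrightarrow> cone x {1..n} (int k) \<and> (\<forall>i j. 1 \<le> i \<longrightarrow> i \<le> j \<longrightarrow> j \<le> n \<longrightarrow> x j \<le> x i) \<and>
     (\<forall>i\<in>{1..n}. x i \<ge> - K) \<and> q x {1..n} (int k) \<le> 1 \<and> q x {1..n} (int k - 1) \<ge> 1"

text \<open>If one of these entries were large, then by the ordering so would be the first k
  entries, and \<open>q_lower\<close> would push q_k above 1. Hence at most k - 1 entries are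
  unbounded.\<close>

lemma adm_upper:
  assumes k: "2 \<le> k" "k \<le> n" and K: "K \<ge> 0"
  shows "\<exists>L\<ge>1. \<forall>x. adm n k K x \<longrightarrow> (\<forall>i\<in>{k..n}. x i \<le> L)"
proof -
  define m where "m = k - 1"
  have m: "k = Suc m" "int k = int m + 1" using k by (auto simp: m_def)
  obtain c C where c: "c > 0" "C \<ge> 0" and low: "\<And>(x :: nat \<Rightarrow> real) S T t (K :: real). \<lbrakk>finite S; card S \<le> n; T \<subseteq> S; card T = Suc m;
     cone x S (int m + 1); K \<ge> 0; t > 0; t \<ge> C * K; \<forall>i\<in>S. x i \<ge> - K; \<forall>i\<in>T. x i \<ge> t\<rbrakk> \<Longrightarrow>
     q x S (int m + 1) \<ge> c * t"
    using q_lower[of n m] by blast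
  define L where "L = 1 + C * K + 1 / c"
  have ck: "C * K \<ge> 0" "1 / c > 0" using c K by simp_all
  have L: "L \<ge> 1" "L \<ge> C * K" "L > 1 / c" using ck by (simp_all add: L_def)
  have "x i \<le> L" if a: "adm n k K x" and i: "i \<in> {k..n}" for x i
  proof (rule ccontr)
    assume "\<not> x i \<le> L"
    moreover have "x i \<le> x k" using a i k unfolding adm_def by simp
    ultimately have "x k \<ge> L" by linarith
    moreover have "x k \<le> x j" if "j \<in> {1..k}" for j using a that k unfolding adm_def by simp
    ultimately have "\<forall>j\<in>{1..k}. x j \<ge> L" by (meson order_trans)
    moreover have "cone x {1..n} (int m + 1)" "\<forall>i\<in>{1..n}. - K \<le> x i" "q x {1..n} (int m + 1) \<le> 1"
      using a unfolding adm_def m(2) by blast+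
    moreover have "{1..k} \<subseteq> {1..n}" "card {1..k} = Suc m" using k m(1) by auto
    moreover have "L > 0" using L by linarith
    ultimately have "c * L \<le> 1"
      using low[of "{1..n}" "{1..k}" x K L] K L by simp
    moreover have "c * L > 1" using L(3) c by (simp add: field_simps)
    ultimately show False by simp
  qed
  then show ?thesis using L by blast
qed

locale quot =
  fixes n k :: nat and K L :: real
  assumes k2: "2 \<le> k" and kn: "k \<le> n" and K0: "K \<ge> 0" and L1: "L \<ge> 1"
    and upper: "\<And>x i. adm n k K x \<Longrightarrow> i \<in> {k..n} \<Longrightarrow> x i \<le> L"
begin

abbreviation "S \<equiv> {1..n}"
abbreviation "S' \<equiv> {2..n}"
abbreviation "T \<equiv> {1..k - 1}"
abbreviation "T' \<equiv> {2..k - 1}"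
abbreviation "U \<equiv> {k..n}"

lemma S'_eq: "S - {1} = S'" and T'_eq: "T - {1} = T'" and TU: "S = T \<union> U" "T \<inter> U = {}"
  and T'U: "S' = T' \<union> U" "T' \<inter> U = {}" and oneS: "1 \<in> S" and oneT: "1 \<in> T"
  using k2 kn by auto

lemma cards: "card T = k - 1" "int (card T) = int k - 1" "card T' = k - 2" "int (card T') = int k - 2"
  using k2 by auto

text \<open>As functions of x 1 alone, q_k = a - w / m and 1 / q_{k-1} = g + v / m, where a, w, g, v
  depend only on the other entries. The letter D marks partial derivatives in x i: \<open>cD\<close>
  is that of sigma_k / sigma_{k-2} on S', the part subtracted in \<open>w\<close>, and
  \<open>nD\<close> is that of - 1 / q_{k-1}, the sign making it nonnegative.\<close>

definition a where "a x = q x S' (int k - 1)"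
definition w where "w x = (a x)\<^sup>2 - es x S' (int k) / es x S' (int k - 2)"
definition g where "g x = es x S' (int k - 3) / es x S' (int k - 2)"
definition v where "v x = 1 - g x * a x"
definition m where "m x = x 1 + a x"
definition aD where "aD x i = dr x S' (int k - 1) (int k - 2) i"
definition cD where "cD x i = dr x S' (int k) (int k - 2) i"
definition gD where "gD x i = dr x S' (int k - 3) (int k - 2) i"
definition wD where "wD x i = 2 * a x * aD x i - cD x i"
definition vD where "vD x i = - (gD x i * a x + g x * aD x i)"
definition qD where "qD x i = dq x S (int k) i"
definition nD where "nD x i = - dr x S (int k - 2) (int k - 1) i"

context
  fixes x assumes adm: "adm n k K x"
begin

lemma coneS: "cone x S (int k)" and coneS': "cone x S' (int k - 1)"
proof -
  show c: "cone x S (int k)" using adm by (simp add: adm_def)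
  show "cone x S' (int k - 1)" using cone_delete[OF _ oneS c] by (simp only: S'_eq finite_atLeastAtMost)
qed

lemma ge_K: "i \<in> S \<Longrightarrow> x i \<ge> - K" and sorted: "1 \<le> i \<Longrightarrow> i \<le> j \<Longrightarrow> j \<le> n \<Longrightarrow> x j \<le> x i"
  using adm by (auto simp: adm_def)

lemma q_bounds: "q x S (int k) > 0" "q x S (int k) \<le> 1" "q x S (int k - 1) \<ge> 1"
  using q_pos[OF coneS] k2 adm by (simp_all add: adm_def)

lemma q_delete_bounds:
  assumes i: "i \<in> S"
  shows "q x (S - {i}) (int k - 1) \<ge> q x S (int k)" "q x (S - {i}) (int k - 1) > 0"
proof -
  have c: "cone x (S - {i}) (int k - 1)" by (rule cone_delete[OF _ i coneS]) simp
  show 1: "q x (S - {i}) (int k - 1) \<ge> q x S (int k)"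
    by (rule q_le_delete[OF _ _ _ i]) (use k2 in \<open>auto intro!: cone_mono[OF coneS]\<close>)
  show "q x (S - {i}) (int k - 1) > 0" using 1 q_bounds(1) by linarith
qed

lemma a_bounds: "a x > 0" "a x \<ge> q x S (int k)" "a x \<le> n * L"
proof -
  show "a x > 0" "a x \<ge> q x S (int k)" using q_delete_bounds[OF oneS] by (simp_all only: S'_eq a_def)
  have "q x S' (int (k - 2) + 1) \<le> real (card S') * L"
  proof (rule q_upper[of _ _ _ T'])
    show "cone x S' (int (k - 2))" using k2 by (intro cone_mono[OF coneS']) simp
    fix j assume "j \<in> S' - T'"
    then show "x j \<le> L" using T'U by (intro upper[OF adm]) auto
  qed (use L1 cards T'U in auto)
  moreover have "real (card S') * L \<le> n * L" using L1 by (intro mult_right_mono) simp_all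
  moreover have "int (k - 2) + 1 = int k - 1" using k2 by simp
  ultimately show "a x \<le> n * L" by (simp add: a_def)
qed

lemma nondegS: "nondeg n 1 K L x S T"
proof -
  have "\<forall>i\<in>S - T. x i \<le> L" by (auto intro!: upper[OF adm])
  moreover have "cone x S (int k - 1)" by (rule cone_mono[OF coneS]) simp
  moreover have "T \<subseteq> S" "\<forall>i\<in>S. - K \<le> x i" using kn ge_K by auto
  ultimately show ?thesis unfolding nondeg_def cards(2) using q_bounds(3) by simp
qed

lemma nondegS': "nondeg n 1 K L x S' T'"
proof -
  have "q x S' (int k - 2) \<ge> 1" if "k \<ge> 3"
  proof -
    have "q x S (int k - 1) \<le> q x (S - {1}) (int k - 1 - 1)"
      by (rule q_le_delete[OF _ _ _ oneS]) (use that in \<open>auto intro!: cone_mono[OF coneS]\<close>)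
    moreover have "int k - 1 - 1 = int k - 2" by simp
    ultimately show ?thesis using q_bounds(3) by (simp only: S'_eq)
  qed
  moreover have "cone x S' (int k - 2)" by (rule cone_mono[OF coneS']) simp
  moreover have "card T' \<ge> 1 \<Longrightarrow> k \<ge> 3" by simp
  moreover have "\<forall>i\<in>S' - T'. x i \<le> L" using T'U by (auto intro!: upper[OF adm])
  moreover have "T' \<subseteq> S'" "\<forall>i\<in>S'. - K \<le> x i" "card S' \<le> n" using kn ge_K by auto
  ultimately show ?thesis unfolding nondeg_def cards(4) by simp
qed

lemma eS'_pos: "es x S' (int k - 2) > 0" "es x S' (int k - 1) > 0" and eS_pos: "es x S (int k - 1) > 0" "es x S (int k - 2) > 0" "es x S (int k) > 0"
  using coneD[OF coneS'] coneD[OF coneS] k2 by simp_all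

text \<open>\<open>g\<close> is the reciprocal of q_{k-2} on S', and deletion gives q_{k-2}(S')
  \<ge> q_{k-1}(S) \<ge> 1. For k = 2 the degree -1 makes \<open>g\<close> equal to 0.\<close>

lemma g_bounds: "0 \<le> g x" "g x \<le> 1"
proof -
  show "0 \<le> g x"
  proof (cases "k = 2")
    case False
    then have "es x S' (int k - 3) > 0" using k2 by (intro coneD[OF coneS']) auto
    then show ?thesis using eS'_pos by (simp add: g_def)
  next
    case True
    then show ?thesis unfolding g_def by simp
  qed
  show "g x \<le> 1"
  proof (cases "k = 2")
    case False
    then have p: "es x S' (int k - 3) > 0" using k2 by (intro coneD[OF coneS']) auto
    have "q x S' (int k - 2) \<ge> 1" using nondegS' False k2 unfolding nondeg_def cards(4) by simp
    moreover have "int k - 2 - 1 = int k - 3" by simp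
    ultimately have "es x S' (int k - 2) \<ge> es x S' (int k - 3)" unfolding q_def using p by (simp add: field_simps)
    then show ?thesis using eS'_pos by (simp add: g_def)
  next
    case True
    then show ?thesis unfolding g_def by simp
  qed
qed

text \<open>Newton's inequality on S' in degree k - 1. The bound by a^2 keeps \<open>W\<close> away
  from 0, and it lets a term of size a s be absorbed by W s^2.\<close>

lemma w_bounds: "of_nat k * w x \<ge> (a x)\<^sup>2" "w x > 0"
proof -
  have c: "cone x S' (int k - 1 - 1)" by (rule cone_mono[OF coneS']) simp
  have kk: "int k - 1 + 1 = int k" "int k - 1 - 1 = int k - 2" by simp_all
  let ?A = "es x S' (int k - 1)" and ?B = "es x S' (int k - 2)" and ?C = "es x S' (int k)"
  have "of_int (int k) * (?A\<^sup>2 - ?C * ?B) \<ge> ?A\<^sup>2"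
    using newton[OF _ _ c] k2 by (simp only: kk) simp
  then have "?A\<^sup>2 / ?B\<^sup>2 \<le> real k * (?A\<^sup>2 - ?C * ?B) / ?B\<^sup>2" by (intro divide_right_mono) auto
  moreover have "w x = (?A\<^sup>2 - ?C * ?B) / ?B\<^sup>2"
    unfolding w_def a_def q_def kk using eS'_pos by (simp add: field_simps power2_eq_square)
  moreover have "a x = ?A / ?B" by (simp add: a_def q_def kk)
  ultimately show 1: "of_nat k * w x \<ge> (a x)\<^sup>2" by (simp add: power_divide)
  have "(a x)\<^sup>2 > 0" using a_bounds(1) by simp
  then have "of_nat k * w x > 0" using 1 by linarith
  then show "w x > 0" by (simp add: zero_less_mult_iff)
qed

text \<open>Both numerators are Newton expressions on \<open>S - {i}\<close>, in degree k - 2 for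
  \<open>nD\<close> and k - 1 for \<open>qD\<close>. The bound for \<open>qD\<close> degenerates
  when the deleted quotient is small, which can happen for l = k - 2; there the bound for
  \<open>nD\<close> takes over.\<close>

lemma nD_lower:
  assumes i: "i \<in> S"
  shows "nD x i \<ge> 1 / k * (1 / (x i + q x (S - {i}) (int k - 1))\<^sup>2)"
    and "qD x i \<ge> 1 / k * ((q x (S - {i}) (int k - 1))\<^sup>2 / (x i + q x (S - {i}) (int k - 1))\<^sup>2)"
    and "x i + q x (S - {i}) (int k - 1) > 0"
proof -
  have c1: "cone x S (int k - 1)" by (rule cone_mono[OF coneS]) simp
  have ci: "cone x (S - {i}) (int k - 1 - 1)" by (rule cone_delete[OF _ i c1]) simp
  let ?h = "es x (S - {i}) (int k - 2)" and ?e = "es x S (int k - 1)"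
  let ?u = "es x (S - {i}) (int k - 1)" and ?l = "es x (S - {i}) (int k - 3)"
  have kk: "int k - 1 - 1 = int k - 2" "int k - 2 - 1 = int k - 3" "int k - 2 + 1 = int k - 1" by simp_all
  have h: "?h > 0" using coneD[OF ci, of "int k - 2"] k2 by simp
  have d: "x i + q x (S - {i}) (int k - 1) = ?e / ?h"
    using q_denom[OF _ i, of x "int k"] h by simp
  then show pos: "x i + q x (S - {i}) (int k - 1) > 0" using h eS_pos by simp
  have qi: "q x (S - {i}) (int k - 1) = ?u / ?h" by (simp only: q_def kk)
  have "(?u / ?e)\<^sup>2 \<le> of_int (int k) * dq x S (int k) i"
    using dq_lower[OF _ i c1] k2 by simp
  moreover have "(q x (S - {i}) (int k - 1))\<^sup>2 / (x i + q x (S - {i}) (int k - 1))\<^sup>2 = (?u / ?e)\<^sup>2"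
    by (subst d, subst qi) (use h eS_pos in \<open>simp add: power_divide\<close>)
  ultimately show "qD x i \<ge> 1 / k * ((q x (S - {i}) (int k - 1))\<^sup>2 / (x i + q x (S - {i}) (int k - 1))\<^sup>2)"
    unfolding qD_def using k2 by (intro inv_mult_le) simp_all
  have "cone x (S - {i}) (int k - 2 - 1)" by (rule cone_mono[OF ci]) simp
  from newton[OF _ _ this] have "?h\<^sup>2 \<le> (of_int (int k - 2) + 1) * (?h\<^sup>2 - ?u * ?l)"
    using k2 by (simp only: kk) simp
  moreover have "?h\<^sup>2 > 0" using h by simp
  ultimately have "(of_int (int k - 2) + 1) * (?h\<^sup>2 - ?u * ?l) > 0" by linarith
  then have "?h\<^sup>2 - ?u * ?l > 0" using k2 by (simp add: zero_less_mult_iff)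
  then have "(of_int (int k - 2) + 1) * (?h\<^sup>2 - ?u * ?l) \<le> k * (?h\<^sup>2 - ?u * ?l)"
    by (intro mult_right_mono) auto
  then have "?h\<^sup>2 \<le> k * (?h\<^sup>2 - ?u * ?l)" using \<open>?h\<^sup>2 \<le> (of_int (int k - 2) + 1) * (?h\<^sup>2 - ?u * ?l)\<close> by linarith
  then have "?h\<^sup>2 / ?e\<^sup>2 \<le> k * (?h\<^sup>2 - ?u * ?l) / ?e\<^sup>2" by (rule divide_right_mono) simp
  moreover have "nD x i = (?h\<^sup>2 - ?u * ?l) / ?e\<^sup>2"
  proof -
    have "dr x S (int k - 2) (int k - 1) i = (?l * ?u - ?h * ?h) / ?e\<^sup>2"
      using dr_alt[OF _ i, of x "int k - 2" "int k - 1"] by (simp only: kk finite_atLeastAtMost)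
    then show ?thesis by (simp only: nD_def minus_divide_left minus_diff_eq power2_eq_square mult.commute)
  qed
  moreover have "1 / (x i + q x (S - {i}) (int k - 1))\<^sup>2 = ?h\<^sup>2 / ?e\<^sup>2" unfolding d by (simp add: power_divide)
  ultimately show "nD x i \<ge> 1 / k * (1 / (x i + q x (S - {i}) (int k - 1))\<^sup>2)"
    using k2 by (intro inv_mult_le) simp_all
qed

end

text \<open>The parameter \<open>e\<close> is \<open>0\<close> for \<open>l = k - 1\<close> and \<open>1\<close> for \<open>l = k - 2\<close>.\<close>

definition normal :: "real \<Rightarrow> (nat \<Rightarrow> real) \<Rightarrow> bool" where
  "normal e x \<longleftrightarrow> adm n k K x \<and>
    (e = 0 \<and> q x S (int k) = 1 \<or> e = 1 \<and> k \<ge> 3 \<and> q x S (int k) * q x S (int k - 1) = 1)"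

text \<open>At F = 1, \<open>G\<close> is F^{ii} for e = 0 and F^{ii} / q_{k-1} for e = 1, as one
  sees by differentiating q_k = F * (1 / q_{k-1}). \<open>W\<close> and \<open>Z\<close> are the
  coefficients of z_1^2 and z_1 z_i in the lower bound \<open>D_lower\<close>, after scaling by m.
  The parameter is real because e * \<kappa> is also inserted for it.\<close>

definition G where "G e x i = qD x i + e * nD x i"
definition W where "W e x = w x + e * v x"
definition Z where "Z e x i = wD x i + e * vD x i - 2 * W e x * aD x i / m x"

lemma G_lower:
  fixes x :: "nat \<Rightarrow> real" and e :: real
  assumes nrm: "normal e x" and i: "i \<in> S"
  shows "G e x i * (4 * real k * (1 + (x i)\<^sup>2)) \<ge> 1" "G e x i > 0"
proof -
  have adm: "adm n k K x" using nrm by (simp add: normal_def)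
  let ?a = "q x (S - {i}) (int k - 1)"
  note low = nD_lower[OF adm i]
  \<comment> \<open>One bound for both values of e: for e = 0 the deleted quotient \<open>?a\<close>
    is at least q_k = 1, so half of 1 + ?a^2 is at most ?a^2; for e = 1 the two bounds of
    \<open>nD_lower\<close> add up.\<close>
  have "G e x i \<ge> 1 / k * ((1 + ?a\<^sup>2) / 2 / (x i + ?a)\<^sup>2)"
  proof (cases "e = 0")
    case True
    then have "?a \<ge> 1" using nrm q_delete_bounds(1)[OF adm i] by (simp add: normal_def)
    then have "?a\<^sup>2 \<ge> 1" by simp
    then have "(1 + ?a\<^sup>2) / 2 \<le> ?a\<^sup>2" by simp
    then have "1 / k * ((1 + ?a\<^sup>2) / 2 / (x i + ?a)\<^sup>2) \<le> 1 / k * (?a\<^sup>2 / (x i + ?a)\<^sup>2)"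
      by (intro mult_left_mono divide_right_mono) auto
    then show ?thesis using low True by (simp add: G_def)
  next
    case False
    then have e: "e = 1" using nrm by (simp add: normal_def)
    have "1 / k * ((1 + ?a\<^sup>2) / 2 / (x i + ?a)\<^sup>2) \<le> 1 / k * ((1 + ?a\<^sup>2) / (x i + ?a)\<^sup>2)"
      by (intro mult_left_mono divide_right_mono) auto
    also have "\<dots> = 1 / k * (1 / (x i + ?a)\<^sup>2) + 1 / k * (?a\<^sup>2 / (x i + ?a)\<^sup>2)"
      by (simp only: add_divide_distrib distrib_left)
    finally show ?thesis using low e by (simp add: G_def)
  qed
  moreover have "1 / k * ((1 + ?a\<^sup>2) / 2 / (x i + ?a)\<^sup>2) \<ge> 1 / (4 * real k * (1 + (x i)\<^sup>2))"
  proof -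
    have "0 \<le> (x i - ?a)\<^sup>2 + 2 * (x i)\<^sup>2 * ?a\<^sup>2 + 2" by simp
    then have "(x i + ?a)\<^sup>2 \<le> 2 * ((1 + ?a\<^sup>2) * (1 + (x i)\<^sup>2))"
      by (simp add: power2_eq_square algebra_simps)
    then have "1 / (2 * (1 + (x i)\<^sup>2)) \<le> (1 + ?a\<^sup>2) / (x i + ?a)\<^sup>2"
      using low(3) add_pos_nonneg[of 1 "(x i)\<^sup>2"] by (intro inv_le_frac) simp_all
    then have "1 / k / 2 * (1 / (2 * (1 + (x i)\<^sup>2))) \<le> 1 / k / 2 * ((1 + ?a\<^sup>2) / (x i + ?a)\<^sup>2)"
      by (intro mult_left_mono) auto
    then show ?thesis by (simp add: mult_ac)
  qed
  ultimately have *: "G e x i \<ge> 1 / (4 * real k * (1 + (x i)\<^sup>2))" by linarith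
  have pos: "4 * real k * (1 + (x i)\<^sup>2) > 0" using k2 by (intro mult_pos_pos add_pos_nonneg) auto
  then show "G e x i * (4 * real k * (1 + (x i)\<^sup>2)) \<ge> 1" using * by (simp only: pos_divide_le_eq)
  have "1 / (4 * real k * (1 + (x i)\<^sup>2)) > 0" using pos by (intro divide_pos_pos) auto
  then show "G e x i > 0" using * by linarith
qed

lemma v_bounds:
  fixes x :: "nat \<Rightarrow> real"
  assumes adm: "adm n k K x" and k3: "k \<ge> 3"
  shows "0 \<le> v x" "v x \<le> 1"
proof -
  have kk: "int k - 2 + 1 = int k - 1" "int k - 2 - 1 = int k - 3" "int k - 1 - 1 = int k - 2" by simp_all
  have "cone x S' (int k - 2 - 1)" by (rule cone_mono[OF coneS'[OF adm]]) simp
  from newton_weak[OF _ _ this] have "es x S' (int k - 1) * es x S' (int k - 3) \<le> (es x S' (int k - 2))\<^sup>2"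
    using k2 by (simp only: kk) simp
  moreover have "g x * a x = es x S' (int k - 1) * es x S' (int k - 3) / (es x S' (int k - 2))\<^sup>2"
    by (simp add: g_def a_def q_def kk power2_eq_square)
  ultimately have "g x * a x \<le> 1" using eS'_pos[OF adm] by (simp add: divide_le_eq_1)
  then show "0 \<le> v x" by (simp add: v_def)
  show "v x \<le> 1" using g_bounds[OF adm] a_bounds[OF adm] by (simp add: v_def)
qed

lemma W_ge_w: "normal e x \<Longrightarrow> W e x \<ge> w x" "normal e x \<Longrightarrow> 0 \<le> \<kappa> \<Longrightarrow> W (e * \<kappa>) x \<ge> w x"
  using v_bounds[of x] by (auto simp: normal_def W_def)

end

section \<open>Large intermediate entries\<close>

lemma frac_diff_bound:
  fixes e P1 P2 t B1 B2 :: real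
  assumes "e > 0" "\<bar>P1\<bar> * t \<le> B1 * e\<^sup>2" "\<bar>P2\<bar> * t \<le> B2 * e\<^sup>2" "t \<ge> 0"
  shows "\<bar>(P1 - P2) / e\<^sup>2\<bar> * t \<le> B1 + B2"
proof -
  have "\<bar>P1 - P2\<bar> * t \<le> (\<bar>P1\<bar> + \<bar>P2\<bar>) * t" using assms(4) by (intro mult_right_mono) auto
  also have "\<dots> \<le> (B1 + B2) * e\<^sup>2" using assms(2,3) unfolding distrib_right by linarith
  finally have "\<bar>P1 - P2\<bar> * t / e\<^sup>2 \<le> (B1 + B2) * e\<^sup>2 / e\<^sup>2" by (intro divide_right_mono) auto
  then show ?thesis using assms(1) by (simp add: abs_divide)
qed

lemma abs_sum4_le: "\<bar>p - c + r - s\<bar> \<le> \<bar>p\<bar> + \<bar>c\<bar> + \<bar>r\<bar> + \<bar>s\<bar>" for p c r s :: real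
  by linarith

lemma dr_split:
  assumes "es x S r \<noteq> 0"
  shows "dr x S p r i = es x (S - {i}) (p - 1) / es x S r - es x S p / es x S r * (es x (S - {i}) (r - 1) / es x S r)"
  using assms unfolding dr_def by (simp add: field_simps power2_eq_square)

lemma es_ratio_tendsto:
  fixes X :: "nat \<Rightarrow> nat \<Rightarrow> real"
  assumes T: "finite T" and U: "finite U" "T \<inter> U = {}" "U1 \<subseteq> U"
    and XT: "\<And>i. i \<in> T \<Longrightarrow> filterlim (\<lambda>n. X n i) at_top sequentially"
    and XU: "\<And>i. i \<in> U \<Longrightarrow> (\<lambda>n. X n i) \<longlonglongrightarrow> \<mu> i"
  shows "(\<lambda>n. es (X n) (T \<union> U1) (int (card T) + s) / es (X n) (T \<union> U) (int (card T))) \<longlonglongrightarrow> es \<mu> U1 s"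
proof -
  have U1: "finite U1" "T \<inter> U1 = {}" using U finite_subset by auto
  have a: "(\<lambda>n. es (X n) (T \<union> U1) (int (card T) + s) / prod (X n) T) \<longlonglongrightarrow> es \<mu> U1 s"
    by (rule es_div_prod_tendsto[OF T U1 XT]) (use U XU in auto)
  have b: "(\<lambda>n. es (X n) (T \<union> U) (int (card T) + 0) / prod (X n) T) \<longlonglongrightarrow> es \<mu> U 0"
    by (rule es_div_prod_tendsto[OF T U(1,2) XT XU])
  have "(\<lambda>n. es (X n) (T \<union> U1) (int (card T) + s) / prod (X n) T /
      (es (X n) (T \<union> U) (int (card T) + 0) / prod (X n) T)) \<longlonglongrightarrow> es \<mu> U1 s / es \<mu> U 0"
    by (rule tendsto_divide[OF a b]) (use U in simp)
  moreover have "eventually (\<lambda>n. \<forall>i\<in>T. X n i > 0) sequentially"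
    unfolding eventually_ball_finite_distrib[OF T] using XT by (simp add: filterlim_at_top_dense)
  then have "eventually (\<lambda>n. es (X n) (T \<union> U1) (int (card T) + s) / prod (X n) T /
      (es (X n) (T \<union> U) (int (card T) + 0) / prod (X n) T)
    = es (X n) (T \<union> U1) (int (card T) + s) / es (X n) (T \<union> U) (int (card T))) sequentially"
  proof eventually_elim
    case (elim n)
    then have "prod (X n) T \<noteq> 0" using T by (auto simp: prod_zero_iff)
    then show ?case by simp
  qed
  ultimately show ?thesis using Lim_transform_eventually U by fastforce
qed

lemma es_2: "finite S \<Longrightarrow> 2 * es x S 2 = (sum x S)\<^sup>2 - (\<Sum>i\<in>S. (x i)\<^sup>2)" for x :: "'i \<Rightarrow> real"
proof -
  assume S: "finite S"
  have "2 * es x S 2 = (\<Sum>i\<in>S. x i * es x (S - {i}) 1)" using es_euler[OF S, of 2 x] by simp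
  also have "\<dots> = (\<Sum>i\<in>S. x i * sum x S - (x i)\<^sup>2)"
    by (intro sum.cong refl) (simp add: es_1 S sum_diff1 power2_eq_square algebra_simps)
  finally show ?thesis by (simp add: sum_subtractf power2_eq_square flip: sum_distrib_right)
qed

context quot
begin

lemma unif_bounds:
  "\<exists>B\<ge>1. \<forall>x. adm n k K x \<longrightarrow> (\<forall>i\<in>S'. \<bar>aD x i\<bar> * (1 + (x i)\<^sup>2) \<le> B \<and> \<bar>cD x i\<bar> * (1 + (x i)\<^sup>2) \<le> B \<and>
    (k \<ge> 3 \<longrightarrow> \<bar>gD x i\<bar> * (1 + (x i)\<^sup>2) \<le> B)) \<and> (\<forall>i\<in>S. \<bar>qD x i\<bar> * (1 + (x i)\<^sup>2) \<le> B) \<and> w x \<le> B \<and> a x \<le> B"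
proof -
  define j where "j = k - 2"
  have j: "int j - 1 = int k - 3" "int j = int k - 2" using k2 by (simp_all add: j_def)
  define j' where "j' = k - 1"
  have j': "int j' - 1 = int k - 2" "int j' = int k - 1" using k2 by (simp_all add: j'_def)
  have L0: "L \<ge> 0" using L1 by simp
  note pb = prod_bound[OF zero_less_one K0 L0, of n]
  obtain B where B: "\<And>s t. B s t \<ge> 0" "\<And>s t x S T i. nondeg n 1 K L x S T \<Longrightarrow> card T = j \<Longrightarrow> i \<in> S \<Longrightarrow>
    \<bar>es x (S - {i}) (int j - 1 + int s) * es x (S - {i}) (int j - 1 + int t)\<bar> * (1 + (x i)\<^sup>2) \<le> B s t * (es x S (int j))\<^sup>2"
    using pb[of j] by metis
  obtain B' where B': "\<And>s t. B' s t \<ge> 0" "\<And>s t x S T i. nondeg n 1 K L x S T \<Longrightarrow> card T = j' \<Longrightarrow> i \<in> S \<Longrightarrow>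
    \<bar>es x (S - {i}) (int j' - 1 + int s) * es x (S - {i}) (int j' - 1 + int t)\<bar> * (1 + (x i)\<^sup>2) \<le> B' s t * (es x S (int j'))\<^sup>2"
    using pb[of j'] by metis
  obtain C where C: "ebd n 1 K L j 2 C" using ebd_exists[OF zero_less_one K0 L0] by blast
  have C0: "C \<ge> 0" using C by (simp add: ebd_def)
  define D where "D = 1 + B 1 1 + B 2 0 + B 2 1 + B 3 0 + B 0 0 + B' 1 1 + B' 2 0 + (n * L)\<^sup>2 + C + n * L"
  have D: "D \<ge> 1" "B 1 1 + B 2 0 \<le> D" "B 2 1 + B 3 0 \<le> D" "B 0 0 \<le> D" "B' 1 1 + B' 2 0 \<le> D" "(n * L)\<^sup>2 + C \<le> D" "n * L \<le> D"
    using B(1) B'(1) C0 L0 unfolding D_def by (simp_all add: add_nonneg_nonneg add_increasing)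
  have main: "(\<forall>i\<in>S'. \<bar>aD x i\<bar> * (1 + (x i)\<^sup>2) \<le> D \<and> \<bar>cD x i\<bar> * (1 + (x i)\<^sup>2) \<le> D \<and>
    (k \<ge> 3 \<longrightarrow> \<bar>gD x i\<bar> * (1 + (x i)\<^sup>2) \<le> D)) \<and> (\<forall>i\<in>S. \<bar>qD x i\<bar> * (1 + (x i)\<^sup>2) \<le> D) \<and> w x \<le> D \<and> a x \<le> D"
    if adm: "adm n k K x" for x
  proof (intro conjI ballI impI)
    have cT: "card T' = j" "card T = j'" by (simp_all add: j_def j'_def)
    note bd = B(2)[OF nondegS'[OF adm] cT(1), unfolded j]
    note bd' = B'(2)[OF nondegS[OF adm] cT(2), unfolded j']
    have pos: "es x S' (int k - 2) > 0" "es x S (int k - 1) > 0" using eS'_pos[OF adm] eS_pos[OF adm] by auto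
    show "a x \<le> D" using a_bounds(3)[OF adm] D by linarith
    have "\<bar>es x S' (int j + int 2)\<bar> \<le> C * es x S' (int j)"
      using C nondegS'[OF adm] cT(1) unfolding ebd_def by blast
    then have "\<bar>es x S' (int k)\<bar> \<le> C * es x S' (int k - 2)" unfolding j(2) by simp
    then have "\<bar>es x S' (int k) / es x S' (int k - 2)\<bar> \<le> C" using pos by (simp add: abs_divide pos_divide_le_eq)
    moreover have "(a x)\<^sup>2 \<le> (n * L)\<^sup>2" using a_bounds[OF adm] by (intro power_mono) auto
    ultimately show "w x \<le> D" using D(6) unfolding w_def by linarith
    fix i
    have t0: "1 + (x i)\<^sup>2 \<ge> 0" by simp
    {
      assume i: "i \<in> S'"
      have "\<bar>aD x i\<bar> * (1 + (x i)\<^sup>2) \<le> B 1 1 + B 2 0"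
        unfolding aD_def dr_alt[OF finite_atLeastAtMost i] 
        by (rule frac_diff_bound[OF pos(1) _ _ t0]) (use bd[OF i, of 1 1] bd[OF i, of 2 0] in \<open>simp_all add: algebra_simps\<close>)
      then show "\<bar>aD x i\<bar> * (1 + (x i)\<^sup>2) \<le> D" using D by linarith
      have "\<bar>cD x i\<bar> * (1 + (x i)\<^sup>2) \<le> B 2 1 + B 3 0"
        unfolding cD_def dr_alt[OF finite_atLeastAtMost i] 
        by (rule frac_diff_bound[OF pos(1) _ _ t0]) (use bd[OF i, of 2 1] bd[OF i, of 3 0] in \<open>simp_all add: algebra_simps\<close>)
      then show "\<bar>cD x i\<bar> * (1 + (x i)\<^sup>2) \<le> D" using D by linarith
      assume k3: "k \<ge> 3"
      have ci: "cone x (S' - {i}) (int k - 1 - 1)" by (rule cone_delete[OF _ i coneS'[OF adm]]) simp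
      have kk: "int k - 3 + 1 = int k - 2" "int k - 3 - 1 = int k - 4" "int k - 2 - 1 = int k - 3" by simp_all
      let ?g = "\<lambda>s. es x (S' - {i}) (int k - s)"
      \<comment> \<open>Degree k - 4 lies outside the range of \<open>prod_bound\<close>. Newton's
        inequality instead bounds the whole numerator of \<open>gD\<close> by the square of the
        function of degree k - 3.\<close>
      have "cone x (S' - {i}) (int k - 3 - 1)" by (rule cone_mono[OF ci]) simp
      from newton_weak[OF _ _ this] have N: "?g 2 * ?g 4 \<le> (?g 3)\<^sup>2" using k3 by (simp only: kk) simp
      have "?g 2 \<ge> 0" using coneD[OF ci, of "int k - 2"] k3 by simp
      moreover have "?g 4 \<ge> 0"
      proof (cases "k = 3")
        case False
        then show ?thesis using coneD[OF ci, of "int k - 4"] k3 by simp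
      qed simp
      ultimately have "0 \<le> ?g 2 * ?g 4" by simp
      then have "\<bar>?g 4 * ?g 2 - ?g 3 * ?g 3\<bar> \<le> (?g 3)\<^sup>2" using N by (simp add: power2_eq_square mult.commute)
      then have "\<bar>?g 4 * ?g 2 - ?g 3 * ?g 3\<bar> * (1 + (x i)\<^sup>2) \<le> \<bar>?g 3 * ?g 3\<bar> * (1 + (x i)\<^sup>2)"
        by (intro mult_right_mono) (simp_all add: power2_eq_square)
      also have "\<dots> \<le> B 0 0 * (es x S' (int k - 2))\<^sup>2" using bd[OF i, of 0 0] by simp
      finally have "\<bar>gD x i\<bar> * (1 + (x i)\<^sup>2) \<le> B 0 0"
        using frac_diff_bound[OF pos(1), of "?g 4 * ?g 2 - ?g 3 * ?g 3" "1 + (x i)\<^sup>2" "B 0 0" 0 0]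
        unfolding gD_def dr_alt[OF finite_atLeastAtMost i] kk by simp
      then show "\<bar>gD x i\<bar> * (1 + (x i)\<^sup>2) \<le> D" using D by linarith
    }
    assume i: "i \<in> S"
    have "\<bar>qD x i\<bar> * (1 + (x i)\<^sup>2) \<le> B' 1 1 + B' 2 0"
      unfolding qD_def dq_eq_dr[OF finite_atLeastAtMost i] dr_alt[OF finite_atLeastAtMost i] 
      by (rule frac_diff_bound[OF pos(2) _ _ t0]) (use bd'[OF i, of 1 1] bd'[OF i, of 2 0] in \<open>simp_all add: algebra_simps\<close>)
    then show "\<bar>qD x i\<bar> * (1 + (x i)\<^sup>2) \<le> D" using D by linarith
  qed
  then show ?thesis using D(1) by blast
qed

lemma unif_bounds_Z:
  "\<exists>B\<ge>1. \<forall>x e \<kappa>. normal e x \<longrightarrow> x 1 \<ge> 1 \<longrightarrow> 0 \<le> \<kappa> \<longrightarrow> \<kappa> \<le> 1 \<longrightarrow>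
    (\<forall>i\<in>S'. \<bar>Z (e * \<kappa>) x i\<bar> * (1 + (x i)\<^sup>2) \<le> B) \<and> (\<forall>i\<in>S. \<bar>qD x i\<bar> * (1 + (x i)\<^sup>2) \<le> B) \<and> a x \<le> B \<and> W (e * \<kappa>) x \<le> B"
proof -
  obtain B where B1: "B \<ge> 1" and B: "\<And>x. adm n k K x \<Longrightarrow> (\<forall>i\<in>S'. \<bar>aD x i\<bar> * (1 + (x i)\<^sup>2) \<le> B \<and> \<bar>cD x i\<bar> * (1 + (x i)\<^sup>2) \<le> B \<and>
    (k \<ge> 3 \<longrightarrow> \<bar>gD x i\<bar> * (1 + (x i)\<^sup>2) \<le> B)) \<and> (\<forall>i\<in>S. \<bar>qD x i\<bar> * (1 + (x i)\<^sup>2) \<le> B) \<and> w x \<le> B \<and> a x \<le> B"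
    using unif_bounds by blast
  define D where "D = 2 * B * B + B + (B * B + B) + 2 * (B + 1) * B"
  have BB: "B * B \<ge> 0" using B1 by simp
  have "D = 5 * (B * B) + 4 * B" by (simp add: D_def algebra_simps)
  then have D: "D \<ge> 1" "B \<le> D" "B + 1 \<le> D" using B1 BB by linarith+
  have main: "(\<forall>i\<in>S'. \<bar>Z (e * \<kappa>) x i\<bar> * (1 + (x i)\<^sup>2) \<le> D) \<and> (\<forall>i\<in>S. \<bar>qD x i\<bar> * (1 + (x i)\<^sup>2) \<le> D) \<and> a x \<le> D \<and> W (e * \<kappa>) x \<le> D"
    if nrm: "normal e x" and x1: "x 1 \<ge> 1" and \<kappa>: "0 \<le> \<kappa>" "\<kappa> \<le> 1" for x e \<kappa>
  proof -
    have adm: "adm n k K x" using nrm by (simp add: normal_def)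
    note b = B[OF adm]
    have ap: "a x > 0" by (rule a_bounds[OF adm])
    have e: "e = 0 \<or> e = 1 \<and> k \<ge> 3" using nrm by (auto simp: normal_def)
    have m1: "m x \<ge> 1" using x1 ap by (simp add: m_def)
    have W: "0 \<le> W (e * \<kappa>) x" "W (e * \<kappa>) x \<le> B + 1"
    proof -
      show "0 \<le> W (e * \<kappa>) x" using W_ge_w(2)[OF nrm \<kappa>(1)] w_bounds[OF adm] by linarith
      have "e * \<kappa> * v x \<le> 1" using e \<kappa> v_bounds[OF adm] mult_le_one[of \<kappa> "v x"] by auto
      then show "W (e * \<kappa>) x \<le> B + 1" using b by (simp add: W_def)
    qed
    have "\<bar>Z (e * \<kappa>) x i\<bar> * (1 + (x i)\<^sup>2) \<le> D" if i: "i \<in> S'" for i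
    proof -
      let ?t = "1 + (x i)\<^sup>2"
      have t: "?t \<ge> 0" by simp
      have bi: "\<bar>aD x i\<bar> * ?t \<le> B" "\<bar>cD x i\<bar> * ?t \<le> B" using b i by auto
      have 1: "\<bar>2 * a x * aD x i\<bar> * ?t \<le> 2 * B * B"
      proof -
        have "\<bar>2 * a x * aD x i\<bar> * ?t = 2 * a x * (\<bar>aD x i\<bar> * ?t)" using ap by (simp add: abs_mult)
        also have "\<dots> \<le> 2 * B * B" using bi b ap by (intro mult_mono) auto
        finally show ?thesis .
      qed
      have 2: "\<bar>e * \<kappa> * vD x i\<bar> * ?t \<le> B * B + B"
      proof (cases "e = 0")
        case True
        then show ?thesis using BB B1 by simp
      next
        case False
        then have e1: "e = 1" "k \<ge> 3" using e by auto
        then have gi: "\<bar>gD x i\<bar> * ?t \<le> B" using b i by auto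
        have "\<bar>vD x i\<bar> \<le> \<bar>gD x i\<bar> * a x + g x * \<bar>aD x i\<bar>"
          using abs_triangle_ineq[of "gD x i * a x" "g x * aD x i"] ap g_bounds[OF adm] unfolding vD_def
          by (simp add: abs_mult)
        then have "\<bar>vD x i\<bar> * ?t \<le> (\<bar>gD x i\<bar> * ?t) * a x + g x * (\<bar>aD x i\<bar> * ?t)"
          using mult_right_mono[OF _ t] by (fastforce simp: algebra_simps)
        also have "\<dots> \<le> B * B + 1 * B" using gi bi b ap g_bounds[OF adm] by (intro add_mono mult_mono) auto
        finally have *: "\<bar>vD x i\<bar> * ?t \<le> B * B + B" by simp
        have "\<bar>e * \<kappa> * vD x i\<bar> * ?t = \<kappa> * (\<bar>vD x i\<bar> * ?t)" using e1 \<kappa> by (simp add: abs_mult)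
        also have "\<dots> \<le> 1 * (\<bar>vD x i\<bar> * ?t)" using \<kappa> by (intro mult_right_mono) auto
        finally show ?thesis using * by simp
      qed
      have 3: "\<bar>2 * W (e * \<kappa>) x * aD x i / m x\<bar> * ?t \<le> 2 * (B + 1) * B"
      proof -
        have "\<bar>2 * W (e * \<kappa>) x * aD x i / m x\<bar> * ?t = 2 * W (e * \<kappa>) x * (\<bar>aD x i\<bar> * ?t) / m x"
          using W m1 by (simp add: abs_mult abs_divide)
        also have "\<dots> \<le> 2 * W (e * \<kappa>) x * (\<bar>aD x i\<bar> * ?t) / 1"
          using W m1 by (intro divide_left_mono) auto
        also have "\<dots> \<le> 2 * (B + 1) * B" using bi W by (simp only: div_by_1) (intro mult_mono, auto)
        finally show ?thesis .
      qed
      have "\<bar>Z (e * \<kappa>) x i\<bar> \<le> \<bar>2 * a x * aD x i\<bar> + \<bar>cD x i\<bar> + \<bar>e * \<kappa> * vD x i\<bar> + \<bar>2 * W (e * \<kappa>) x * aD x i / m x\<bar>"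
        unfolding Z_def wD_def by (rule abs_sum4_le)
      then have "\<bar>Z (e * \<kappa>) x i\<bar> * ?t \<le> (\<bar>2 * a x * aD x i\<bar> + \<bar>cD x i\<bar> + \<bar>e * \<kappa> * vD x i\<bar> + \<bar>2 * W (e * \<kappa>) x * aD x i / m x\<bar>) * ?t"
        by (rule mult_right_mono[OF _ t])
      also have "\<dots> \<le> D" using 1 2 3 bi(2) unfolding distrib_right D_def by linarith
      finally show ?thesis .
    qed
    moreover have "\<bar>qD x i\<bar> * (1 + (x i)\<^sup>2) \<le> D" if "i \<in> S" for i using b that D by fastforce
    moreover have "a x \<le> D" "W (e * \<kappa>) x \<le> D" using b W D by linarith+
    ultimately show ?thesis by blast
  qed
  then show ?thesis using D(1) by blast
qed

text \<open>In the limit \<open>Z\<close> becomes \<sigma> + \<mu>_i, where \<sigma> is the sum of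
  the bounded entries, while \<open>G\<close> becomes 1. For e = 0 one has \<sigma> = 1 and the sum
  of (\<sigma> + \<mu>_i)^2 would be too large; subtracting a * qD, which tends to \<sigma>, leaves
  \<mu>_i. For e = 1 one has \<sigma> = 0, and the factor 1 - e switches the correction off. The
  interval for \<kappa> makes room for giving away part of the convexity of 1 / q_{k-1}.\<close>

lemma caseI:
  assumes e01: "e = 0 \<or> e = 1"
  shows "\<exists>\<eta> M :: real. 0 < \<eta> \<and> \<eta> \<le> 1/2 \<and> M \<ge> 1 \<and> (\<forall>x \<kappa>. normal e x \<longrightarrow> x (k - 1) \<ge> M \<longrightarrow> 1 - \<eta> \<le> \<kappa> \<longrightarrow> \<kappa> \<le> 1 \<longrightarrow>
    (\<Sum>i\<in>S'. (Z (e * \<kappa>) x i - (1 - e) * a x * qD x i)\<^sup>2 / G e x i) \<le> (1 - \<eta>)\<^sup>2 * (2 * W (e * \<kappa>) x))"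
proof (rule ccontr)
  assume neg: "\<not> ?thesis"
  define H where "H x \<kappa> = (\<Sum>i\<in>S'. (Z (e * \<kappa>) x i - (1 - e) * a x * qD x i)\<^sup>2 / G e x i)" for x \<kappa>
  \<comment> \<open>Failure for \<eta> = 1 / (n + 2) and M = n + 1 at every n. Here n is the
    sequence index and hides the dimension. The first k - 1 entries then tend to infinity, while the
    others are bounded and converge along a subsequence.\<close>
  have "\<exists>x \<kappa>. normal e x \<and> x (k - 1) \<ge> real n + 1 \<and> 1 - 1 / (real n + 2) \<le> \<kappa> \<and> \<kappa> \<le> 1 \<and>
      \<not> H x \<kappa> \<le> (1 - 1 / (real n + 2))\<^sup>2 * (2 * W (e * \<kappa>) x)" for n :: nat
  proof -
    have "0 < 1 / (real n + 2)" "1 / (real n + 2) \<le> 1/2" "real n + 1 \<ge> 1" by (simp_all add: field_simps)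
    then show ?thesis using neg unfolding H_def by blast
  qed
  then obtain X0 \<kappa>0 where X0: "\<And>n. normal e (X0 n)" "\<And>n. X0 n (k - 1) \<ge> real n + 1"
    "\<And>n. 1 - 1 / (real n + 2) \<le> \<kappa>0 n" "\<And>n. \<kappa>0 n \<le> 1"
    "\<And>n. \<not> H (X0 n) (\<kappa>0 n) \<le> (1 - 1 / (real n + 2))\<^sup>2 * (2 * W (e * \<kappa>0 n) (X0 n))" by metis
  have bd: "\<bar>X0 j i\<bar> \<le> K + L" if "i \<in> U" for i j
  proof -
    have "adm n k K (X0 j)" using X0(1) by (simp add: normal_def)
    then have "X0 j i \<le> L" "X0 j i \<ge> - K" using upper[of "X0 j" i] ge_K[of "X0 j" i] that k2 by auto
    then show ?thesis using K0 L1 by linarith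
  qed
  have "\<exists>r \<mu>. strict_mono r \<and> (\<forall>i\<in>U. (\<lambda>n. X0 (r n) i) \<longlonglongrightarrow> \<mu> i)"
    by (rule finite_convergent_subseq[OF finite_atLeastAtMost bd])
  then obtain r \<mu> where r: "strict_mono r" and \<mu>: "\<And>i. i \<in> U \<Longrightarrow> (\<lambda>n. X0 (r n) i) \<longlonglongrightarrow> \<mu> i" by blast
  define X where "X j = X0 (r j)" for j
  define \<kappa> where "\<kappa> j = \<kappa>0 (r j)" for j
  have nrm: "normal e (X j)" for j by (simp add: X_def X0)
  have adm: "adm n k K (X j)" for j using nrm by (simp add: normal_def)
  have rj: "real (r j) \<ge> real j" for j using seq_suble[OF r, of j] by simp
  have Xk: "X j (k - 1) \<ge> real j + 1" for j using X0(2)[of "r j"] rj[of j] by (simp add: X_def)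
  have lim1: "(\<lambda>j. 1 - 1 / (real (r j) + 2)) \<longlonglongrightarrow> 1"
  proof -
    have "(\<lambda>j. 1 - inverse (real (j + 2))) \<longlonglongrightarrow> 1 - 0"
      by (intro tendsto_intros LIMSEQ_ignore_initial_segment[OF lim_inverse_n])
    then have "(\<lambda>j. 1 - 1 / (real j + 2)) \<longlonglongrightarrow> 1" by (simp add: divide_inverse add.commute)
    from LIMSEQ_subseq_LIMSEQ[OF this r] show ?thesis by (simp add: o_def)
  qed
  have k1: "\<kappa> \<longlonglongrightarrow> 1"
    by (rule tendsto_sandwich[OF _ _ lim1 tendsto_const]) (auto simp: \<kappa>_def X0)
  have \<kappa>b: "0 \<le> \<kappa> j" "\<kappa> j \<le> 1" for j
  proof -
    have "1 / (real (r j) + 2) \<le> 1" by (simp add: field_simps)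
    then show "0 \<le> \<kappa> j" unfolding \<kappa>_def using X0(3)[of "r j"] by linarith
  qed (simp add: \<kappa>_def X0)
  have XT: "filterlim (\<lambda>j. X j i) at_top sequentially" if i: "i \<in> T" for i
  proof (rule filterlim_at_top_mono[OF filterlim_real_sequentially], rule always_eventually, rule allI)
    fix j
    have "X j (k - 1) \<le> X j i" using i k2 kn by (intro sorted[OF adm]) auto
    then show "real j \<le> X j i" using Xk[of j] by linarith
  qed
  have XT': "filterlim (\<lambda>j. X j i) at_top sequentially" if "i \<in> T'" for i using that by (intro XT) auto
  have XU: "(\<lambda>j. X j i) \<longlonglongrightarrow> \<mu> i" if "i \<in> U" for i using \<mu>[OF that] by (simp add: X_def)
  define \<sigma> where "\<sigma> = sum \<mu> U"
  have es\<mu>: "es \<mu> U 0 = 1" "es \<mu> U 1 = \<sigma>" "es \<mu> U (- 1) = 0" by (simp_all add: \<sigma>_def es_1)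
  have es\<mu>i: "es \<mu> (U - {i}) 0 = 1" "es \<mu> (U - {i}) 1 = \<sigma> - \<mu> i" "es \<mu> (U - {i}) (- 1) = 0" "es \<mu> (U - {i}) (- 2) = 0"
    if "i \<in> U" for i using that by (simp_all add: \<sigma>_def es_1 sum_diff1)
  have R': "(\<lambda>j. es (X j) S' (int k - 2 + s) / es (X j) S' (int k - 2)) \<longlonglongrightarrow> es \<mu> U s" for s
  proof -
    have "(\<lambda>j. es (X j) (T' \<union> U) (int (card T') + s) / es (X j) (T' \<union> U) (int (card T'))) \<longlonglongrightarrow> es \<mu> U s"
      by (rule es_ratio_tendsto[OF finite_atLeastAtMost finite_atLeastAtMost T'U(2) subset_refl])
        (rule XT', assumption, rule XU, assumption)
    then show ?thesis unfolding T'U(1)[symmetric] cards(4) .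
  qed
  have Ri': "(\<lambda>j. es (X j) (S' - {i}) (int k - 2 + s) / es (X j) S' (int k - 2)) \<longlonglongrightarrow> es \<mu> (U - {i}) s"
    if i: "i \<in> U" for i s
  proof -
    have "T' \<union> (U - {i}) = S' - {i}" using T'U i by auto
    moreover have "(\<lambda>j. es (X j) (T' \<union> (U - {i})) (int (card T') + s) / es (X j) (T' \<union> U) (int (card T'))) \<longlonglongrightarrow> es \<mu> (U - {i}) s"
      by (rule es_ratio_tendsto[OF finite_atLeastAtMost finite_atLeastAtMost T'U(2) Diff_subset])
        (rule XT', assumption, rule XU, assumption)
    ultimately show ?thesis unfolding T'U(1)[symmetric] cards(4) by (simp only:)
  qed
  have R: "(\<lambda>j. es (X j) S (int k - 1 + s) / es (X j) S (int k - 1)) \<longlonglongrightarrow> es \<mu> U s" for s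
  proof -
    have "(\<lambda>j. es (X j) (T \<union> U) (int (card T) + s) / es (X j) (T \<union> U) (int (card T))) \<longlonglongrightarrow> es \<mu> U s"
      by (rule es_ratio_tendsto[OF finite_atLeastAtMost finite_atLeastAtMost TU(2) subset_refl])
        (rule XT, assumption, rule XU, assumption)
    then show ?thesis unfolding TU(1)[symmetric] cards(2) .
  qed
  have Ri: "(\<lambda>j. es (X j) (S - {i}) (int k - 1 + s) / es (X j) S (int k - 1)) \<longlonglongrightarrow> es \<mu> (U - {i}) s"
    if i: "i \<in> U" for i s
  proof -
    have "T \<union> (U - {i}) = S - {i}" using TU i by auto
    moreover have "(\<lambda>j. es (X j) (T \<union> (U - {i})) (int (card T) + s) / es (X j) (T \<union> U) (int (card T))) \<longlonglongrightarrow> es \<mu> (U - {i}) s"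
      by (rule es_ratio_tendsto[OF finite_atLeastAtMost finite_atLeastAtMost TU(2) Diff_subset])
        (rule XT, assumption, rule XU, assumption)
    ultimately show ?thesis unfolding TU(1)[symmetric] cards(2) by (simp only:)
  qed
  have ks: "int k - 2 + 1 = int k - 1" "int k - 2 + 2 = int k" "int k - 2 + - 1 = int k - 3" "int k - 2 + - 2 = int k - 4" "int k - 2 + 0 = int k - 2"
    "int k - 1 + 1 = int k" "int k - 1 + - 1 = int k - 2" "int k - 1 + - 2 = int k - 3" "int k - 1 + 0 = int k - 1"
    "int k - 1 - 1 = int k - 2" "int k - 2 - 1 = int k - 3" "int k - 3 - 1 = int k - 4" by simp_all
  have E: "es (X j) S' (int k - 2) \<noteq> 0" "es (X j) S (int k - 1) \<noteq> 0" for j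
    using eS'_pos[OF adm[of j]] eS_pos[OF adm[of j]] by auto
  have la: "(\<lambda>j. a (X j)) \<longlonglongrightarrow> \<sigma>" using R'[of 1] by (simp only: ks a_def q_def es\<mu>)
  have lw: "(\<lambda>j. w (X j)) \<longlonglongrightarrow> \<sigma>\<^sup>2 - es \<mu> U 2"
    unfolding w_def by (intro tendsto_intros la R'[of 2, unfolded ks])
  have lg: "(\<lambda>j. g (X j)) \<longlonglongrightarrow> 0" using R'[of "- 1"] by (simp only: ks g_def es\<mu>)
  have lv: "(\<lambda>j. v (X j)) \<longlonglongrightarrow> 1"
    unfolding v_def using tendsto_diff[OF tendsto_const tendsto_mult[OF lg la], of 1] by simp
  have laD: "(\<lambda>j. aD (X j) i) \<longlonglongrightarrow> 1" if i: "i \<in> U" for i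
  proof -
    have "(\<lambda>j. es (X j) (S' - {i}) (int k - 2) / es (X j) S' (int k - 2)
        - es (X j) S' (int k - 1) / es (X j) S' (int k - 2) * (es (X j) (S' - {i}) (int k - 3) / es (X j) S' (int k - 2)))
        \<longlonglongrightarrow> 1 - \<sigma> * 0"
      using tendsto_diff[OF Ri'[OF i, of 0] tendsto_mult[OF R'[of 1] Ri'[OF i, of "- 1"]]] by (simp only: ks es\<mu> es\<mu>i[OF i])
    then show ?thesis unfolding aD_def by (simp only: dr_split[OF E(1)] ks) simp
  qed
  have lcD: "(\<lambda>j. cD (X j) i) \<longlonglongrightarrow> \<sigma> - \<mu> i" if i: "i \<in> U" for i
  proof -
    have "(\<lambda>j. es (X j) (S' - {i}) (int k - 1) / es (X j) S' (int k - 2)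
        - es (X j) S' (int k) / es (X j) S' (int k - 2) * (es (X j) (S' - {i}) (int k - 3) / es (X j) S' (int k - 2)))
        \<longlonglongrightarrow> (\<sigma> - \<mu> i) - es \<mu> U 2 * 0"
      using tendsto_diff[OF Ri'[OF i, of 1] tendsto_mult[OF R'[of 2] Ri'[OF i, of "- 1"]]] by (simp only: ks es\<mu>i[OF i])
    then show ?thesis unfolding cD_def by (simp only: dr_split[OF E(1)] ks) simp
  qed
  have lgD: "(\<lambda>j. gD (X j) i) \<longlonglongrightarrow> 0" if i: "i \<in> U" for i
  proof -
    have "(\<lambda>j. es (X j) (S' - {i}) (int k - 4) / es (X j) S' (int k - 2)
        - es (X j) S' (int k - 3) / es (X j) S' (int k - 2) * (es (X j) (S' - {i}) (int k - 3) / es (X j) S' (int k - 2)))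
        \<longlonglongrightarrow> 0 - 0 * 0"
      using tendsto_diff[OF Ri'[OF i, of "- 2"] tendsto_mult[OF R'[of "- 1"] Ri'[OF i, of "- 1"]]] by (simp only: ks es\<mu> es\<mu>i[OF i])
    then show ?thesis unfolding gD_def by (simp only: dr_split[OF E(1)] ks) simp
  qed
  have lqD: "(\<lambda>j. qD (X j) i) \<longlonglongrightarrow> 1" if i: "i \<in> U" for i
  proof -
    have iS: "i \<in> S" using i k2 by auto
    have "(\<lambda>j. es (X j) (S - {i}) (int k - 1) / es (X j) S (int k - 1)
        - es (X j) S (int k) / es (X j) S (int k - 1) * (es (X j) (S - {i}) (int k - 2) / es (X j) S (int k - 1)))
        \<longlonglongrightarrow> 1 - \<sigma> * 0"
      using tendsto_diff[OF Ri[OF i, of 0] tendsto_mult[OF R[of 1] Ri[OF i, of "- 1"]]] by (simp only: ks es\<mu> es\<mu>i[OF i])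
    then show ?thesis unfolding qD_def by (simp only: dq_eq_dr[OF finite_atLeastAtMost iS] dr_split[OF E(2)] ks) simp
  qed
  have lnD: "(\<lambda>j. nD (X j) i) \<longlonglongrightarrow> 0" if i: "i \<in> U" for i
  proof -
    have "(\<lambda>j. - (es (X j) (S - {i}) (int k - 3) / es (X j) S (int k - 1)
        - es (X j) S (int k - 2) / es (X j) S (int k - 1) * (es (X j) (S - {i}) (int k - 2) / es (X j) S (int k - 1))))
        \<longlonglongrightarrow> - (0 - 0 * 0)"
      using tendsto_minus[OF tendsto_diff[OF Ri[OF i, of "- 2"] tendsto_mult[OF R[of "- 1"] Ri[OF i, of "- 1"]]]] by (simp only: ks es\<mu> es\<mu>i[OF i])
    then show ?thesis unfolding nD_def by (simp only: dr_split[OF E(2)] ks) simp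
  qed
  have lG: "(\<lambda>j. G e (X j) i) \<longlonglongrightarrow> 1" if i: "i \<in> U" for i
    unfolding G_def using tendsto_add[OF lqD[OF i] tendsto_mult[OF tendsto_const[of e] lnD[OF i]]] by simp
  have lW: "(\<lambda>j. W (e * \<kappa> j) (X j)) \<longlonglongrightarrow> \<sigma>\<^sup>2 - es \<mu> U 2 + e"
    unfolding W_def using tendsto_add[OF lw tendsto_mult[OF tendsto_mult[OF tendsto_const[of e] k1] lv]] by simp
  have lm: "(\<lambda>j. inverse (m (X j))) \<longlonglongrightarrow> 0"
  proof (rule tendsto_inverse_0_at_top, rule filterlim_at_top_mono[OF XT[OF oneT]], rule always_eventually, rule allI)
    fix j show "X j 1 \<le> m (X j)" using a_bounds(1)[OF adm[of j]] by (simp add: m_def)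
  qed
  have lZ: "(\<lambda>j. Z (e * \<kappa> j) (X j) i) \<longlonglongrightarrow> \<sigma> + \<mu> i" if i: "i \<in> U" for i
  proof -
    have "(\<lambda>j. 2 * a (X j) * aD (X j) i - cD (X j) i + e * \<kappa> j * (- (gD (X j) i * a (X j) + g (X j) * aD (X j) i))
        - 2 * W (e * \<kappa> j) (X j) * aD (X j) i * inverse (m (X j)))
        \<longlonglongrightarrow> 2 * \<sigma> * 1 - (\<sigma> - \<mu> i) + e * 1 * (- (0 * \<sigma> + 0 * 1)) - 2 * (\<sigma>\<^sup>2 - es \<mu> U 2 + e) * 1 * 0"
      by (intro tendsto_intros la laD lcD lgD lg lW lm k1 i)
    then show ?thesis unfolding Z_def wD_def vD_def by (simp add: divide_inverse)
  qed
  \<comment> \<open>For e = 1 the normalization turns q_k into sigma_{k-2} / sigma_{k-1}, whose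
    limit is sigma_{-1}(\<mu>) = 0.\<close>
  have \<sigma>e: "e = 0 \<and> \<sigma> = 1 \<or> e = 1 \<and> \<sigma> = 0"
  proof -
    have lq: "(\<lambda>j. q (X j) S (int k)) \<longlonglongrightarrow> \<sigma>" using R[of 1] by (simp only: ks q_def es\<mu>)
    show ?thesis
    proof (cases "e = 0")
      case True
      then have "q (X j) S (int k) = 1" for j using nrm[of j] by (simp add: normal_def)
      then show ?thesis using lq LIMSEQ_unique[OF tendsto_const] True by auto
    next
      case False
      then have e: "e = 1" using e01 by simp
      have "q (X j) S (int k) = es (X j) S (int k - 2) / es (X j) S (int k - 1)" for j
      proof -
        have "q (X j) S (int k) * q (X j) S (int k - 1) = 1" using nrm[of j] e by (simp add: normal_def)
        moreover have "q (X j) S (int k - 1) = es (X j) S (int k - 1) / es (X j) S (int k - 2)" by (simp only: q_def ks)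
        ultimately show ?thesis using eS_pos[OF adm[of j]] by (simp add: field_simps)
      qed
      then have "(\<lambda>j. q (X j) S (int k)) \<longlonglongrightarrow> 0" using R[of "- 1"] by (simp only: ks es\<mu>)
      then show ?thesis using lq LIMSEQ_unique e by blast
    qed
  qed
  obtain B where B1: "B \<ge> 1" and B: "\<And>x e \<kappa>. normal e x \<Longrightarrow> x 1 \<ge> 1 \<Longrightarrow> 0 \<le> \<kappa> \<Longrightarrow> \<kappa> \<le> 1 \<Longrightarrow>
    (\<forall>i\<in>S'. \<bar>Z (e * \<kappa>) x i\<bar> * (1 + (x i)\<^sup>2) \<le> B) \<and> (\<forall>i\<in>S. \<bar>qD x i\<bar> * (1 + (x i)\<^sup>2) \<le> B) \<and> a x \<le> B \<and> W (e * \<kappa>) x \<le> B"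
    using unif_bounds_Z by blast
  have X1: "X j 1 \<ge> 1" for j
  proof -
    have "X j (k - 1) \<le> X j 1" using k2 kn by (intro sorted[OF adm]) auto
    then show ?thesis using Xk[of j] by simp
  qed
  define Y where "Y j i = (Z (e * \<kappa> j) (X j) i - (1 - e) * a (X j) * qD (X j) i)\<^sup>2 / G e (X j) i" for j i
  have YU: "(\<lambda>j. Y j i) \<longlonglongrightarrow> (\<mu> i)\<^sup>2" if i: "i \<in> U" for i
  proof -
    have "(\<lambda>j. Y j i) \<longlonglongrightarrow> (\<sigma> + \<mu> i - (1 - e) * \<sigma> * 1)\<^sup>2 / 1"
      unfolding Y_def by (intro tendsto_intros lZ la lqD lG i) simp
    moreover have eq: "\<sigma> + \<mu> i - (1 - e) * \<sigma> * 1 = \<mu> i" using \<sigma>e by auto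
    ultimately show ?thesis by (simp only: eq div_by_1)
  qed
  \<comment> \<open>\<open>Z\<close> and \<open>qD\<close> are of order x_i^{-2} and
    \<open>G\<close> is at least of that order, so the squared quotient still decays; a multiple of
    1 / x_i is enough as a majorant.\<close>
  have YT: "(\<lambda>j. Y j i) \<longlonglongrightarrow> 0" if i: "i \<in> T'" for i
  proof -
    have iS: "i \<in> S'" "i \<in> S" "i \<in> T" using i kn by auto
    have bound: "Y j i \<le> (B + B * B)\<^sup>2 * (4 * real k) * inverse (X j i)" "0 \<le> Y j i" for j
    proof -
      let ?t = "1 + (X j i)\<^sup>2"
      have t: "?t > 0" by (simp add: add_pos_nonneg)
      have xi: "X j i \<ge> 1"
      proof -
        have "X j (k - 1) \<le> X j i" using iS k2 kn by (intro sorted[OF adm]) auto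
        then show ?thesis using Xk[of j] by simp
      qed
      note Gl = G_lower[OF nrm[of j] iS(2)]
      note b = B[OF nrm[of j] X1[of j] \<kappa>b[of j]]
      have ap: "0 < a (X j)" "a (X j) \<le> B" using a_bounds(1)[OF adm[of j]] b by auto
      let ?z = "Z (e * \<kappa> j) (X j) i - (1 - e) * a (X j) * qD (X j) i"
      have "\<bar>(1 - e) * a (X j) * qD (X j) i\<bar> * ?t \<le> B * B"
      proof -
        have "\<bar>(1 - e) * a (X j) * qD (X j) i\<bar> * ?t = \<bar>1 - e\<bar> * (a (X j) * (\<bar>qD (X j) i\<bar> * ?t))" using ap by (simp add: abs_mult)
        also have "\<dots> \<le> 1 * (B * B)"
          using e01 ap b iS B1 by (intro mult_mono) auto
        finally show ?thesis by simp
      qed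
      moreover have "\<bar>Z (e * \<kappa> j) (X j) i\<bar> * ?t \<le> B" using b iS by blast
      moreover have "\<bar>?z\<bar> * ?t \<le> (\<bar>Z (e * \<kappa> j) (X j) i\<bar> + \<bar>(1 - e) * a (X j) * qD (X j) i\<bar>) * ?t"
        using t by (intro mult_right_mono abs_triangle_ineq4) auto
      ultimately have "\<bar>?z\<bar> * ?t \<le> B + B * B" unfolding distrib_right by linarith
      then have "(\<bar>?z\<bar> * ?t)\<^sup>2 \<le> (B + B * B)\<^sup>2" using t by (intro power_mono) auto
      then have z: "?z\<^sup>2 * ?t\<^sup>2 \<le> (B + B * B)\<^sup>2" by (simp only: power_mult_distrib power2_abs)
      have "Y j i * 1 \<le> Y j i * (G e (X j) i * (4 * real k * ?t))"
        using Gl unfolding Y_def by (intro mult_left_mono divide_nonneg_pos) auto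
      also have "\<dots> = 4 * real k * (?z\<^sup>2 * ?t\<^sup>2) * inverse ?t"
        unfolding Y_def using Gl(2) t by (simp add: field_simps power2_eq_square)
      also have "\<dots> \<le> 4 * real k * (B + B * B)\<^sup>2 * inverse ?t" using z t by (intro mult_right_mono mult_left_mono) auto
      also have "\<dots> \<le> 4 * real k * (B + B * B)\<^sup>2 * inverse (X j i)"
      proof -
        have "X j i \<le> ?t" using xi self_le_power[of "X j i" 2] by simp
        then show ?thesis using xi by (intro mult_left_mono le_imp_inverse_le) auto
      qed
      finally show "Y j i \<le> (B + B * B)\<^sup>2 * (4 * real k) * inverse (X j i)" by (simp add: mult_ac)
      show "0 \<le> Y j i" unfolding Y_def using Gl(2) by (intro divide_nonneg_pos) auto
    qed
    have "(\<lambda>j. (B + B * B)\<^sup>2 * (4 * real k) * inverse (X j i)) \<longlonglongrightarrow> (B + B * B)\<^sup>2 * (4 * real k) * 0"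
      by (intro tendsto_intros tendsto_inverse_0_at_top XT iS)
    then have u: "(\<lambda>j. (B + B * B)\<^sup>2 * (4 * real k) * inverse (X j i)) \<longlonglongrightarrow> 0" by simp
    show ?thesis by (rule tendsto_sandwich[OF _ _ tendsto_const u]) (intro always_eventually allI bound)+
  qed
  have "(\<lambda>j. \<Sum>i\<in>T'. Y j i) \<longlonglongrightarrow> (\<Sum>i\<in>T'. 0)" by (intro tendsto_sum YT)
  moreover have "(\<lambda>j. \<Sum>i\<in>U. Y j i) \<longlonglongrightarrow> (\<Sum>i\<in>U. (\<mu> i)\<^sup>2)" by (intro tendsto_sum YU)
  ultimately have "(\<lambda>j. (\<Sum>i\<in>T'. Y j i) + (\<Sum>i\<in>U. Y j i)) \<longlonglongrightarrow> (\<Sum>i\<in>T'. 0) + (\<Sum>i\<in>U. (\<mu> i)\<^sup>2)" by (rule tendsto_add)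
  moreover have "H (X j) (\<kappa> j) = (\<Sum>i\<in>T'. Y j i) + (\<Sum>i\<in>U. Y j i)" for j
    unfolding H_def Y_def T'U(1) by (rule sum.union_disjoint) (use T'U in auto)
  ultimately have lH: "(\<lambda>j. H (X j) (\<kappa> j)) \<longlonglongrightarrow> (\<Sum>i\<in>U. (\<mu> i)\<^sup>2)" by simp
  have "(\<lambda>j. (1 - 1 / (real (r j) + 2))\<^sup>2 * (2 * W (e * \<kappa> j) (X j))) \<longlonglongrightarrow> 1\<^sup>2 * (2 * (\<sigma>\<^sup>2 - es \<mu> U 2 + e))"
    by (intro tendsto_mult tendsto_power lim1 tendsto_const lW)
  moreover have "(1 - 1 / (real (r j) + 2))\<^sup>2 * (2 * W (e * \<kappa> j) (X j)) \<le> H (X j) (\<kappa> j)" for j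
    using X0(5)[of "r j"] by (simp add: X_def \<kappa>_def)
  \<comment> \<open>By \<open>es_2\<close> the limit 2 (\<sigma>^2 - sigma_2(\<mu>) + e) equals
    \<sigma>^2 + |\<mu>|^2 + 2 e, so failure in the limit would mean \<sigma>^2 + 2 e \<le> 0,
    although \<sigma> = 1 or e = 1.\<close>
  ultimately have "1\<^sup>2 * (2 * (\<sigma>\<^sup>2 - es \<mu> U 2 + e)) \<le> (\<Sum>i\<in>U. (\<mu> i)\<^sup>2)"
    using LIMSEQ_le[OF _ lH] by blast
  moreover have "2 * es \<mu> U 2 = \<sigma>\<^sup>2 - (\<Sum>i\<in>U. (\<mu> i)\<^sup>2)" unfolding \<sigma>_def by (rule es_2) simp
  ultimately have "\<sigma>\<^sup>2 + 2 * e \<le> 0" by (simp add: algebra_simps)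
  then show False using \<sigma>e by auto
qed

end

section \<open>Bounded intermediate entries\<close>

lemma cone_delete_set:
  fixes x :: "nat \<Rightarrow> real"
  assumes "finite J" "finite S" "J \<subseteq> S" "cone x S k"
  shows "cone x (S - J) (k - int (card J))"
  using assms
proof (induction J rule: finite_induct)
  case (insert j F)
  have eq: "S - insert j F = S - F - {j}" "k - int (card (insert j F)) = k - int (card F) - 1"
    using insert(1,2) by auto
  have "cone x (S - F) (k - int (card F))" using insert by blast
  moreover have "finite (S - F)" "j \<in> S - F" using insert by blast+
  ultimately show ?case unfolding eq by (intro cone_delete)
qed simp

lemma dq_euler:
  fixes x :: "nat \<Rightarrow> real"
  assumes S: "finite S" and ne: "es x S (k - 1) \<noteq> 0"
  shows "(\<Sum>i\<in>S. x i * dq x S k i) = q x S k"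
proof -
  have kk: "k - 1 - 1 = k - 2" by simp
  let ?e = "es x S (k - 1)" and ?f = "es x S k"
  have "(\<Sum>i\<in>S. x i * dq x S k i) = (\<Sum>i\<in>S. (?e * (x i * es x (S - {i}) (k - 1)) - ?f * (x i * es x (S - {i}) (k - 2))) / ?e\<^sup>2)"
    by (intro sum.cong refl) (simp add: dq_alt[OF S] algebra_simps)
  also have "\<dots> = (?e * (of_int k * ?f) - ?f * (of_int (k - 1) * ?e)) / ?e\<^sup>2"
    using es_euler[OF S, of k x] es_euler[OF S, of "k - 1" x]
    by (simp only: kk sum_subtractf sum_distrib_left[symmetric] sum_divide_distrib[symmetric])
  also have "\<dots> = q x S k" using ne unfolding q_def by (simp add: field_simps power2_eq_square)
  finally show ?thesis .
qed

lemma neg_quotient_le: "p \<le> r * y \<Longrightarrow> 2 * y = - E / s \<Longrightarrow> r * (E / s) \<le> 2 * (- p)" for p r y E s :: real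
proof -
  assume "p \<le> r * y" "2 * y = - E / s"
  then have "E / s = - (2 * y)" by simp
  then show "r * (E / s) \<le> 2 * (- p)" using \<open>p \<le> r * y\<close> by simp
qed

lemma quotient_square_scale: "t \<noteq> 0 \<Longrightarrow> (u / t)\<^sup>2 * (b * (c * t)) = c * (b * u\<^sup>2) / t" for t u b c :: real
  by (simp add: field_simps power2_eq_square)

lemma sum_squares_le: "(p + r)\<^sup>2 \<le> 2 * p\<^sup>2 + 2 * r\<^sup>2" for p r :: real
  using zero_le_power2[of "p - r"] by (simp add: power2_eq_square algebra_simps)

lemma sum_sq_le_card:
  fixes f :: "'i \<Rightarrow> real"
  assumes "finite A" "card A \<le> n"
  shows "(\<Sum>i\<in>A. \<bar>f i\<bar>)\<^sup>2 \<le> real n * (\<Sum>i\<in>A. (f i)\<^sup>2)"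
proof -
  have "(\<Sum>i\<in>A. \<bar>f i\<bar>)\<^sup>2 \<le> (\<Sum>i\<in>A. \<bar>f i\<bar>\<^sup>2) * card A"
    using Cauchy_Schwarz_ineq_sum[of "\<lambda>i. \<bar>f i\<bar>" "\<lambda>_. 1" A] by simp
  also have "\<dots> \<le> (\<Sum>i\<in>A. \<bar>f i\<bar>\<^sup>2) * n" using assms(2) by (intro mult_left_mono sum_nonneg) auto
  finally show ?thesis by (simp add: mult.commute)
qed

context quot
begin

text \<open>Deleting the k - 2 indices \<open>T - {i}\<close> leaves i together with
  \<open>U\<close>, where \<open>Q_two_nth_2\<close> measures the distance of z from the radial
  direction. Different i produce different radial factors; the index k belongs to all these sets and
  its entry is at least c, so each factor can be compared with z k / x k.\<close>

lemma strict_concave: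
  assumes c0: "c > 0" and M: "M \<ge> 1" and k3: "k \<ge> 3"
  shows "\<exists>C\<ge>0. \<forall>x z. adm n k K x \<longrightarrow> x k \<ge> c \<longrightarrow> x (k - 1) \<le> M \<longrightarrow>
    (\<Sum>i\<in>{i\<in>S. x i \<le> M}. (z i - x i * (z k / x k))\<^sup>2) \<le> C * (- (Q x z S (int k) $ 2))"
proof -
  have M0: "M \<ge> 0" using M by simp
  obtain r where r: "r > 0" and chain: "\<And>(x :: nat \<Rightarrow> real) z A J. \<lbrakk>finite A; card A \<le> n; J \<subseteq> A; card J = k - 2;
    cone x A (int (k - 2) + 1); \<forall>i\<in>J. x i \<ge> c; \<forall>i\<in>A - J. x i \<le> M\<rbrakk> \<Longrightarrow>
    Q x z A (int (k - 2) + 2) $ 2 \<le> r * Q x z (A - J) 2 $ 2"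
    using Q_concave_chain[OF c0 M0, of n "k - 2"] by blast
  define D where "D = 2 * real n * M / r"
  define C1 where "C1 = 2 * D + 2 * (K + M)\<^sup>2 * (D / c\<^sup>2)"
  have D: "D \<ge> 0" unfolding D_def using r M by simp
  have C1: "C1 \<ge> 0" unfolding C1_def using D by simp
  have main: "(\<Sum>i\<in>{i\<in>S. x i \<le> M}. (z i - x i * (z k / x k))\<^sup>2) \<le> real n * C1 * (- (Q x z S (int k) $ 2))"
    if adm: "adm n k K x" and xk: "x k \<ge> c" and xk1: "x (k - 1) \<le> M" for x z
  proof -
    let ?P = "- (Q x z S (int k) $ 2)"
    have P0: "?P \<ge> 0"
      using Q_concave[of S x "int k" z] cone_mono[OF coneS[OF adm], of "int k - 1"] k2 by simp
    have part: "(\<Sum>j\<in>insert i U. (z j - x j * \<rho>)\<^sup>2) \<le> D * ?P"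
      if i: "i \<in> T" "x i \<le> M" and \<rho>: "\<rho> = sum z (insert i U) / sum x (insert i U)" for i \<rho>
    proof -
      let ?J = "T - {i}"
      have J: "?J \<subseteq> S" "card ?J = k - 2" "S - ?J = insert i U" "finite ?J" using i kn k2 by auto
      have kk: "int (k - 2) + 1 = int k - 1" "int (k - 2) + 2 = int k" using k2 by auto
      have UM: "x j \<le> M" if "j \<in> insert i U" for j
      proof (cases "j = i")
        case False
        then have "x j \<le> x (k - 1)" using that i k2 by (intro sorted[OF adm]) auto
        then show ?thesis using xk1 by linarith
      qed (use i in simp)
      have "Q x z S (int k) $ 2 \<le> r * Q x z (insert i U) 2 $ 2"
      proof -
        have "\<forall>j\<in>?J. x j \<ge> c"
        proof
          fix j assume "j \<in> ?J"
          then have "x k \<le> x j" using kn by (intro sorted[OF adm]) auto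
          then show "x j \<ge> c" using xk by linarith
        qed
        moreover have "\<forall>j\<in>S - ?J. x j \<le> M" unfolding J(3) using UM by blast
        moreover have "cone x S (int k - 1)" by (rule cone_mono[OF coneS[OF adm]]) simp
        ultimately show ?thesis using chain[of S ?J x z] J unfolding kk J(3) by simp
      qed
      moreover have c1: "cone x (insert i U) 1"
      proof -
        have "int k - int (card ?J) = 2" using J k2 by simp
        then have "cone x (insert i U) 2" using cone_delete_set[OF J(4) _ J(1) coneS[OF adm]] unfolding J(3) by simp
        then show ?thesis by (rule cone_mono) simp
      qed
      moreover have "2 * Q x z (insert i U) 2 $ 2 = - (\<Sum>j\<in>insert i U. (z j - x j * \<rho>)\<^sup>2) / sum x (insert i U)"
        unfolding \<rho> by (rule Q_two_nth_2[OF _ c1]) simp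
      ultimately have le: "r * ((\<Sum>j\<in>insert i U. (z j - x j * \<rho>)\<^sup>2) / sum x (insert i U)) \<le> 2 * ?P"
        by (intro neg_quotient_le)
      have s0: "sum x (insert i U) > 0" using coneD[OF c1, of 1] by (simp add: es_1)
      have "sum x (insert i U) \<le> (\<Sum>j\<in>insert i U. M)" by (rule sum_mono) (rule UM)
      also have "\<dots> = real (card (insert i U)) * M" by simp
      also have "card (insert i U) \<le> card S" using i kn k2 by (intro card_mono) auto
      then have "real (card (insert i U)) * M \<le> real n * M" using M by (intro mult_right_mono) auto
      finally have s1: "sum x (insert i U) \<le> real n * M" .
      have "r * (\<Sum>j\<in>insert i U. (z j - x j * \<rho>)\<^sup>2) \<le> 2 * ?P * sum x (insert i U)"
        using le s0 by (simp add: field_simps)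
      also have "\<dots> \<le> 2 * ?P * (real n * M)" using s1 P0 by (intro mult_left_mono) auto
      finally show ?thesis using r by (simp add: D_def field_simps)
    qed
    have each: "(z j - x j * (z k / x k))\<^sup>2 \<le> C1 * ?P" if j: "j \<in> {i\<in>S. x i \<le> M}" for j
    proof -
      \<comment> \<open>An index of \<open>U\<close> lies in the remaining set for every choice of
        i; k - 1 is taken because its entry is known to be at most M.\<close>
      define i where "i = (if j \<in> T then j else k - 1)"
      have i: "i \<in> T" "x i \<le> M" "j \<in> insert i U" using j xk1 k2 by (auto simp: i_def)
      define \<rho> where "\<rho> = sum z (insert i U) / sum x (insert i U)"
      note pt = part[OF i(1,2) \<rho>_def]
      have le: "(z l - x l * \<rho>)\<^sup>2 \<le> D * ?P" if "l \<in> insert i U" for l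
        using member_le_sum[of l "insert i U" "\<lambda>j. (z j - x j * \<rho>)\<^sup>2"] that pt by force
      have xk0: "x k > 0" using xk c0 by linarith
      have "\<rho> - z k / x k = - ((z k - x k * \<rho>) / x k)" using xk0 by (simp add: field_simps)
      then have "(\<rho> - z k / x k)\<^sup>2 = (z k - x k * \<rho>)\<^sup>2 / (x k)\<^sup>2" by (simp add: power_divide)
      also have "\<dots> \<le> D * ?P / c\<^sup>2"
        using le[of k] kn xk c0 D P0 by (intro frac_le power_mono mult_nonneg_nonneg) auto
      finally have rr: "(\<rho> - z k / x k)\<^sup>2 \<le> D / c\<^sup>2 * ?P" by simp
      have "- K \<le> x j" using ge_K[OF adm, of j] j by auto
      then have "\<bar>x j\<bar> \<le> K + M" using j K0 M by auto
      then have xj: "(x j)\<^sup>2 \<le> (K + M)\<^sup>2" by (metis abs_ge_zero power2_abs power_mono)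
      have "(z j - x j * (z k / x k))\<^sup>2 = ((z j - x j * \<rho>) + x j * (\<rho> - z k / x k))\<^sup>2" by (simp add: algebra_simps)
      also have "\<dots> \<le> 2 * (z j - x j * \<rho>)\<^sup>2 + 2 * (x j * (\<rho> - z k / x k))\<^sup>2"
        by (rule sum_squares_le)
      also have "(x j * (\<rho> - z k / x k))\<^sup>2 \<le> (K + M)\<^sup>2 * (D / c\<^sup>2 * ?P)"
        unfolding power_mult_distrib by (intro mult_mono xj rr) auto
      finally show ?thesis using le[OF i(3)] by (simp add: C1_def algebra_simps)
    qed
    have "(\<Sum>i\<in>{i\<in>S. x i \<le> M}. (z i - x i * (z k / x k))\<^sup>2) \<le> (\<Sum>i\<in>{i\<in>S. x i \<le> M}. C1 * ?P)"
      by (rule sum_mono[OF each])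
    also have "\<dots> = real (card {i\<in>S. x i \<le> M}) * (C1 * ?P)" by simp
    also have "\<dots> \<le> real n * (C1 * ?P)"
    proof (rule mult_right_mono)
      have "{i\<in>S. x i \<le> M} \<subseteq> S" by blast
      then have "card {i\<in>S. x i \<le> M} \<le> card S" by (rule card_mono[rotated]) simp
      then show "real (card {i\<in>S. x i \<le> M}) \<le> real n" by simp
      show "0 \<le> C1 * ?P" by (rule mult_nonneg_nonneg[OF C1 P0])
    qed
    finally show ?thesis by (simp only: mult.assoc)
  qed
  have "real n * C1 \<ge> 0" using C1 by simp
  then show ?thesis using main by blast
qed

lemma x_k_lower: "adm n k K x \<Longrightarrow> x k \<ge> q x S (int k) / n"
proof -
  assume adm: "adm n k K x"
  have "q x S (int (k - 1) + 1) \<le> real (card S) * max (x k) 0"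
  proof (rule q_upper[of _ _ _ T])
    show "cone x S (int (k - 1))" using k2 by (intro cone_mono[OF coneS[OF adm]]) simp
    fix j assume "j \<in> S - T"
    then have "x j \<le> x k" using k2 by (intro sorted[OF adm]) auto
    then show "x j \<le> max (x k) 0" by simp
  qed (use kn in auto)
  moreover have "int (k - 1) + 1 = int k" using k2 by simp
  ultimately have le: "q x S (int k) \<le> n * max (x k) 0" by simp
  have p: "q x S (int k) > 0" by (rule q_bounds[OF adm])
  have "x k > 0" using le p by (cases "x k > 0") auto
  then show ?thesis using le kn k2 by (simp add: field_simps)
qed

text \<open>Write z_i = dd_i + x_i \<rho> on the bounded entries. The transversal parts dd_i are
  controlled by strict concavity, the large entries by \<open>G\<close>. The radial factor \<rho> is
  recovered from the first derivative of q_k, because Euler's identity makes its coefficient at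
  least c / 2. Concavity and first derivative come with the factor m, which exceeds any constant
  once x 1 is large.\<close>

lemma caseII:
  assumes M: "M \<ge> 1" and c: "c > 0" and C: "C > 0" and d: "d > 0"
  shows "\<exists>K\<^sub>0\<ge>1. \<forall>x e \<kappa> z. normal e x \<longrightarrow> x (k - 1) \<le> M \<longrightarrow> x 1 \<ge> K\<^sub>0 \<longrightarrow> 0 \<le> \<kappa> \<longrightarrow> \<kappa> \<le> 1 \<longrightarrow> q x S (int k) \<ge> c \<longrightarrow>
    C * (\<Sum>i\<in>S'. Z (e * \<kappa>) x i * z i)\<^sup>2 \<le> (\<Sum>i\<in>S'. G e x i * (z i)\<^sup>2)
      + m x / 8 * (- (Q x z S (int k) $ 2) + (Q x z S (int k) $ 1)\<^sup>2) + d * (z 1 / m x)\<^sup>2"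
proof (cases "k \<ge> 3")
  case False
  \<comment> \<open>For k = 2 the entry x (k - 1) is x 1 itself, so with threshold M + 1 the
    hypotheses contradict each other.\<close>
  then have "k - 1 = 1" using k2 by simp
  moreover have "M + 1 \<ge> 1" using M by simp
  ultimately show ?thesis by (intro exI[of _ "M + 1"]) auto
next
  case k3: True
  obtain B where B1: "B \<ge> 1" and B: "\<And>x e \<kappa>. normal e x \<Longrightarrow> x 1 \<ge> 1 \<Longrightarrow> 0 \<le> \<kappa> \<Longrightarrow> \<kappa> \<le> 1 \<Longrightarrow>
    (\<forall>i\<in>S'. \<bar>Z (e * \<kappa>) x i\<bar> * (1 + (x i)\<^sup>2) \<le> B) \<and> (\<forall>i\<in>S. \<bar>qD x i\<bar> * (1 + (x i)\<^sup>2) \<le> B) \<and> a x \<le> B \<and> W (e * \<kappa>) x \<le> B"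
    using unif_bounds_Z by blast
  have n1: "real n \<ge> 1" using kn k2 by simp
  define D where "D = B * (1 + 2 * n * B / c) + 2 * n * B / c"
  define C6 where "C6 = 3 * n * D\<^sup>2"
  \<comment> \<open>M' \<ge> 2 n B / c leaves the large entries at most c / 2 of Euler's identity,
    and M' \<ge> 4 k C C6 lets \<open>G\<close> absorb their squares.\<close>
  define M' where "M' = M + 2 * n * B / c + C * C6 * (4 * real k)"
  have nBc: "2 * n * B / c \<ge> 0" using c B1 by simp
  have D0: "D \<ge> 0" "2 * n * B / c \<le> D" "B * (1 + 2 * n * B / c) \<le> D" unfolding D_def using nBc B1 by simp_all
  have C60: "C6 \<ge> 0" by (simp add: C6_def)
  have CC0: "C * C6 * (4 * real k) \<ge> 0" using C C60 by simp
  have M': "M' \<ge> 1" "M' \<ge> M" "M' \<ge> 2 * n * B / c" "M' \<ge> C * C6 * (4 * real k)"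
    using M nBc CC0 unfolding M'_def by linarith+
  have cn: "c / n > 0" using c n1 by simp
  obtain C7 where C7: "C7 \<ge> 0" and strict: "\<And>x z. adm n k K x \<Longrightarrow> x k \<ge> c / n \<Longrightarrow> x (k - 1) \<le> M' \<Longrightarrow>
    (\<Sum>i\<in>{i\<in>S. x i \<le> M'}. (z i - x i * (z k / x k))\<^sup>2) \<le> C7 * (- (Q x z S (int k) $ 2))"
    using strict_concave[OF cn M'(1) k3] by blast
  \<comment> \<open>The last two summands pay for the terms absorbed by m / 8 times concavity and
    first derivative, and for the z 1 term absorbed by d (z 1 / m)^2.\<close>
  define K\<^sub>0 where "K\<^sub>0 = 1 + M' + 8 * C * C6 * (1 + C7) + C * C6 * (1 + B)\<^sup>2 / d"
  have t1: "8 * C * C6 * (1 + C7) \<ge> 0" "C * C6 * (1 + B)\<^sup>2 / d \<ge> 0" using C C60 C7 d by simp_all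
  have K0': "K\<^sub>0 \<ge> 1" "K\<^sub>0 > M'" "K\<^sub>0 \<ge> 8 * C * C6 * (1 + C7)" "K\<^sub>0 \<ge> C * C6 * (1 + B)\<^sup>2 / d"
    using t1 M' unfolding K\<^sub>0_def by linarith+
  have main: "C * (\<Sum>i\<in>S'. Z (e * \<kappa>) x i * z i)\<^sup>2 \<le> (\<Sum>i\<in>S'. G e x i * (z i)\<^sup>2)
      + m x / 8 * (- (Q x z S (int k) $ 2) + (Q x z S (int k) $ 1)\<^sup>2) + d * (z 1 / m x)\<^sup>2"
    if nrm: "normal e x" and xM: "x (k - 1) \<le> M" and x1: "x 1 \<ge> K\<^sub>0" and \<kappa>: "0 \<le> \<kappa>" "\<kappa> \<le> 1" and qc: "q x S (int k) \<ge> c" for x e \<kappa> z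
  proof -
    have adm: "adm n k K x" using nrm by (simp add: normal_def)
    have x11: "x 1 \<ge> 1" using x1 K0' by linarith
    note b = B[OF nrm x11 \<kappa>]
    define A where "A = {i\<in>S. x i \<le> M'}"
    define La where "La = S - A"
    have fin: "finite A" "finite La" and SA: "S = A \<union> La" "A \<inter> La = {}"
      by (auto simp: A_def La_def)
    have cA: "card A \<le> n" "card La \<le> n"

    proof -
      have "A \<subseteq> S" "La \<subseteq> S" by (auto simp: A_def La_def)
      then have "card A \<le> card S" "card La \<le> card S" by (simp_all only: card_mono finite_atLeastAtMost)
      then show "card A \<le> n" "card La \<le> n" by simp_all
    qed
    have oneL: "1 \<in> La" and one: "1 \<notin> A" using x1 K0' oneS by (auto simp: A_def La_def)
    have S'A: "S' = A \<union> (La - {1})" "A \<inter> (La - {1}) = {}" using SA one S'_eq oneL by auto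
    have large: "x i > M'" if "i \<in> La" for i using that by (auto simp: A_def La_def)
    define \<rho> where "\<rho> = z k / x k"
    define y where "y i = z i / (1 + (x i)\<^sup>2)" for i
    define dd where "dd i = z i - x i * \<rho>" for i
    let ?Q1 = "Q x z S (int k) $ 1" and ?P = "- (Q x z S (int k) $ 2)"
    have t: "1 + (x i)\<^sup>2 > 0" for i by (simp add: add_pos_nonneg)
    have t1: "1 + (x i)\<^sup>2 \<ge> 1" for i by simp
    have xt: "\<bar>x i\<bar> \<le> 1 + (x i)\<^sup>2" for i
    proof -
      have "0 \<le> (\<bar>x i\<bar> - 1)\<^sup>2" by simp
      then have "2 * \<bar>x i\<bar> \<le> 1 + (x i)\<^sup>2" by (simp add: power2_eq_square algebra_simps abs_mult_self_eq flip: abs_mult)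
      then show ?thesis by linarith
    qed
    have from_t: "\<bar>u * v\<bar> \<le> B * \<bar>v / (1 + (x i)\<^sup>2)\<bar>" if "\<bar>u\<bar> * (1 + (x i)\<^sup>2) \<le> B" for u v i
    proof -
      have "\<bar>u * v\<bar> = (\<bar>u\<bar> * (1 + (x i)\<^sup>2)) * \<bar>v / (1 + (x i)\<^sup>2)\<bar>" using t[of i] by (simp add: abs_mult abs_divide)
      also have "\<dots> \<le> B * \<bar>v / (1 + (x i)\<^sup>2)\<bar>" using that by (rule mult_right_mono) simp
      finally show ?thesis .
    qed
    have from_1: "\<bar>u * v\<bar> \<le> B * \<bar>v\<bar>" if "\<bar>u\<bar> * (1 + (x i)\<^sup>2) \<le> B" for u v i
    proof -
      have "\<bar>u\<bar> * 1 \<le> \<bar>u\<bar> * (1 + (x i)\<^sup>2)" by (rule mult_left_mono) auto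
      then show ?thesis unfolding abs_mult using that by (intro mult_right_mono) auto
    qed
    have from_x: "\<bar>u * x i\<bar> \<le> B" if "\<bar>u\<bar> * (1 + (x i)\<^sup>2) \<le> B" for u i
    proof -
      have "\<bar>u * x i\<bar> \<le> \<bar>u\<bar> * (1 + (x i)\<^sup>2)" unfolding abs_mult using xt[of i] by (rule mult_left_mono) simp
      then show ?thesis using that by linarith
    qed
    have qb: "\<bar>qD x i\<bar> * (1 + (x i)\<^sup>2) \<le> B" if "i \<in> S" for i using b that by blast
    have zb: "\<bar>Z (e * \<kappa>) x i\<bar> * (1 + (x i)\<^sup>2) \<le> B" if "i \<in> S'" for i using b that by blast
    have AS: "A \<subseteq> S" "La \<subseteq> S" "A \<subseteq> S'" "La - {1} \<subseteq> S'" using SA S'A by auto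
    have ne: "es x S (int k - 1) \<noteq> 0" using eS_pos[OF adm] by simp
    have eul: "q x S (int k) = (\<Sum>i\<in>A. qD x i * x i) + (\<Sum>i\<in>La. qD x i * x i)"
      using dq_euler[OF _ ne] sum.union_disjoint[OF fin SA(2), of "\<lambda>i. qD x i * x i"]
      unfolding SA(1)[symmetric] qD_def by (simp add: mult.commute)
    have "(\<Sum>i\<in>La. qD x i * x i) \<le> (\<Sum>i\<in>La. B / M')"
    proof (rule sum_mono)
      fix i assume i: "i \<in> La"
      have xi: "x i > M'" by (rule large[OF i])
      have "qD x i * x i \<le> B * \<bar>x i / (1 + (x i)\<^sup>2)\<bar>" using from_t[OF qb[of i], of "x i"] i AS by auto
      also have "\<bar>x i / (1 + (x i)\<^sup>2)\<bar> \<le> 1 / M'"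
      proof -
        have "x i * M' \<le> x i * x i" using xi M' by (intro mult_left_mono) auto
        then have "x i * M' \<le> 1 + (x i)\<^sup>2" by (simp add: power2_eq_square)
        then show ?thesis using xi M' t[of i] by (simp add: field_simps)
      qed
      finally show "qD x i * x i \<le> B / M'" using B1 by simp
    qed
    also have "\<dots> = real (card La) * (B / M')" by simp
    also have "\<dots> \<le> real n * (B / M')" using cA B1 M' by (intro mult_right_mono) auto
    also have "\<dots> \<le> c / 2" using M' c by (simp add: field_simps)
    finally have qA: "(\<Sum>i\<in>A. qD x i * x i) \<ge> c / 2" using eul qc by linarith
    have Q1e: "?Q1 = (\<Sum>i\<in>A. qD x i * z i) + (\<Sum>i\<in>La. qD x i * z i)"
      using Q_nth_1[OF _ ne, of z] sum.union_disjoint[OF fin SA(2), of "\<lambda>i. qD x i * z i"]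
      unfolding SA(1)[symmetric] qD_def by (simp add: mult.commute)
    have zd: "z i = dd i + x i * \<rho>" for i by (simp add: dd_def)
    \<comment> \<open>The first derivative, restricted to the bounded entries and split into
      transversal and radial part, is solved for \<rho>; by \<open>qA\<close> the divisor is at
      least c / 2.\<close>
    have "(\<Sum>i\<in>A. qD x i * z i) = (\<Sum>i\<in>A. qD x i * dd i) + \<rho> * (\<Sum>i\<in>A. qD x i * x i)"
      by (simp add: zd algebra_simps sum.distrib sum_distrib_left)
    then have "\<rho> * (\<Sum>i\<in>A. qD x i * x i) = ?Q1 - (\<Sum>i\<in>A. qD x i * dd i) - (\<Sum>i\<in>La. qD x i * z i)"
      using Q1e by simp
    then have "\<bar>\<rho>\<bar> * \<bar>\<Sum>i\<in>A. qD x i * x i\<bar> \<le> \<bar>?Q1\<bar> + \<bar>\<Sum>i\<in>A. qD x i * dd i\<bar> + \<bar>\<Sum>i\<in>La. qD x i * z i\<bar>"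
      by (simp flip: abs_mult)
    moreover have "\<bar>\<rho>\<bar> * (c / 2) \<le> \<bar>\<rho>\<bar> * \<bar>\<Sum>i\<in>A. qD x i * x i\<bar>" using qA by (intro mult_left_mono) auto
    moreover have qd: "\<bar>\<Sum>i\<in>A. qD x i * dd i\<bar> \<le> B * (\<Sum>i\<in>A. \<bar>dd i\<bar>)"
      unfolding sum_distrib_left by (rule order_trans[OF sum_abs]) (intro sum_mono from_1, rule qb, use AS in blast)
    moreover have "\<bar>\<Sum>i\<in>La. qD x i * z i\<bar> \<le> B * (\<Sum>i\<in>La. \<bar>y i\<bar>)"
      unfolding sum_distrib_left y_def by (rule order_trans[OF sum_abs]) (intro sum_mono from_t, rule qb, use AS in blast)
    ultimately have "\<bar>\<rho>\<bar> * (c / 2) \<le> \<bar>?Q1\<bar> + B * (\<Sum>i\<in>A. \<bar>dd i\<bar>) + B * (\<Sum>i\<in>La. \<bar>y i\<bar>)" by linarith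
    then have rho: "\<bar>\<rho>\<bar> \<le> 2 / c * (\<bar>?Q1\<bar> + B * (\<Sum>i\<in>A. \<bar>dd i\<bar>) + B * (\<Sum>i\<in>La. \<bar>y i\<bar>))"
      using c by (simp add: field_simps)
    define sA sL where s_defs: "sA = (\<Sum>i\<in>A. \<bar>dd i\<bar>)" "sL = (\<Sum>i\<in>La. \<bar>y i\<bar>)"
    have s0: "sA \<ge> 0" "sL \<ge> 0" by (simp_all add: s_defs sum_nonneg)
    let ?Z = "\<Sum>i\<in>S'. Z (e * \<kappa>) x i * z i"
    have "?Z = (\<Sum>i\<in>A. Z (e * \<kappa>) x i * z i) + (\<Sum>i\<in>La - {1}. Z (e * \<kappa>) x i * z i)"
      unfolding S'A(1) by (rule sum.union_disjoint) (use fin S'A in auto)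
    also have "(\<Sum>i\<in>A. Z (e * \<kappa>) x i * z i) = (\<Sum>i\<in>A. Z (e * \<kappa>) x i * dd i) + \<rho> * (\<Sum>i\<in>A. Z (e * \<kappa>) x i * x i)"
      by (simp add: zd algebra_simps sum.distrib sum_distrib_left)
    finally have "\<bar>?Z\<bar> \<le> \<bar>\<Sum>i\<in>A. Z (e * \<kappa>) x i * dd i\<bar> + \<bar>\<rho>\<bar> * \<bar>\<Sum>i\<in>A. Z (e * \<kappa>) x i * x i\<bar>
        + \<bar>\<Sum>i\<in>La - {1}. Z (e * \<kappa>) x i * z i\<bar>" by (simp flip: abs_mult)
    moreover have "\<bar>\<Sum>i\<in>A. Z (e * \<kappa>) x i * dd i\<bar> \<le> B * sA"
      unfolding sum_distrib_left s_defs by (rule order_trans[OF sum_abs]) (intro sum_mono from_1, rule zb, use AS in blast)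
    moreover have "\<bar>\<Sum>i\<in>A. Z (e * \<kappa>) x i * x i\<bar> \<le> n * B"
    proof -
      have "\<bar>\<Sum>i\<in>A. Z (e * \<kappa>) x i * x i\<bar> \<le> (\<Sum>i\<in>A. B)"
        by (rule order_trans[OF sum_abs]) (intro sum_mono from_x, rule zb, use AS in blast)
      also have "\<dots> \<le> n * B" using cA B1 by (simp add: mult_right_mono)
      finally show ?thesis .
    qed
    then have "\<bar>\<rho>\<bar> * \<bar>\<Sum>i\<in>A. Z (e * \<kappa>) x i * x i\<bar> \<le> (2 / c * (\<bar>?Q1\<bar> + B * sA + B * sL)) * (n * B)"
      using rho B1 c s0 unfolding s_defs[symmetric] by (intro mult_mono) auto
    moreover have "\<bar>\<Sum>i\<in>La - {1}. Z (e * \<kappa>) x i * z i\<bar> \<le> B * sL"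
    proof -
      have "\<bar>\<Sum>i\<in>La - {1}. Z (e * \<kappa>) x i * z i\<bar> \<le> B * (\<Sum>i\<in>La - {1}. \<bar>y i\<bar>)"
        unfolding sum_distrib_left y_def by (rule order_trans[OF sum_abs]) (intro sum_mono from_t, rule zb, use AS in blast)
      also have "(\<Sum>i\<in>La - {1}. \<bar>y i\<bar>) \<le> sL" unfolding s_defs by (rule sum_mono2) (use fin in auto)
      finally show ?thesis using B1 by simp
    qed
    ultimately have "\<bar>?Z\<bar> \<le> B * sA + (2 / c * (\<bar>?Q1\<bar> + B * sA + B * sL)) * (n * B) + B * sL" by linarith
    also have "\<dots> = (2 * n * B / c) * \<bar>?Q1\<bar> + B * (1 + 2 * n * B / c) * sA + B * (1 + 2 * n * B / c) * sL"
      by (simp add: algebra_simps add_divide_distrib)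
    also have "\<dots> \<le> D * \<bar>?Q1\<bar> + D * sA + D * sL" using D0 s0 by (intro add_mono mult_right_mono) auto
    finally have "\<bar>?Z\<bar> \<le> D * (\<bar>?Q1\<bar> + sA + sL)" by (simp add: algebra_simps)
    then have "\<bar>?Z\<bar>\<^sup>2 \<le> (D * (\<bar>?Q1\<bar> + sA + sL))\<^sup>2" by (rule power_mono) simp
    also have "\<dots> = D\<^sup>2 * (\<bar>?Q1\<bar> + sA + sL)\<^sup>2" by (rule power_mult_distrib)
    also have "\<dots> \<le> D\<^sup>2 * (3 * n * (?Q1\<^sup>2 + (\<Sum>i\<in>A. (dd i)\<^sup>2) + (\<Sum>i\<in>La. (y i)\<^sup>2)))"
    proof (rule mult_left_mono)
      have "(p + u + v)\<^sup>2 \<le> 3 * (p\<^sup>2 + u\<^sup>2 + v\<^sup>2)" for p u v :: real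
        using zero_le_power2[of "p - u"] zero_le_power2[of "p - v"] zero_le_power2[of "u - v"]
        by (simp add: power2_eq_square algebra_simps)
      then have "(\<bar>?Q1\<bar> + sA + sL)\<^sup>2 \<le> 3 * (\<bar>?Q1\<bar>\<^sup>2 + sA\<^sup>2 + sL\<^sup>2)" .
      also have "\<dots> \<le> 3 * (n * ?Q1\<^sup>2 + n * (\<Sum>i\<in>A. (dd i)\<^sup>2) + n * (\<Sum>i\<in>La. (y i)\<^sup>2))"
      proof -
        have h: "sA\<^sup>2 \<le> n * (\<Sum>i\<in>A. (dd i)\<^sup>2)" "sL\<^sup>2 \<le> n * (\<Sum>i\<in>La. (y i)\<^sup>2)"
          unfolding s_defs by (intro sum_sq_le_card fin cA)+
        have h': "\<bar>?Q1\<bar>\<^sup>2 \<le> n * ?Q1\<^sup>2" using mult_right_mono[OF n1, of "?Q1\<^sup>2"] by simp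
        show ?thesis by (rule mult_left_mono[OF add_mono[OF add_mono[OF h' h(1)] h(2)]]) simp
      qed
      finally show "(\<bar>?Q1\<bar> + sA + sL)\<^sup>2 \<le> 3 * n * (?Q1\<^sup>2 + (\<Sum>i\<in>A. (dd i)\<^sup>2) + (\<Sum>i\<in>La. (y i)\<^sup>2))"
        by (simp add: algebra_simps)
    qed simp
    finally have Z2: "?Z\<^sup>2 \<le> C6 * (?Q1\<^sup>2 + (\<Sum>i\<in>A. (dd i)\<^sup>2) + (\<Sum>i\<in>La. (y i)\<^sup>2))"
      by (simp only: C6_def power2_abs mult_ac)
    have P0: "?P \<ge> 0"
      using Q_concave[of S x "int k" z] cone_mono[OF coneS[OF adm], of "int k - 1"] k2 by simp
    have xkc: "x k \<ge> c / n"
    proof -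
      have "c / n \<le> q x S (int k) / n" using qc by (intro divide_right_mono) auto
      then show ?thesis using x_k_lower[OF adm] by linarith
    qed
    have st: "(\<Sum>i\<in>A. (dd i)\<^sup>2) \<le> C7 * ?P"
      unfolding A_def dd_def \<rho>_def by (rule strict[OF adm xkc]) (use xM M' in linarith)
    have m1: "m x \<ge> K\<^sub>0" "m x > 0" "m x \<le> (1 + B) * x 1"
    proof -
      have "a x > 0" by (rule a_bounds[OF adm])
      then show "m x \<ge> K\<^sub>0" "m x > 0" using x1 x11 by (simp_all add: m_def)
      have "a x \<le> B * x 1" using b x11 B1 mult_left_mono[of 1 "x 1" B] by linarith
      then show "m x \<le> (1 + B) * x 1" by (simp add: m_def algebra_simps)
    qed
    have i1: "C * C6 * (?Q1\<^sup>2 + C7 * ?P) \<le> m x / 8 * (?P + ?Q1\<^sup>2)"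
    proof -
      have "?Q1\<^sup>2 + C7 * ?P \<le> (1 + C7) * (?P + ?Q1\<^sup>2)" 
        using P0 mult_nonneg_nonneg[OF C7 zero_le_power2[of ?Q1]] by (simp add: algebra_simps)
      then have "C * C6 * (?Q1\<^sup>2 + C7 * ?P) \<le> C * C6 * ((1 + C7) * (?P + ?Q1\<^sup>2))"
        using C C60 by (intro mult_left_mono) auto
      also have "\<dots> = (C * C6 * (1 + C7)) * (?P + ?Q1\<^sup>2)" by simp
      also have "\<dots> \<le> m x / 8 * (?P + ?Q1\<^sup>2)" 
        by (rule mult_right_mono[OF _ add_nonneg_nonneg[OF P0 zero_le_power2]]) (use m1 K0' in linarith)
      finally show ?thesis .
    qed
    \<comment> \<open>y_i^2 carries the weight (1 + x_i^2)^{-2}. One power is matched by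
      \<open>G_lower\<close>, the other beats the constants because x_i > M'.\<close>
    have i2: "C * C6 * (\<Sum>i\<in>La - {1}. (y i)\<^sup>2) \<le> (\<Sum>i\<in>S'. G e x i * (z i)\<^sup>2)"
    proof -
      have "C * C6 * (\<Sum>i\<in>La - {1}. (y i)\<^sup>2) \<le> (\<Sum>i\<in>La - {1}. G e x i * (z i)\<^sup>2)"
        unfolding sum_distrib_left
      proof (rule sum_mono)
        fix i assume i: "i \<in> La - {1}"
        then have iS: "i \<in> S" using AS by auto
        note Gl = G_lower[OF nrm iS]
        have "(y i)\<^sup>2 * 1 \<le> (y i)\<^sup>2 * (G e x i * (4 * real k * (1 + (x i)\<^sup>2)))" using Gl by (intro mult_left_mono) auto
        also have "\<dots> = 4 * real k * (G e x i * (z i)\<^sup>2) / (1 + (x i)\<^sup>2)"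
          unfolding y_def by (rule quotient_square_scale) (use t[of i] in simp)
        finally have "C * C6 * (y i)\<^sup>2 \<le> C * C6 * (4 * real k * (G e x i * (z i)\<^sup>2) / (1 + (x i)\<^sup>2))"
          using C C60 by (intro mult_left_mono) auto
        also have "\<dots> = (C * C6 * (4 * real k)) * (G e x i * (z i)\<^sup>2) / (1 + (x i)\<^sup>2)" by simp
        also have "\<dots> \<le> (1 + (x i)\<^sup>2) * (G e x i * (z i)\<^sup>2) / (1 + (x i)\<^sup>2)"
        proof -
          have "C * C6 * (4 * real k) \<le> x i" using M' large[of i] i by auto
          then have "C * C6 * (4 * real k) \<le> 1 + (x i)\<^sup>2" using xt[of i] by linarith
          then show ?thesis using Gl t[of i] by (intro divide_right_mono mult_right_mono mult_nonneg_nonneg) auto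
        qed
        also have "\<dots> = G e x i * (z i)\<^sup>2" using t[of i] by simp
        finally show "C * C6 * (y i)\<^sup>2 \<le> G e x i * (z i)\<^sup>2" .
      qed
      also have "\<dots> \<le> (\<Sum>i\<in>S'. G e x i * (z i)\<^sup>2)"
      proof (rule sum_mono2)
        fix i assume "i \<in> S' - (La - {1})"
        then have "i \<in> S" by auto
        then show "0 \<le> G e x i * (z i)\<^sup>2" using G_lower(2)[OF nrm, of i] by simp
      qed (use AS in auto)
      finally show ?thesis .
    qed
    \<comment> \<open>Since m \<le> (1 + B) x 1, the quantity (y 1)^2 is at most a constant times (z
      1 / m)^2 / (x 1)^2, and x 1 is large.\<close>
    have i3: "C * C6 * (y 1)\<^sup>2 \<le> d * (z 1 / m x)\<^sup>2"
    proof -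
      have "C * C6 * (1 + B)\<^sup>2 / d \<le> x 1" using K0' x1 by linarith
      then have "C * C6 * (1 + B)\<^sup>2 \<le> d * x 1" by (simp only: pos_divide_le_eq[OF d] mult.commute)
      also have "\<dots> \<le> d * (x 1)\<^sup>2" using x11 d self_le_power[of "x 1" 2] by (intro mult_left_mono) auto
      finally have e1: "C * C6 * (1 + B)\<^sup>2 \<le> d * (x 1)\<^sup>2" .
      have "(m x)\<^sup>2 \<le> ((1 + B) * x 1)\<^sup>2" using m1 by (intro power_mono) auto
      then have "C * C6 * (m x)\<^sup>2 \<le> C * C6 * ((1 + B)\<^sup>2 * (x 1)\<^sup>2)"
        unfolding power_mult_distrib using C C60 by (intro mult_left_mono) auto
      also have "\<dots> = (C * C6 * (1 + B)\<^sup>2) * (x 1)\<^sup>2" by simp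
      also have "\<dots> \<le> (d * (x 1)\<^sup>2) * (x 1)\<^sup>2" by (rule mult_right_mono[OF e1]) simp
      also have "\<dots> = d * ((x 1)\<^sup>2)\<^sup>2" by (simp add: power2_eq_square)
      also have "\<dots> \<le> d * (1 + (x 1)\<^sup>2)\<^sup>2" using d by (intro mult_left_mono power_mono) auto
      finally have e2: "C * C6 * (m x)\<^sup>2 \<le> d * (1 + (x 1)\<^sup>2)\<^sup>2" .
      have "C * C6 * (y 1)\<^sup>2 = (C * C6 * (m x)\<^sup>2) * ((z 1)\<^sup>2 / ((m x)\<^sup>2 * (1 + (x 1)\<^sup>2)\<^sup>2))"
        unfolding y_def power_divide using m1 by simp
      also have "\<dots> \<le> (d * (1 + (x 1)\<^sup>2)\<^sup>2) * ((z 1)\<^sup>2 / ((m x)\<^sup>2 * (1 + (x 1)\<^sup>2)\<^sup>2))"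
        by (rule mult_right_mono[OF e2]) simp
      also have "\<dots> = d * (z 1 / m x)\<^sup>2" unfolding power_divide using t[of 1] by simp
      finally show ?thesis .
    qed
    have "(\<Sum>i\<in>La. (y i)\<^sup>2) = (y 1)\<^sup>2 + (\<Sum>i\<in>La - {1}. (y i)\<^sup>2)" by (rule sum.remove[OF fin(2) oneL])
    then have "?Z\<^sup>2 \<le> C6 * (?Q1\<^sup>2 + C7 * ?P + ((y 1)\<^sup>2 + (\<Sum>i\<in>La - {1}. (y i)\<^sup>2)))"
      using Z2 st C60 by (smt (verit) mult_left_mono)
    then have "C * ?Z\<^sup>2 \<le> C * (C6 * (?Q1\<^sup>2 + C7 * ?P + ((y 1)\<^sup>2 + (\<Sum>i\<in>La - {1}. (y i)\<^sup>2))))"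
      using C by (intro mult_left_mono) auto
    also have "\<dots> = C * C6 * (?Q1\<^sup>2 + C7 * ?P) + C * C6 * (y 1)\<^sup>2 + C * C6 * (\<Sum>i\<in>La - {1}. (y i)\<^sup>2)"
      by (simp only: distrib_left mult.assoc add.assoc)
    finally show ?thesis using i1 i2 i3 by linarith
  qed
  show ?thesis using K0'(1) main by blast
qed

end

section \<open>The Hessian form\<close>

text \<open>The effect on w / M of changing only the linear coefficient of M by s. It is applied
  with s = z 1: in q_k = a - w / m and 1 / q_{k-1} = g + v / m the entry x 1 occurs in m
  alone.\<close>

lemma fps_quotient_shift:
  fixes P P' M M' w :: "real fps"
  assumes P: "P * M = w" "P' * M' = w" and M: "M = M' + fps_const s * fps_X" and m: "m = M' $ 0" "m \<noteq> 0"
  shows "P $ 2 = P' $ 2 + (w $ 0 * (s\<^sup>2 + 2 * s * M' $ 1) / m ^ 3 - w $ 1 * s / m\<^sup>2)"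
proof -
  define a1 a2 w0 w1 w2 where d: "a1 = M' $ 1" "a2 = M' $ 2" "w0 = w $ 0" "w1 = w $ 1" "w2 = w $ 2"
  have M0: "M $ 0 = m" "M $ 1 = a1 + s" "M $ 2 = a2" using m(1) by (simp_all add: M d numeral_2_eq_2)
  note e = fps_mult_coeffs[OF P(1), unfolded M0]
  note e' = fps_mult_coeffs[OF P(2), folded m(1), folded d]
  have e: "P $ 0 * m = w0" "P $ 0 * (a1 + s) + P $ 1 * m = w1" "P $ 0 * a2 + P $ 1 * (a1 + s) + P $ 2 * m = w2"
    using e by (simp_all add: d)
  have "P $ 0 = w0 / m" "P' $ 0 = w0 / m" using e(1) e'(1) m(2) by (simp_all add: field_simps)
  note z = this
  have "P $ 1 = (w1 - w0 / m * (a1 + s)) / m" "P' $ 1 = (w1 - w0 / m * a1) / m"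
    using e(2) e'(2) m(2) unfolding z by (simp_all add: field_simps)
  note o = this
  have "P $ 2 = (w2 - P $ 0 * a2 - P $ 1 * (a1 + s)) / m" "P' $ 2 = (w2 - P' $ 0 * a2 - P' $ 1 * a1) / m"
    using e(3) e'(3) m(2) by (simp_all add: field_simps)
  then have "P $ 2 = (w2 - w0 / m * a2 - (w1 - w0 / m * (a1 + s)) / m * (a1 + s)) / m"
    "P' $ 2 = (w2 - w0 / m * a2 - (w1 - w0 / m * a1) / m * a1) / m"
    unfolding z o by simp_all
  moreover have "(w2 - w0 / m * a2 - (w1 - w0 / m * (a1 + s)) / m * (a1 + s)) / m
      - (w2 - w0 / m * a2 - (w1 - w0 / m * a1) / m * a1) / m = w0 * (s\<^sup>2 + 2 * s * a1) / m ^ 3 - w1 * s / m\<^sup>2"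
    using m(2) by (simp add: field_simps power2_eq_square power3_eq_cube)
  ultimately have "P $ 2 - P' $ 2 = w0 * (s\<^sup>2 + 2 * s * a1) / m ^ 3 - w1 * s / m\<^sup>2"
    by (simp only:)
  then show ?thesis by (simp add: d)
qed

lemma combine_le: "X \<le> - p \<Longrightarrow> c * Y \<le> c * N \<Longrightarrow> 2 * (X + c * Y) \<le> - 2 * p + 2 * c * N" for X Y p c N :: real
  by (simp add: distrib_left)

lemma weighted_cauchy_schwarz:
  fixes Y G z :: "'i \<Rightarrow> real"
  assumes "finite A" "\<And>i. i \<in> A \<Longrightarrow> G i > 0"
  shows "(\<Sum>i\<in>A. Y i * z i)\<^sup>2 \<le> (\<Sum>i\<in>A. (Y i)\<^sup>2 / G i) * (\<Sum>i\<in>A. G i * (z i)\<^sup>2)"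
proof -
  have "(\<Sum>i\<in>A. Y i * z i) = (\<Sum>i\<in>A. (Y i / sqrt (G i)) * (sqrt (G i) * z i))"
    by (intro sum.cong refl) (use assms(2) in force)
  also have "\<dots>\<^sup>2 \<le> (\<Sum>i\<in>A. (Y i / sqrt (G i))\<^sup>2) * (\<Sum>i\<in>A. (sqrt (G i) * z i)\<^sup>2)"
    by (rule Cauchy_Schwarz_ineq_sum)
  also have "(\<Sum>i\<in>A. (Y i / sqrt (G i))\<^sup>2) = (\<Sum>i\<in>A. (Y i)\<^sup>2 / G i)"
    by (intro sum.cong refl) (simp add: power_divide assms(2) less_imp_le)
  also have "(\<Sum>i\<in>A. (sqrt (G i) * z i)\<^sup>2) = (\<Sum>i\<in>A. G i * (z i)\<^sup>2)"
    by (intro sum.cong refl) (simp add: power_mult_distrib assms(2) less_imp_le)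
  finally show ?thesis .
qed

context quot
begin

context
  fixes x :: "nat \<Rightarrow> real" assumes adm: "adm n k K x"
begin

lemma Rt_inverse:
  shows "Rt x z S (int k - 2) (int k - 1) * Q x z S (int k - 1) = 1"
proof -
  let ?N = "Rt x z S (int k - 2) (int k - 1)" and ?R = "Q x z S (int k - 1)"
  let ?c = "es (ray x z) S (int k - 2)" and ?b = "es (ray x z) S (int k - 1)"
  have kk: "int k - 1 - 1 = int k - 2" by simp
  have N: "?N * ?b = ?c" by (rule Rt_mult) (use eS_pos[OF adm] in auto)
  have R: "?R * ?c = ?b" using Q_mult[of S x "int k - 1" z, unfolded kk] eS_pos[OF adm] by simp
  have "?b $ 0 \<noteq> 0" using eS_pos[OF adm] by simp
  then have "?b \<noteq> 0" by (rule fps_nonzeroI)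
  moreover have "?N * ?R * ?b = ?b" using N R by (simp add: mult_ac)
  ultimately show ?thesis by simp
qed

text \<open>The reciprocal of a positive concave function: comparing second coefficients in N *
  q_{k-1} = 1, the concavity of q_{k-1} can only help. The quantitative first inequality is what
  later absorbs the cross term of F * (1 / q_{k-1}).\<close>

lemma N_convex:
  "Rt x z S (int k - 2) (int k - 1) $ 2 \<ge> (Rt x z S (int k - 2) (int k - 1) $ 1)\<^sup>2 / (1 / q x S (int k - 1))"
  "Rt x z S (int k - 2) (int k - 1) $ 0 = 1 / q x S (int k - 1)" "Rt x z S (int k - 2) (int k - 1) $ 2 \<ge> 0"
proof -
  let ?N = "Rt x z S (int k - 2) (int k - 1)" and ?R = "Q x z S (int k - 1)" and ?r = "q x S (int k - 1)"
  have r: "?r \<ge> 1" by (rule q_bounds[OF adm])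
  note c = fps_mult_coeffs[OF Rt_inverse[of z]]
  have R0: "?R $ 0 = ?r" by (simp add: Q_nth_0)
  show N0: "?N $ 0 = 1 / ?r" using c(1) r by (simp add: R0 field_simps)
  have R2: "?R $ 2 \<le> 0" by (rule Q_concave) (use k2 in \<open>auto intro!: cone_mono[OF coneS[OF adm]]\<close>)
  have R1: "?R $ 1 = - (?N $ 1 * ?r\<^sup>2)" using c(2) r unfolding N0 R0 by (simp add: field_simps power2_eq_square)
  have "?N $ 2 * ?r = - (?N $ 1 * ?R $ 1) - 1 / ?r * ?R $ 2" using c(3) unfolding N0 R0 by (simp add: numeral_2_eq_2)
  also have "\<dots> \<ge> - (?N $ 1 * ?R $ 1)" using R2 r by (simp add: field_simps)
  also have "- (?N $ 1 * ?R $ 1) = (?N $ 1)\<^sup>2 * ?r * ?r" unfolding R1 by (simp add: power2_eq_square)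
  finally have "?N $ 2 \<ge> (?N $ 1)\<^sup>2 * ?r" using r by (simp add: mult_le_cancel_right)
  then show 1: "?N $ 2 \<ge> (?N $ 1)\<^sup>2 / (1 / ?r)" by simp
  have "(?N $ 1)\<^sup>2 / (1 / ?r) \<ge> 0" using r by (intro divide_nonneg_nonneg) auto
  then show "?N $ 2 \<ge> 0" using 1 by linarith
qed

lemma m_pos: "m x = es x S (int k - 1) / es x S' (int k - 2)" "m x > 0"
proof -
  have kk: "int k - 1 - 1 = int k - 2" by simp
  have "es x S (int k - 1) = x 1 * es x S' (int k - 2) + es x S' (int k - 1)"
    using es_remove[OF _ oneS, of x "int k - 1"] by (simp only: S'_eq kk finite_atLeastAtMost)
  then show 1: "m x = es x S (int k - 1) / es x S' (int k - 2)"
    unfolding m_def a_def q_def kk using eS'_pos[OF adm] by (simp add: field_simps)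
  show "m x > 0" unfolding 1 using eS'_pos[OF adm] eS_pos[OF adm] by simp
qed

lemma first_order: "qD x 1 = w x / (m x)\<^sup>2" "nD x 1 = v x / (m x)\<^sup>2"
proof -
  have kk: "int k - 1 - 1 = int k - 2" "int k - 2 - 1 = int k - 3" by simp_all
  let ?A = "es x S' (int k - 1)" and ?B = "es x S' (int k)" and ?C = "es x S' (int k - 2)" and ?G = "es x S' (int k - 3)"
  let ?e = "es x S (int k - 1)"
  have p: "?C > 0" "?e > 0" using eS'_pos[OF adm] eS_pos[OF adm] by auto
  have w: "w x = (?A\<^sup>2 - ?B * ?C) / ?C\<^sup>2"
    unfolding w_def a_def q_def kk using p by (simp add: field_simps power2_eq_square)
  have v: "v x = (?C * ?C - ?G * ?A) / ?C\<^sup>2"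
    unfolding v_def g_def a_def q_def kk using p by (simp add: field_simps power2_eq_square)
  show "qD x 1 = w x / (m x)\<^sup>2"
    unfolding qD_def dq_def S'_eq w m_pos(1) using p by (simp add: power_divide)
  have "dr x S (int k - 2) (int k - 1) 1 = (?G * ?A - ?C * ?C) / ?e\<^sup>2"
    using dr_alt[OF _ oneS, of x "int k - 2" "int k - 1"] by (simp only: S'_eq kk finite_atLeastAtMost)
  then have "nD x 1 = (?C * ?C - ?G * ?A) / ?e\<^sup>2"
    by (simp only: nD_def minus_divide_left minus_diff_eq)
  then show "nD x 1 = v x / (m x)\<^sup>2" unfolding v m_pos(1) using p by (simp add: power_divide)
qed

text \<open>Compare z with \<open>z0\<close>, the direction without first component: only m changes,
  and the second coefficients along \<open>z0\<close> are dropped by concavity of q_k and convexity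
  of 1 / q_{k-1}. What is left contains z 1 in every term. After multiplication by m the square term
  is 2 W (z 1 / m)^2, about twice what the theorem demands.\<close>

lemma D_lower:
  assumes \<chi>: "\<chi> \<ge> 0"
  shows "2 * W \<chi> x * (z 1 / m x)\<^sup>2 - 2 * (z 1 / m x) * (\<Sum>i\<in>S'. Z \<chi> x i * z i)
    \<le> m x * (- 2 * Q x z S (int k) $ 2 + 2 * \<chi> * Rt x z S (int k - 2) (int k - 1) $ 2)"
proof -
  define z0 where "z0 = z(1 := 0)"
  have z0: "ray x z0 i = ray x z i" if "i \<in> S'" for i using that by (auto simp: z0_def ray_def)
  have esz0: "es (ray x z0) S' j = es (ray x z) S' j" for j by (rule es_cong) (rule z0)
  let ?A = "es (ray x z) S' (int k - 1)" and ?B = "es (ray x z) S' (int k)" and ?C = "es (ray x z) S' (int k - 2)" and ?G = "es (ray x z) S' (int k - 3)"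
  define A where "A = Rt x z S' (int k - 1) (int k - 2)"
  define c where "c = Rt x z S' (int k) (int k - 2)"
  define h where "h = Rt x z S' (int k - 3) (int k - 2)"
  define ww where "ww = A * A - c"
  define vv where "vv = 1 - h * A"
  have ne: "es x S' (int k - 2) \<noteq> 0" using eS'_pos[OF adm] by simp
  have kk: "int k - 1 - 1 = int k - 2" "int k - 2 - 1 = int k - 3" by simp_all
  have AC: "A * ?C = ?A" "c * ?C = ?B" "h * ?C = ?G"
    unfolding A_def c_def h_def by (intro Rt_mult finite_atLeastAtMost ne)+
  have "?C $ 0 \<noteq> 0" using ne by simp
  then have C0: "?C \<noteq> 0" by (rule fps_nonzeroI)
  have neS: "es x S (int k - 1) \<noteq> 0" using eS_pos[OF adm] by simp
  have key: "(A - Q x y S (int k)) * (ray x y 1 + A) = ww"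
    "(Rt x y S (int k - 2) (int k - 1) - h) * (ray x y 1 + A) = vv" if y: "y = z \<or> y = z0" for y
  proof -
    have esy: "es (ray x y) S' j = es (ray x z) S' j" for j using y esz0 by auto
    let ?r = "ray x y 1"
    have e: "es (ray x y) S (int k) = ?r * ?A + ?B" "es (ray x y) S (int k - 1) = ?r * ?C + ?A"
      "es (ray x y) S (int k - 2) = ?r * ?G + ?C"
      using es_remove[OF _ oneS, of "ray x y"] by (simp_all only: S'_eq esy kk finite_atLeastAtMost)
    have Q: "Q x y S (int k) * (?r * ?C + ?A) = ?r * ?A + ?B" using Q_mult[OF _ neS, of y] by (simp only: e finite_atLeastAtMost)
    have N: "Rt x y S (int k - 2) (int k - 1) * (?r * ?C + ?A) = ?r * ?G + ?C"
      using Rt_mult[OF _ neS, of y "int k - 2"] by (simp only: e finite_atLeastAtMost)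
    have M: "(?r + A) * ?C = ?r * ?C + ?A" by (simp add: distrib_right AC)
    have "(A - Q x y S (int k)) * (?r + A) * ?C = A * (?r * ?C + ?A) - (?r * ?A + ?B)"
      by (simp only: mult.assoc M left_diff_distrib Q)
    also have "\<dots> = A * (?r * ?C + A * ?C) - (?r * (A * ?C) + c * ?C)" by (simp only: AC)
    also have "\<dots> = ww * ?C" by (simp add: ww_def algebra_simps)
    finally show "(A - Q x y S (int k)) * (?r + A) = ww" using C0 by simp
    have "(Rt x y S (int k - 2) (int k - 1) - h) * (?r + A) * ?C = (?r * ?G + ?C) - h * (?r * ?C + ?A)"
      by (simp only: mult.assoc M left_diff_distrib N)
    also have "\<dots> = (?r * (h * ?C) + ?C) - h * (?r * ?C + A * ?C)" by (simp only: AC)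
    also have "\<dots> = vv * ?C" by (simp add: vv_def algebra_simps)
    finally show "(Rt x y S (int k - 2) (int k - 1) - h) * (?r + A) = vv" using C0 by simp
  qed
  have M: "ray x z 1 + A = (ray x z0 1 + A) + fps_const (z 1) * fps_X"
    by (simp add: ray_def z0_def)
  have A0: "A $ 0 = a x" by (simp add: A_def Rt_nth_0 a_def q_def kk)
  have c0: "c $ 0 = es x S' (int k) / es x S' (int k - 2)" and h0: "h $ 0 = g x"
    by (simp_all add: c_def h_def Rt_nth_0 g_def)
  have M0: "m x = (ray x z0 1 + A) $ 0" by (simp add: A0 m_def)
  have M1: "(ray x z0 1 + A) $ 1 = A $ 1" using ray_nth(2)[of x z0 1] by (simp add: z0_def One_nat_def)
  have mp: "m x > 0" by (rule m_pos)
  have A1: "A $ 1 = (\<Sum>i\<in>S'. z i * aD x i)" unfolding A_def aD_def by (rule Rt_nth_1[OF _ ne]) simp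
  have c1: "c $ 1 = (\<Sum>i\<in>S'. z i * cD x i)" unfolding c_def cD_def by (rule Rt_nth_1[OF _ ne]) simp
  have h1: "h $ 1 = (\<Sum>i\<in>S'. z i * gD x i)" unfolding h_def gD_def by (rule Rt_nth_1[OF _ ne]) simp
  have w0: "ww $ 0 = w x" "vv $ 0 = v x" by (simp_all add: ww_def vv_def w_def v_def A0 c0 h0 power2_eq_square)
  have w1: "ww $ 1 = (\<Sum>i\<in>S'. z i * wD x i)"
  proof -
    have "ww $ 1 = 2 * a x * A $ 1 - c $ 1" using fps_mult_nth_1[of A A] by (simp add: ww_def A0)
    then show ?thesis unfolding A1 c1 wD_def
      by (simp add: sum_distrib_left sum_subtractf right_diff_distrib mult_ac)
  qed
  have v1: "vv $ 1 = (\<Sum>i\<in>S'. z i * vD x i)"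
  proof -
    have "vv $ 1 = - (h $ 1 * a x + g x * A $ 1)" using fps_mult_nth_1[of h A] by (simp add: vv_def A0 h0)
    then show ?thesis unfolding A1 h1 vD_def
      by (simp add: sum_distrib_left sum_distrib_right sum_negf sum.distrib sum_subtractf algebra_simps)
  qed
  let ?s = "z 1" and ?m = "m x"
  have "Q x z0 S (int k) $ 2 \<le> 0" by (rule Q_concave) (use k2 in \<open>auto intro!: cone_mono[OF coneS[OF adm]]\<close>)
  moreover have "(A - Q x z S (int k)) $ 2 = (A - Q x z0 S (int k)) $ 2
      + (ww $ 0 * (?s\<^sup>2 + 2 * ?s * (ray x z0 1 + A) $ 1) / ?m ^ 3 - ww $ 1 * ?s / ?m\<^sup>2)"
    by (rule fps_quotient_shift[OF key(1) key(1) M M0]) (use mp in auto)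
  ultimately have q2: "- (Q x z S (int k) $ 2) \<ge> w x * (?s\<^sup>2 + 2 * ?s * A $ 1) / ?m ^ 3 - ww $ 1 * ?s / ?m\<^sup>2"
    unfolding M1 w0 by simp
  have "Rt x z0 S (int k - 2) (int k - 1) $ 2 \<ge> 0" by (rule N_convex)
  moreover have "(Rt x z S (int k - 2) (int k - 1) - h) $ 2 = (Rt x z0 S (int k - 2) (int k - 1) - h) $ 2
      + (vv $ 0 * (?s\<^sup>2 + 2 * ?s * (ray x z0 1 + A) $ 1) / ?m ^ 3 - vv $ 1 * ?s / ?m\<^sup>2)"
    by (rule fps_quotient_shift[OF key(2) key(2) M M0]) (use mp in auto)
  ultimately have n2: "Rt x z S (int k - 2) (int k - 1) $ 2 \<ge> v x * (?s\<^sup>2 + 2 * ?s * A $ 1) / ?m ^ 3 - vv $ 1 * ?s / ?m\<^sup>2"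
    unfolding M1 w0 by simp
  have ZZ: "(\<Sum>i\<in>S'. Z \<chi> x i * z i) = ww $ 1 + \<chi> * vv $ 1 - 2 * W \<chi> x * A $ 1 / ?m"
    unfolding w1 v1 A1 Z_def
    by (simp add: sum_distrib_left sum_divide_distrib sum.distrib sum_subtractf algebra_simps)
  have "\<chi> * (v x * (?s\<^sup>2 + 2 * ?s * A $ 1) / ?m ^ 3 - vv $ 1 * ?s / ?m\<^sup>2) \<le> \<chi> * Rt x z S (int k - 2) (int k - 1) $ 2"
    by (rule mult_left_mono[OF n2 \<chi>])
  then have "2 * (w x * (?s\<^sup>2 + 2 * ?s * A $ 1) / ?m ^ 3 - ww $ 1 * ?s / ?m\<^sup>2
      + \<chi> * (v x * (?s\<^sup>2 + 2 * ?s * A $ 1) / ?m ^ 3 - vv $ 1 * ?s / ?m\<^sup>2))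
    \<le> - 2 * Q x z S (int k) $ 2 + 2 * \<chi> * Rt x z S (int k - 2) (int k - 1) $ 2"
    by (rule combine_le[OF q2])
  from mult_left_mono[OF this, of ?m]
  have "?m * (2 * (w x * (?s\<^sup>2 + 2 * ?s * A $ 1) / ?m ^ 3 - ww $ 1 * ?s / ?m\<^sup>2
      + \<chi> * (v x * (?s\<^sup>2 + 2 * ?s * A $ 1) / ?m ^ 3 - vv $ 1 * ?s / ?m\<^sup>2)))
    \<le> ?m * (- 2 * Q x z S (int k) $ 2 + 2 * \<chi> * Rt x z S (int k - 2) (int k - 1) $ 2)" using mp by simp
  moreover have "?m * (2 * (w x * (?s\<^sup>2 + 2 * ?s * A $ 1) / ?m ^ 3 - ww $ 1 * ?s / ?m\<^sup>2
      + \<chi> * (v x * (?s\<^sup>2 + 2 * ?s * A $ 1) / ?m ^ 3 - vv $ 1 * ?s / ?m\<^sup>2)))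
    = 2 * W \<chi> x * (?s / ?m)\<^sup>2 - 2 * (?s / ?m) * (\<Sum>i\<in>S'. Z \<chi> x i * z i)"
    unfolding ZZ W_def using mp by (simp add: field_simps power2_eq_square power3_eq_cube)
  ultimately show ?thesis by simp
qed

lemma q_pred_upper: "q x S (int k - 1) \<le> n * max (x (k - 1)) 0"
proof -
  have "q x S (int (k - 2) + 1) \<le> real (card S) * max (x (k - 1)) 0"
  proof (rule q_upper[of _ _ _ "{1..k - 2}"])
    show "cone x S (int (k - 2))" using k2 by (intro cone_mono[OF coneS[OF adm]]) simp
    fix j assume "j \<in> S - {1..k - 2}"
    then have "x j \<le> x (k - 1)" using k2 by (intro sorted[OF adm]) auto
    then show "x j \<le> max (x (k - 1)) 0" by simp
  qed (use kn in auto)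
  moreover have "int (k - 2) + 1 = int k - 1" using k2 by simp
  ultimately show ?thesis by simp
qed

end

lemma core_arith:
  fixes \<eta> W s G :: real
  assumes \<eta>: "0 < \<eta>" "\<eta> \<le> 1/2" and W: "W > 0" and u: "u\<^sup>2 \<le> (1 - \<eta>)\<^sup>2 * (2 * W) * G" and G: "G \<ge> 0"
  shows "2 * s * u \<le> (1 - \<eta>) * (W * s\<^sup>2 + 2 * G)"
proof (rule power2_le_imp_le)
  have "(2 * s * u)\<^sup>2 = 4 * s\<^sup>2 * u\<^sup>2" by (simp add: power_mult_distrib)
  also have "\<dots> \<le> 4 * s\<^sup>2 * ((1 - \<eta>)\<^sup>2 * (2 * W) * G)" by (rule mult_left_mono[OF u]) simp
  also have "\<dots> = (1 - \<eta>)\<^sup>2 * (4 * (W * s\<^sup>2) * (2 * G))" by simp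
  also have "\<dots> \<le> (1 - \<eta>)\<^sup>2 * (W * s\<^sup>2 + 2 * G)\<^sup>2"
  proof (rule mult_left_mono)
    show "4 * (W * s\<^sup>2) * (2 * G) \<le> (W * s\<^sup>2 + 2 * G)\<^sup>2"
      using zero_le_power2[of "W * s\<^sup>2 - 2 * G"] by (simp add: power2_eq_square algebra_simps)
  qed simp
  finally show "(2 * s * u)\<^sup>2 \<le> ((1 - \<eta>) * (W * s\<^sup>2 + 2 * G))\<^sup>2" by (simp add: power_mult_distrib)
  show "0 \<le> (1 - \<eta>) * (W * s\<^sup>2 + 2 * G)" using \<eta> W G by (intro mult_nonneg_nonneg add_nonneg_nonneg) auto
qed

end

text \<open>Here u stands for W s^2 with s = z 1 / m. Of the surplus \<eta> u left by
  \<open>core_arith\<close>, one quarter is spent on the term containing \<open>Q1\<close>, and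
  three quarters remain.\<close>

lemma caseI_combine:
  fixes \<eta> t u G s Zs Zt \<alpha> Q1 y mP mD mE :: real
  assumes "2 * s * Zt \<le> (1 - \<eta>) * (u + 2 * G)" "2 * (1 - \<eta>) * G \<le> 2 * (1 - t) * G"
    and "Zs = Zt + \<alpha> * (Q1 - y)" "mP - 2 * s * (\<alpha> * Q1) \<ge> - (\<eta> / 4 * u)" "2 * s * (\<alpha> * y) \<ge> 0"
    and "mD \<ge> 2 * u - 2 * s * Zs" "mE = mD + mP"
  shows "mE \<ge> (1 + 3 * \<eta> / 4) * u - 2 * (1 - t) * G"
proof -
  define p X Y V r r' where defs: "p = \<eta> * u" "X = 2 * s * Zt" "Y = 2 * s * (\<alpha> * Q1)" "V = 2 * s * Zs"
    "r = 2 * (1 - \<eta>) * G" "r' = 2 * (1 - t) * G"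
  have "X \<le> u - p + r" using assms(1) by (simp add: defs algebra_simps)
  moreover have "r \<le> r'" using assms(2) by (simp only: defs)
  moreover have "mP - Y \<ge> - (p / 4)" using assms(4) by (simp add: defs)
  moreover have "V \<le> X + Y" using assms(5) by (simp add: defs assms(3) algebra_simps)
  moreover have "mD \<ge> 2 * u - V" using assms(6) by (simp only: defs)
  moreover have "(1 + 3 * \<eta> / 4) * u - 2 * (1 - t) * G = u + 3 * p / 4 - r'" by (simp add: defs algebra_simps)
  ultimately show ?thesis using assms(7) by linarith
qed

context quot
begin

text \<open>\<open>P\<close> stands for the squared first-order term: \<open>K\<^sub>1\<close> times
  the squared first derivative of q_k for l = k - 1, and 2 \<nu> times that of F with \<nu> = 1 /
  q_{k-1} for l = k - 2. The lower bound by \<open>K\<^sub>1\<close> serves the case of large x (k -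
  1) with e = 0; the comparison with half the squared derivative serves the case of bounded x (k -
  1).\<close>

lemma core:
  "\<exists>K\<^sub>0 K\<^sub>1 \<kappa> \<delta> :: real. K\<^sub>0 \<ge> 1 \<and> K\<^sub>1 \<ge> 1 \<and> 1/2 \<le> \<kappa> \<and> \<kappa> < 1 \<and> \<delta> > 0 \<and>
    (\<forall>x e z P. normal e x \<longrightarrow> x 1 \<ge> K\<^sub>0 \<longrightarrow> P \<ge> 0 \<longrightarrow> (e = 0 \<longrightarrow> P \<ge> K\<^sub>1 * (Q x z S (int k) $ 1)\<^sup>2) \<longrightarrow>
      - 2 * Q x z S (int k) $ 2 + 2 * (e * \<kappa>) * Rt x z S (int k - 2) (int k - 1) $ 2 + P
        \<ge> - 2 * Q x z S (int k) $ 2 + 1 / 2 * (Q x z S (int k) $ 1)\<^sup>2 \<longrightarrow>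
      - 2 * Q x z S (int k) $ 2 + 2 * (e * \<kappa>) * Rt x z S (int k - 2) (int k - 1) $ 2 + P
        + 2 / ((1 + \<delta>) * x 1) * (\<Sum>i\<in>S'. G e x i * (z i)\<^sup>2) \<ge> (1 + \<delta>) * (G e x 1 * (z 1)\<^sup>2 / x 1))"
proof -
  obtain \<eta>0 M0 where I0: "0 < \<eta>0" "\<eta>0 \<le> 1/2" "M0 \<ge> 1" and c0: "\<And>x \<kappa>. normal 0 x \<Longrightarrow> x (k - 1) \<ge> M0 \<Longrightarrow> 1 - \<eta>0 \<le> \<kappa> \<Longrightarrow> \<kappa> \<le> 1 \<Longrightarrow>
    (\<Sum>i\<in>S'. (Z (0 * \<kappa>) x i - (1 - 0) * a x * qD x i)\<^sup>2 / G 0 x i) \<le> (1 - \<eta>0)\<^sup>2 * (2 * W (0 * \<kappa>) x)"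
    using caseI[of 0] by blast
  obtain \<eta>1 M1 where I1: "0 < \<eta>1" "\<eta>1 \<le> 1/2" "M1 \<ge> 1" and c1: "\<And>x \<kappa>. normal 1 x \<Longrightarrow> x (k - 1) \<ge> M1 \<Longrightarrow> 1 - \<eta>1 \<le> \<kappa> \<Longrightarrow> \<kappa> \<le> 1 \<Longrightarrow>
    (\<Sum>i\<in>S'. (Z (1 * \<kappa>) x i - (1 - 1) * a x * qD x i)\<^sup>2 / G 1 x i) \<le> (1 - \<eta>1)\<^sup>2 * (2 * W (1 * \<kappa>) x)"
    using caseI[of 1] by blast
  define \<eta> where "\<eta> = min \<eta>0 \<eta>1"
  define M where "M = max M0 M1"
  have \<eta>: "0 < \<eta>" "\<eta> \<le> 1/2" "\<eta> \<le> \<eta>0" "\<eta> \<le> \<eta>1" using I0 I1 by (auto simp: \<eta>_def)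
  have M: "M \<ge> 1" "M \<ge> M0" "M \<ge> M1" using I0 by (auto simp: M_def)
  \<comment> \<open>t plays the roles of \<delta> and 1 - \<kappa> at once. The losses combine to (1
    + t)^2 / (1 - t), which must stay below 1 + 3 \<eta> / 4 = 1 + 12 t and, in the bounded case,
    below 5 / 4.\<close>
  define t where "t = \<eta> / 16"
  have t: "0 < t" "t \<le> 1/32" using \<eta> by (simp_all add: t_def)
  \<comment> \<open>A lower bound for q_k in the bounded case, where q_k is 1 or the reciprocal of
    q_{k-1} \<le> n M. It leads to w \<ge> a^2 / k \<ge> c^2 / k = \<open>cW\<close>.\<close>
  define c where "c = 1 / (n * M)"
  have n1: "real n \<ge> 1" using kn k2 by simp
  have nM: "n * M \<ge> 1" using mult_mono[OF n1 M(1)] by simp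
  have c: "c > 0" "c \<le> 1" using nM by (simp_all add: c_def)
  define cW where "cW = c\<^sup>2 / k"
  have cW: "cW > 0" using c k2 by (simp add: cW_def)
  \<comment> \<open>Chosen so that (3/2) s Zs \<le> (cW/8) s^2 + (9 / (2 cW)) Zs^2 is exactly the
    arithmetic-geometric mean inequality.\<close>
  have CW: "9 / (2 * cW) > 0" "cW / 8 > 0" using cW by simp_all
  obtain K\<^sub>2 where K2: "K\<^sub>2 \<ge> 1" and c2: "\<And>x e \<kappa> z. normal e x \<Longrightarrow> x (k - 1) \<le> M \<Longrightarrow> x 1 \<ge> K\<^sub>2 \<Longrightarrow> 0 \<le> \<kappa> \<Longrightarrow> \<kappa> \<le> 1 \<Longrightarrow> q x S (int k) \<ge> c \<Longrightarrow>
    9 / (2 * cW) * (\<Sum>i\<in>S'. Z (e * \<kappa>) x i * z i)\<^sup>2 \<le> (\<Sum>i\<in>S'. G e x i * (z i)\<^sup>2)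
      + m x / 8 * (- (Q x z S (int k) $ 2) + (Q x z S (int k) $ 1)\<^sup>2) + cW / 8 * (z 1 / m x)\<^sup>2"
    using caseII[OF M(1) c(1) CW] by blast
  \<comment> \<open>The summand n L / t yields a \<le> t x 1, hence x 1 \<le> m \<le> (1 + t) x 1.
    In the next constant, 4 k / \<eta> comes from Young's inequality for 2 s a Q1 combined with a^2
    \<le> k W.\<close>
  define K\<^sub>0 where "K\<^sub>0 = K\<^sub>2 + n * L / t"
  define K\<^sub>1 where "K\<^sub>1 = 1 + 4 * real k / \<eta>"
  define \<kappa> where "\<kappa> = 1 - t"
  have nLt: "n * L / t \<ge> 0" using L1 t by simp
  have K0': "K\<^sub>0 \<ge> 1" "K\<^sub>0 \<ge> K\<^sub>2" "K\<^sub>0 \<ge> n * L / t" using nLt K2 by (simp_all add: K\<^sub>0_def)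
  have K1': "K\<^sub>1 \<ge> 1" "K\<^sub>1 \<ge> 4 * real k / \<eta>" using \<eta> by (simp_all add: K\<^sub>1_def)
  have \<kappa>: "1/2 \<le> \<kappa>" "\<kappa> < 1" "0 \<le> \<kappa>" "\<kappa> \<le> 1" "\<kappa> > 0" using t by (simp_all add: \<kappa>_def)
  have \<kappa>\<eta>: "1 - \<eta> \<le> \<kappa>" using \<eta> by (simp add: \<kappa>_def t_def)
  have r1: "(1 + t) * (1 + t) / \<kappa> \<le> 1 + 3 * \<eta> / 4"
  proof -
    have "t * t \<le> t * (1/32)" using t by (intro mult_left_mono) auto
    then have "(1 + t) * (1 + t) \<le> (1 + 12 * t) * (1 - t)" using t by (simp add: algebra_simps)
    moreover have "3 * \<eta> / 4 = 12 * t" by (simp add: t_def)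
    ultimately show ?thesis using \<kappa>(5) unfolding \<kappa>_def by (simp only: pos_divide_le_eq)
  qed
  have r2: "(1 + t) * (1 + t) / \<kappa> \<le> 5 / 4"
  proof -
    have "(1 + t) * (1 + t) \<le> 33 / 32 * (33 / 32)" using t by (intro mult_mono) auto
    also have "\<dots> \<le> 5 / 4 * (1 - t)" using t by simp
    finally have "(1 + t) * (1 + t) \<le> 5 / 4 * (1 - t)" .
    then show ?thesis using \<kappa>(5) unfolding \<kappa>_def by (simp only: pos_divide_le_eq)
  qed
  have main: "- 2 * Q x z S (int k) $ 2 + 2 * (e * \<kappa>) * Rt x z S (int k - 2) (int k - 1) $ 2 + P
        + 2 / ((1 + t) * x 1) * (\<Sum>i\<in>S'. G e x i * (z i)\<^sup>2) \<ge> (1 + t) * (G e x 1 * (z 1)\<^sup>2 / x 1)"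
    if nrm: "normal e x" and x1: "x 1 \<ge> K\<^sub>0" and P: "P \<ge> 0" and P0: "e = 0 \<Longrightarrow> P \<ge> K\<^sub>1 * (Q x z S (int k) $ 1)\<^sup>2"
      and low: "- 2 * Q x z S (int k) $ 2 + 2 * (e * \<kappa>) * Rt x z S (int k - 2) (int k - 1) $ 2 + P
        \<ge> - 2 * Q x z S (int k) $ 2 + 1 / 2 * (Q x z S (int k) $ 1)\<^sup>2" for x e z P
  proof -
    have adm: "adm n k K x" using nrm by (simp add: normal_def)
    have e01: "e = 0 \<or> e = 1" using nrm by (auto simp: normal_def)
    have e\<kappa>: "e * \<kappa> \<ge> 0" using e01 \<kappa> by auto
    define Dd where "Dd = - 2 * Q x z S (int k) $ 2 + 2 * (e * \<kappa>) * Rt x z S (int k - 2) (int k - 1) $ 2"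
    define E where "E = Dd + P"
    define s where "s = z 1 / m x"
    define Zs where "Zs = (\<Sum>i\<in>S'. Z (e * \<kappa>) x i * z i)"
    define Gs where "Gs = (\<Sum>i\<in>S'. G e x i * (z i)\<^sup>2)"
    define w' where "w' = W (e * \<kappa>) x"
    let ?Q1 = "Q x z S (int k) $ 1" and ?Q2 = "Q x z S (int k) $ 2"
    have x11: "x 1 \<ge> 1" "x 1 > 0" using x1 K0' by linarith+
    have ax: "0 < a x" "a x \<le> t * x 1"
    proof -
      show "0 < a x" by (rule a_bounds[OF adm])
      have "n * L / t \<le> x 1" using K0' x1 by linarith
      then have "n * L \<le> t * x 1" using t by (simp only: pos_divide_le_eq mult.commute)
      then show "a x \<le> t * x 1" using a_bounds(3)[OF adm] by linarith
    qed
    have mx: "m x \<ge> x 1" "m x \<le> (1 + t) * x 1" "m x \<ge> 1" "m x > 0"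
      using ax x11 by (simp_all add: m_def algebra_simps)
    have Dl: "m x * Dd \<ge> 2 * w' * s\<^sup>2 - 2 * s * Zs"
      using D_lower[OF adm e\<kappa>, of z] by (simp only: Dd_def w'_def s_def Zs_def)
    have mP: "m x * P \<ge> 0" using mx P by simp
    have mE: "m x * E = m x * Dd + m x * P" by (simp add: E_def distrib_left)
    have Gs0: "Gs \<ge> 0" unfolding Gs_def
    proof (rule sum_nonneg)
      fix i assume "i \<in> S'"
      then have "i \<in> S" by auto
      then show "0 \<le> G e x i * (z i)\<^sup>2" using G_lower(2)[OF nrm, of i] by simp
    qed
    have wpos: "w x > 0" "(a x)\<^sup>2 \<le> real k * w x" using w_bounds[OF adm] by auto
    have ww: "w x \<le> w'" "w' > 0" using W_ge_w(2)[OF nrm \<kappa>(3)] wpos by (simp_all add: w'_def)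
    have v0: "e * v x \<ge> 0" using nrm v_bounds(1)[OF adm] by (auto simp: normal_def)
    \<comment> \<open>\<open>G\<close> at index 1 involves w + e v, whereas the available
      coefficient is w' = w + e \<kappa> v; passing between them costs the factor 1 /
      \<kappa>.\<close>
    have G1: "m x * ((1 + t) * (G e x 1 * (z 1)\<^sup>2 / x 1)) \<le> (1 + t) * (1 + t) / \<kappa> * w' * s\<^sup>2"
    proof -
      have "G e x 1 = (w x + e * v x) / (m x)\<^sup>2" by (simp add: G_def first_order[OF adm] add_divide_distrib)
      then have "G e x 1 * (z 1)\<^sup>2 = (w x + e * v x) * s\<^sup>2" by (simp add: s_def power_divide)
      moreover have "w x + e * v x \<le> w' / \<kappa>"
      proof -
        have "\<kappa> * w x \<le> 1 * w x" using \<kappa> wpos by (intro mult_right_mono) auto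
        then have "(w x + e * v x) * \<kappa> \<le> w'" by (simp add: w'_def W_def algebra_simps)
        then show ?thesis using \<kappa>(5) by (simp only: pos_le_divide_eq)
      qed
      ultimately have g: "G e x 1 * (z 1)\<^sup>2 \<le> w' / \<kappa> * s\<^sup>2" by (simp only:) (intro mult_right_mono, auto)
      have "m x * ((1 + t) * (G e x 1 * (z 1)\<^sup>2 / x 1)) = m x / x 1 * (1 + t) * (G e x 1 * (z 1)\<^sup>2)" by simp
      also have "\<dots> \<le> (1 + t) * (1 + t) * (w' / \<kappa> * s\<^sup>2)"
      proof (rule mult_mono[OF _ g])
        have "m x / x 1 \<le> 1 + t" using mx x11 by (simp only: pos_divide_le_eq)
        then show "m x / x 1 * (1 + t) \<le> (1 + t) * (1 + t)" using t by (intro mult_right_mono) auto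
        have "G e x 1 > 0" by (rule G_lower(2)[OF nrm oneS])
        then show "0 \<le> G e x 1 * (z 1)\<^sup>2" by simp
        show "0 \<le> (1 + t) * (1 + t)" using t by simp
      qed
      finally show ?thesis by (simp add: mult_ac)
    qed
    have third: "m x * (2 / ((1 + t) * x 1) * Gs) \<ge> 2 * (1 - t) * Gs"
    proof -
      have "2 * (1 - t) * ((1 + t) * x 1) \<le> m x * 2"
      proof -
        have "(1 - t) * (1 + t) \<le> 1" by (simp add: algebra_simps)
        then have "(1 - t) * (1 + t) * x 1 \<le> 1 * x 1" using x11 by (intro mult_right_mono) auto
        moreover have "2 * (1 - t) * ((1 + t) * x 1) = 2 * ((1 - t) * (1 + t) * x 1)" by (simp only: mult_ac)
        ultimately show ?thesis using mx by linarith
      qed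
      then have "2 * (1 - t) \<le> m x * 2 / ((1 + t) * x 1)" 
        using mult_pos_pos[of "1 + t" "x 1"] t x11 by (simp only: pos_le_divide_eq add_pos_pos zero_less_one)
      then have "2 * (1 - t) * Gs \<le> m x * 2 / ((1 + t) * x 1) * Gs" by (rule mult_right_mono[OF _ Gs0])
      then show ?thesis by simp
    qed
    have ws: "w' * s\<^sup>2 \<ge> 0" using ww by simp
    have goal_m: "m x * (E + 2 / ((1 + t) * x 1) * Gs) \<ge> m x * ((1 + t) * (G e x 1 * (z 1)\<^sup>2 / x 1))"
    proof (cases "x (k - 1) \<le> M")
      case True
      have qc: "q x S (int k) \<ge> c"
      proof (cases "e = 0")
        case True
        then show ?thesis using nrm c by (simp add: normal_def)
      next
        case False
        then have qq: "q x S (int k) * q x S (int k - 1) = 1" using nrm by (simp add: normal_def)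
        have "q x S (int k - 1) \<le> n * max (x (k - 1)) 0" by (rule q_pred_upper[OF adm])
        also have "\<dots> \<le> n * M" using True M by (intro mult_left_mono) auto
        finally have r: "q x S (int k - 1) \<le> n * M" .
        have "1 \<le> q x S (int k) * (n * M)"
          using mult_left_mono[OF r, of "q x S (int k)"] q_bounds[OF adm] unfolding qq by linarith
        moreover have "0 < real n * M" using nM by linarith
        ultimately show ?thesis unfolding c_def by (simp only: pos_divide_le_eq)
      qed
      have "c\<^sup>2 \<le> (a x)\<^sup>2" using a_bounds(2)[OF adm] qc c by (intro power_mono) auto
      then have "c\<^sup>2 \<le> k * w x" using wpos by linarith
      moreover have "real k * w x \<le> real k * w'" using ww by (intro mult_left_mono) auto
      ultimately have "c\<^sup>2 \<le> real k * w'" by linarith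
      then have cw: "cW \<le> w'" using k2 by (simp add: cW_def pos_divide_le_eq mult.commute)
      have i1: "m x * (- 2 * ?Q2 + 1 / 2 * ?Q1\<^sup>2) = - 2 * (m x * ?Q2) + 1 / 2 * (m x * ?Q1\<^sup>2)"
        and i2: "m x / 8 * (- ?Q2 + ?Q1\<^sup>2) = - (1 / 8) * (m x * ?Q2) + 1 / 8 * (m x * ?Q1\<^sup>2)"
        by (simp_all add: algebra_simps)
      have "9 / (2 * cW) * Zs\<^sup>2 \<le> Gs + m x / 8 * (- ?Q2 + ?Q1\<^sup>2) + cW / 8 * s\<^sup>2"
        unfolding Zs_def Gs_def s_def
        by (rule c2[OF nrm True _ \<kappa>(3,4) qc]) (use x1 K0' in linarith)
      then have "9 / (2 * cW) * Zs\<^sup>2 \<le> Gs + (- (1 / 8) * (m x * ?Q2) + 1 / 8 * (m x * ?Q1\<^sup>2)) + cW / 8 * s\<^sup>2"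
        unfolding i2 .
      moreover have "cW / 8 * s\<^sup>2 \<le> w' / 8 * s\<^sup>2" using cw by (intro mult_right_mono) auto
      moreover have "3 / 2 * (s * Zs) \<le> 1 / 8 * (w' * s\<^sup>2) + 9 / (2 * cW) * Zs\<^sup>2"
      proof -
        have "1 / 8 * (cW * s\<^sup>2) + 9 / (2 * cW) * Zs\<^sup>2 - 3 / 2 * (s * Zs) = (cW * s - 6 * Zs)\<^sup>2 / (8 * cW)"
          using cW by (simp add: field_simps power2_eq_square)
        moreover have "(cW * s - 6 * Zs)\<^sup>2 / (8 * cW) \<ge> 0" using cW by simp
        moreover have "cW * s\<^sup>2 \<le> w' * s\<^sup>2" using cw by (intro mult_right_mono) auto
        ultimately show ?thesis by linarith
      qed
      \<comment> \<open>Three quarters of \<open>Dl\<close> and one quarter of this bound give (3/2)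
        w' s^2 - (3/2) s Zs - m Q2 / 2 + m Q1^2 / 8. The mixed term costs w' s^2 / 4, Gs and parts
        of the last two terms, so 5/4 w' s^2 - Gs remains.\<close>
      moreover have "m x * E \<ge> - 2 * (m x * ?Q2) + 1 / 2 * (m x * ?Q1\<^sup>2)"
        unfolding i1[symmetric] E_def Dd_def by (rule mult_left_mono[OF low]) (use mx in simp)
      moreover have "?Q2 \<le> 0" by (rule Q_concave) (use k2 in \<open>auto intro!: cone_mono[OF coneS[OF adm]]\<close>)
      then have "m x * ?Q2 \<le> 0" using mx by (simp add: mult_nonneg_nonpos)
      moreover have "m x * ?Q1\<^sup>2 \<ge> 0" using mx by simp
      ultimately have "m x * E \<ge> 5 / 4 * (w' * s\<^sup>2) - Gs" using Dl mE mP by linarith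
      moreover have "2 * (1 - t) * Gs \<ge> 1 * Gs" using t Gs0 by (intro mult_right_mono) auto
      moreover have "(1 + t) * (1 + t) / \<kappa> * w' * s\<^sup>2 \<le> 5 / 4 * (w' * s\<^sup>2)"
        using mult_right_mono[OF r2 ws] by (simp add: mult.assoc)
      ultimately show ?thesis using third G1 unfolding distrib_left by linarith
    next
      case False
      then have xM: "x (k - 1) \<ge> M" by simp
      define \<alpha> where "\<alpha> = (1 - e) * a x"
      define Zt where "Zt = (\<Sum>i\<in>S'. (Z (e * \<kappa>) x i - \<alpha> * qD x i) * z i)"
      have Gp: "G e x i > 0" if "i \<in> S'" for i using G_lower(2)[OF nrm, of i] that by auto
      have H: "(\<Sum>i\<in>S'. (Z (e * \<kappa>) x i - \<alpha> * qD x i)\<^sup>2 / G e x i) \<le> (1 - \<eta>)\<^sup>2 * (2 * w')"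
      proof -
        have mono: "(1 - h)\<^sup>2 * (2 * w') \<le> (1 - \<eta>)\<^sup>2 * (2 * w')" if "\<eta> \<le> h" "h \<le> 1/2" for h
          using that ww \<eta> by (intro mult_right_mono power_mono) auto
        show ?thesis
        proof (cases "e = 0")
          case True
          show ?thesis using c0[of x \<kappa>] nrm xM M \<kappa> \<kappa>\<eta> \<eta> mono[of \<eta>0] I0 unfolding True \<alpha>_def w'_def by fastforce
        next
          case False
          then have e: "e = 1" using e01 by simp
          show ?thesis using c1[of x \<kappa>] nrm xM M \<kappa> \<kappa>\<eta> \<eta> mono[of \<eta>1] I1 unfolding e \<alpha>_def w'_def by fastforce
        qed
      qed
      have "Zt\<^sup>2 \<le> (\<Sum>i\<in>S'. (Z (e * \<kappa>) x i - \<alpha> * qD x i)\<^sup>2 / G e x i) * Gs"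
        unfolding Zt_def Gs_def by (rule weighted_cauchy_schwarz[OF _ Gp]) simp
      also have "\<dots> \<le> (1 - \<eta>)\<^sup>2 * (2 * w') * Gs" by (rule mult_right_mono[OF H Gs0])
      finally have "2 * s * Zt \<le> (1 - \<eta>) * (w' * s\<^sup>2 + 2 * Gs)" by (rule core_arith[OF \<eta>(1,2) ww(2) _ Gs0])
      moreover have "2 * (1 - \<eta>) * Gs \<le> 2 * (1 - t) * Gs" using \<eta> Gs0 by (intro mult_right_mono) (auto simp: t_def)
      \<comment> \<open>Summing the subtracted multiple of \<open>qD\<close> over S' gives the full
        first derivative minus its term at index 1. That term enters the estimate with a favourable
        sign; the derivative itself is left to \<open>P\<close>.\<close>
      moreover have "Zs = Zt + \<alpha> * (?Q1 - w x / (m x) * s)"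
      proof -
        have ne: "es x S (int k - 1) \<noteq> 0" using eS_pos[OF adm] by simp
        have "?Q1 = (\<Sum>i\<in>S. z i * qD x i)" unfolding qD_def by (rule Q_nth_1[OF _ ne]) simp
        also have "\<dots> = z 1 * qD x 1 + (\<Sum>i\<in>S - {1}. z i * qD x i)" by (rule sum.remove[OF _ oneS]) simp
        also have "z 1 * qD x 1 = w x / m x * s" unfolding first_order[OF adm] s_def using mx by (simp add: power2_eq_square)
        finally have "(\<Sum>i\<in>S'. z i * qD x i) = ?Q1 - w x / m x * s" by (simp add: S'_eq)
        moreover have "Zs = Zt + \<alpha> * (\<Sum>i\<in>S'. z i * qD x i)"
        proof -
          have "Zs = (\<Sum>i\<in>S'. (Z (e * \<kappa>) x i - \<alpha> * qD x i) * z i + \<alpha> * (z i * qD x i))"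
            unfolding Zs_def by (intro sum.cong refl) (simp add: algebra_simps)
          then show ?thesis unfolding Zt_def by (simp only: sum.distrib sum_distrib_left)
        qed
        ultimately show ?thesis by (simp only:)
      qed
      moreover have "m x * P - 2 * s * (\<alpha> * ?Q1) \<ge> - (\<eta> / 4 * (w' * s\<^sup>2))"
      proof (cases "e = 0")
        case False
        then have "2 * s * (\<alpha> * ?Q1) = 0" using e01 by (simp add: \<alpha>_def)
        moreover have "0 \<le> \<eta> / 4 * (w' * s\<^sup>2)" by (rule mult_nonneg_nonneg[OF _ ws]) (use \<eta> in simp)
        ultimately show ?thesis using mP by linarith
      next
        case True
        then have \<alpha>: "\<alpha> = a x" by (simp add: \<alpha>_def)
        have "4 * real k / \<eta> * ?Q1\<^sup>2 \<le> K\<^sub>1 * ?Q1\<^sup>2" using K1' by (intro mult_right_mono) auto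
        then have "4 * real k / \<eta> * ?Q1\<^sup>2 \<le> P" using P0[OF True] by linarith
        also have "P \<le> m x * P" using mx P mult_right_mono[of 1 "m x" P] by simp
        finally have p: "4 * real k / \<eta> * ?Q1\<^sup>2 \<le> m x * P" .
        have kw: "(a x)\<^sup>2 \<le> k * w'" 
          using wpos(2) mult_left_mono[OF ww(1), of "real k"] by linarith
        have k0: "real k > 0" using k2 by simp
        have "\<eta> / 4 * (w' * s\<^sup>2) \<ge> \<eta> / (4 * real k) * ((a x)\<^sup>2 * s\<^sup>2)"
        proof -
          have "(a x)\<^sup>2 * s\<^sup>2 \<le> k * w' * s\<^sup>2" using kw by (rule mult_right_mono) simp
          then have "\<eta> / (4 * real k) * ((a x)\<^sup>2 * s\<^sup>2) \<le> \<eta> / (4 * real k) * (k * w' * s\<^sup>2)" using \<eta> by (intro mult_left_mono) auto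
          also have "\<dots> = \<eta> / 4 * (w' * s\<^sup>2)" using k0 by simp
          finally show ?thesis .
        qed
        moreover have "2 * s * (a x * ?Q1) \<le> \<eta> / (4 * real k) * ((a x)\<^sup>2 * s\<^sup>2) + 4 * real k / \<eta> * ?Q1\<^sup>2"
        proof -
          have "\<eta> / (4 * real k) * ((a x)\<^sup>2 * s\<^sup>2) + 4 * real k / \<eta> * ?Q1\<^sup>2 - 2 * s * (a x * ?Q1)
            = (\<eta> * (a x * s) - 4 * real k * ?Q1)\<^sup>2 / (4 * real k * \<eta>)"
            using \<eta> k0 by (simp add: field_simps power2_eq_square)
          moreover have "(\<eta> * (a x * s) - 4 * real k * ?Q1)\<^sup>2 / (4 * real k * \<eta>) \<ge> 0" using \<eta> by simp
          ultimately show ?thesis by linarith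
        qed
        ultimately show ?thesis using p unfolding \<alpha> by linarith
      qed
      moreover have "2 * s * (\<alpha> * (w x / m x * s)) \<ge> 0"
      proof -
        have "\<alpha> \<ge> 0" using e01 ax by (auto simp: \<alpha>_def)
        moreover have "2 * s * (\<alpha> * (w x / m x * s)) = 2 * \<alpha> * (w x / m x) * s\<^sup>2" by (simp add: power2_eq_square)
        moreover have "0 \<le> 2 * \<alpha> * (w x / m x) * s\<^sup>2"
          using calculation(1) wpos mx by (intro mult_nonneg_nonneg divide_nonneg_nonneg) auto
        ultimately show ?thesis by (simp only:)
      qed
      moreover have "m x * Dd \<ge> 2 * (w' * s\<^sup>2) - 2 * s * Zs" using Dl by (simp only: mult.assoc)
      ultimately have "m x * E \<ge> (1 + 3 * \<eta> / 4) * (w' * s\<^sup>2) - 2 * (1 - t) * Gs"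
        using mE by (intro caseI_combine)
      moreover have "(1 + t) * (1 + t) / \<kappa> * w' * s\<^sup>2 \<le> (1 + 3 * \<eta> / 4) * (w' * s\<^sup>2)"
        using mult_right_mono[OF r1 ws] by (simp add: mult.assoc)
      ultimately show ?thesis using third G1 unfolding distrib_left by linarith
    qed
    then have "(1 + t) * (G e x 1 * (z 1)\<^sup>2 / x 1) \<le> E + 2 / ((1 + t) * x 1) * Gs"
      by (rule mult_left_le_imp_le) (rule mx)
    then show ?thesis by (simp only: E_def Dd_def Gs_def)
  qed
  show ?thesis using K0'(1) K1'(1) \<kappa>(1,2) t(1) main by blast
qed

end

section \<open>Reduction to the normalized problem\<close>

context quot
begin

text \<open>For l = k - 2 and F = 1 put \<nu> = 1 / q_{k-1} = q_k. The product rule for q_k = F * (1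
  / q_{k-1}) gives Q2 = N2 + F1 N1 + \<nu> F2, and \<open>core\<close> then yields \<nu> times the
  claim. As \<nu> may be arbitrarily small, every term has to carry the factor \<nu>, and it is
  cancelled at the end.\<close>

lemma normalized:
  assumes l: "int l = int k - 1 \<or> int l = int k - 2 \<and> k \<ge> 3"
  shows "\<exists>K\<^sub>0 K\<^sub>1 \<delta> :: real. K\<^sub>0 \<ge> 1 \<and> K\<^sub>1 \<ge> 1 \<and> \<delta> > 0 \<and> (\<forall>x z. adm n k K x \<longrightarrow> es x S (int k) / es x S (int l) = 1 \<longrightarrow> x 1 \<ge> K\<^sub>0 \<longrightarrow>
    - 2 * Rt x z S (int k) (int l) $ 2 + K\<^sub>1 * (Rt x z S (int k) (int l) $ 1)\<^sup>2
      + 2 / ((1 + \<delta>) * x 1) * (\<Sum>i\<in>S'. dr x S (int k) (int l) i * (z i)\<^sup>2)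
      \<ge> (1 + \<delta>) * (dr x S (int k) (int l) 1 * (z 1)\<^sup>2 / x 1))"
proof -
  obtain K\<^sub>0 K\<^sub>1 \<kappa> \<delta> where C: "K\<^sub>0 \<ge> 1" "K\<^sub>1 \<ge> 1" "1/2 \<le> \<kappa>" "\<kappa> < 1" "\<delta> > 0"
    and core: "\<And>x e z P. \<lbrakk>normal e x; x 1 \<ge> K\<^sub>0; P \<ge> 0; e = 0 \<longrightarrow> P \<ge> K\<^sub>1 * (Q x z S (int k) $ 1)\<^sup>2;
      - 2 * Q x z S (int k) $ 2 + 2 * (e * \<kappa>) * Rt x z S (int k - 2) (int k - 1) $ 2 + P
        \<ge> - 2 * Q x z S (int k) $ 2 + 1 / 2 * (Q x z S (int k) $ 1)\<^sup>2\<rbrakk> \<Longrightarrow>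
      - 2 * Q x z S (int k) $ 2 + 2 * (e * \<kappa>) * Rt x z S (int k - 2) (int k - 1) $ 2 + P
        + 2 / ((1 + \<delta>) * x 1) * (\<Sum>i\<in>S'. G e x i * (z i)\<^sup>2) \<ge> (1 + \<delta>) * (G e x 1 * (z 1)\<^sup>2 / x 1)"
    using core by blast
  from l show ?thesis
  proof
    assume l1: "int l = int k - 1"
    have "- 2 * Rt x z S (int k) (int l) $ 2 + K\<^sub>1 * (Rt x z S (int k) (int l) $ 1)\<^sup>2
      + 2 / ((1 + \<delta>) * x 1) * (\<Sum>i\<in>S'. dr x S (int k) (int l) i * (z i)\<^sup>2)
      \<ge> (1 + \<delta>) * (dr x S (int k) (int l) 1 * (z 1)\<^sup>2 / x 1)"
      if adm: "adm n k K x" and F: "es x S (int k) / es x S (int l) = 1" and x1: "x 1 \<ge> K\<^sub>0" for x z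
    proof -
      have R: "Rt x z S (int k) (int l) = Q x z S (int k)" by (simp only: Rt_def Q_def l1)
      have G: "G 0 x i = dr x S (int k) (int l) i" if "i \<in> S" for i
        using dq_eq_dr[OF finite_atLeastAtMost that] by (simp add: G_def qD_def l1)
      have SG: "(\<Sum>i\<in>S'. G 0 x i * (z i)\<^sup>2) = (\<Sum>i\<in>S'. dr x S (int k) (int l) i * (z i)\<^sup>2)"
        by (intro sum.cong refl arg_cong2[where f = "(*)"] G) auto
      have nrm: "normal 0 x" using adm F by (simp add: normal_def q_def l1)
      have "1 / 2 * (Q x z S (int k) $ 1)\<^sup>2 \<le> K\<^sub>1 * (Q x z S (int k) $ 1)\<^sup>2" using C by (intro mult_right_mono) auto
      then have "- 2 * Q x z S (int k) $ 2 + 2 * (0 * \<kappa>) * Rt x z S (int k - 2) (int k - 1) $ 2 + K\<^sub>1 * (Q x z S (int k) $ 1)\<^sup>2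
        \<ge> - 2 * Q x z S (int k) $ 2 + 1 / 2 * (Q x z S (int k) $ 1)\<^sup>2" by simp
      from core[OF nrm x1 _ _ this] C show ?thesis unfolding SG G[OF oneS] R by simp
    qed
    then show ?thesis using C by blast
  next
    assume l2: "int l = int k - 2 \<and> k \<ge> 3"
    define K\<^sub>1' where "K\<^sub>1' = 2 + 1 / (2 * (1 - \<kappa>))"
    have K1': "K\<^sub>1' \<ge> 1" using C by (simp add: K\<^sub>1'_def)
    have "- 2 * Rt x z S (int k) (int l) $ 2 + K\<^sub>1' * (Rt x z S (int k) (int l) $ 1)\<^sup>2
      + 2 / ((1 + \<delta>) * x 1) * (\<Sum>i\<in>S'. dr x S (int k) (int l) i * (z i)\<^sup>2)
      \<ge> (1 + \<delta>) * (dr x S (int k) (int l) 1 * (z 1)\<^sup>2 / x 1)"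
      if adm: "adm n k K x" and F: "es x S (int k) / es x S (int l) = 1" and x1: "x 1 \<ge> K\<^sub>0" for x z
    proof -
      have k3: "k \<ge> 3" and l': "int l = int k - 2" using l2 by auto
      have kk: "int k - 1 - 1 = int k - 2" by simp
      define \<nu> where "\<nu> = q x S (int k)"
      have qq: "q x S (int k) * q x S (int k - 1) = 1"
        using F eS_pos[OF adm] unfolding q_def l' kk by simp
      then have \<nu>1: "1 / q x S (int k - 1) = \<nu>" using q_bounds[OF adm] by (simp add: \<nu>_def field_simps)
      have \<nu>: "0 < \<nu>" "\<nu> \<le> 1" using q_bounds[OF adm] by (auto simp: \<nu>_def)
      have nrm: "normal 1 x" using adm k3 qq by (simp add: normal_def)
      have ne: "es x S (int k - 1) \<noteq> 0" "es x S (int k - 2) \<noteq> 0" using eS_pos[OF adm] by auto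
      have prod: "Rt x y S (int k) (int l) * Rt x y S (int k - 2) (int k - 1) = Q x y S (int k)" for y
      proof -
        let ?b = "es (ray x y) S (int k - 1)" and ?c = "es (ray x y) S (int k - 2)"
        have N: "Rt x y S (int k - 2) (int k - 1) * ?b = ?c" by (rule Rt_mult[OF _ ne(1)]) simp
        have F: "Rt x y S (int k) (int l) * ?c = es (ray x y) S (int k)" unfolding l' by (rule Rt_mult[OF _ ne(2)]) simp
        have Qb: "Q x y S (int k) * ?b = es (ray x y) S (int k)" by (rule Q_mult[OF _ ne(1)]) simp
        have "Rt x y S (int k) (int l) * Rt x y S (int k - 2) (int k - 1) * ?b = Q x y S (int k) * ?b"
          by (simp only: mult.assoc N F Qb)
        moreover have "?b $ 0 \<noteq> 0" using ne by simp
        then have "?b \<noteq> 0" by (rule fps_nonzeroI)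
        ultimately show ?thesis by simp
      qed
      have F0: "Rt x y S (int k) (int l) $ 0 = 1" for y using F by (simp add: Rt_nth_0)
      have N0: "Rt x y S (int k - 2) (int k - 1) $ 0 = \<nu>" for y using N_convex(2)[OF adm, of y] \<nu>1 by simp
      note co = fps_mult_coeffs[OF prod, unfolded F0 N0]
      have G: "G 1 x i = \<nu> * dr x S (int k) (int l) i" if i: "i \<in> S" for i
      proof -
        \<comment> \<open>In the direction of the i-th unit vector the first coefficients are
          partial derivatives, so the product rule for series becomes an identity between
          them.\<close>
        define y where "y = (\<lambda>j. if j = i then 1 else 0 :: real)"
        have sum1: "(\<Sum>j\<in>S. y j * f j) = f i" for f
        proof -
          have "(\<Sum>j\<in>S. y j * f j) = (\<Sum>j\<in>S. if j = i then f j else 0)" by (intro sum.cong refl) (simp add: y_def)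
          then show ?thesis using i by simp
        qed
        have "Rt x y S (int k) (int l) $ 1 = dr x S (int k) (int l) i"
          "Rt x y S (int k - 2) (int k - 1) $ 1 = dr x S (int k - 2) (int k - 1) i"
          "Q x y S (int k) $ 1 = qD x i"
          unfolding qD_def l' by (subst Rt_nth_1 Q_nth_1; simp add: ne sum1)+
        then show ?thesis using co(2)[of y] by (simp add: G_def nD_def algebra_simps)
      qed
      let ?F1 = "Rt x z S (int k) (int l) $ 1" and ?F2 = "Rt x z S (int k) (int l) $ 2"
      let ?N1 = "Rt x z S (int k - 2) (int k - 1) $ 1" and ?N2 = "Rt x z S (int k - 2) (int k - 1) $ 2"
      let ?Q1 = "Q x z S (int k) $ 1" and ?Q2 = "Q x z S (int k) $ 2"
      have Q1: "?Q1 = ?N1 + ?F1 * \<nu>" and Q2: "?Q2 = ?N2 + ?F1 * ?N1 + ?F2 * \<nu>" using co(2,3)[of z] by simp_all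
      have N2: "?N1\<^sup>2 / \<nu> \<le> ?N2" using N_convex(1)[OF adm, of z] unfolding \<nu>1 .
      have N2': "?N1\<^sup>2 \<le> \<nu> * ?N2" using N2 \<nu> by (simp add: field_simps)
      have N20: "?N2 \<ge> 0" by (rule N_convex(3)[OF adm])
      \<comment> \<open>From Q1 = N1 + \<nu> F1 one gets Q1^2 / 2 \<le> N1^2 + \<nu>^2 F1^2. Now
        N1^2 \<le> \<nu> N2 \<le> N2, and 2 \<kappa> \<ge> 1.\<close>
      have low: "- 2 * ?Q2 + 2 * (1 * \<kappa>) * ?N2 + 2 * \<nu> * ?F1\<^sup>2 \<ge> - 2 * ?Q2 + 1 / 2 * ?Q1\<^sup>2"
      proof -
        have "?Q1\<^sup>2 \<le> 2 * ?N1\<^sup>2 + 2 * (?F1 * \<nu>)\<^sup>2" unfolding Q1 by (rule sum_squares_le)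
        moreover have "\<nu> * ?N2 \<le> 1 * ?N2" using \<nu> N20 by (intro mult_right_mono) auto
        moreover have "(?F1 * \<nu>)\<^sup>2 \<le> \<nu> * ?F1\<^sup>2"
        proof -
          have "\<nu> * (\<nu> * ?F1\<^sup>2) \<le> 1 * (\<nu> * ?F1\<^sup>2)" using \<nu> by (intro mult_right_mono) auto
          then show ?thesis by (simp add: power2_eq_square mult_ac)
        qed
        moreover have "1 / 2 * ?N2 \<le> \<kappa> * ?N2" using C N20 by (intro mult_right_mono) auto
        moreover have "0 \<le> \<nu> * ?F1\<^sup>2" using \<nu> by simp
        ultimately show ?thesis using N2' by simp
      qed
      have cross: "- 2 * ?F2 * \<nu> + K\<^sub>1' * ?F1\<^sup>2 * \<nu> \<ge> - 2 * ?Q2 + 2 * (1 * \<kappa>) * ?N2 + 2 * \<nu> * ?F1\<^sup>2"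
      proof -
        define h where "h = 1 - \<kappa>"
        have h: "h > 0" using C by (simp add: h_def)
        have "2 * h * ?N1\<^sup>2 / \<nu> + \<nu> * ?F1\<^sup>2 / (2 * h) + 2 * (?F1 * ?N1) = (2 * h * ?N1 + \<nu> * ?F1)\<^sup>2 / (2 * h * \<nu>)"
          using h \<nu> by (simp add: field_simps power2_eq_square)
        moreover have "(2 * h * ?N1 + \<nu> * ?F1)\<^sup>2 / (2 * h * \<nu>) \<ge> 0" using h \<nu> by simp
        moreover have "2 * h * (?N1\<^sup>2 / \<nu>) \<le> 2 * h * ?N2" using N2 h by (intro mult_left_mono) auto
        ultimately have "- 2 * (?F1 * ?N1) \<le> 2 * h * ?N2 + \<nu> * ?F1\<^sup>2 / (2 * h)" by simp
        moreover have "K\<^sub>1' * ?F1\<^sup>2 * \<nu> = 2 * \<nu> * ?F1\<^sup>2 + \<nu> * ?F1\<^sup>2 / (2 * h)"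
          unfolding K\<^sub>1'_def h_def by (simp add: algebra_simps)
        moreover have "2 * h * ?N2 = 2 * ?N2 - 2 * \<kappa> * ?N2" by (simp add: h_def algebra_simps)
        moreover have "- 2 * ?F2 * \<nu> = - 2 * ?Q2 + 2 * ?N2 + 2 * (?F1 * ?N1)" unfolding Q2 by simp
        ultimately show ?thesis by (simp; linarith?)
      qed
      have SG: "(\<Sum>i\<in>S'. G 1 x i * (z i)\<^sup>2) = \<nu> * (\<Sum>i\<in>S'. dr x S (int k) (int l) i * (z i)\<^sup>2)"
        unfolding sum_distrib_left
      proof (rule sum.cong[OF refl])
        fix i assume "i \<in> S'"
        then have "i \<in> S" by auto
        from G[OF this] show "G 1 x i * (z i)\<^sup>2 = \<nu> * (dr x S (int k) (int l) i * (z i)\<^sup>2)" by simp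
      qed
      have "0 \<le> 2 * \<nu> * ?F1\<^sup>2" using \<nu> by simp
      from core[OF nrm x1 this _ low] have main: "(1 + \<delta>) * (\<nu> * dr x S (int k) (int l) 1 * (z 1)\<^sup>2 / x 1)
        \<le> - 2 * ?Q2 + 2 * (1 * \<kappa>) * ?N2 + 2 * \<nu> * ?F1\<^sup>2
          + 2 / ((1 + \<delta>) * x 1) * (\<nu> * (\<Sum>i\<in>S'. dr x S (int k) (int l) i * (z i)\<^sup>2))"
        unfolding SG G[OF oneS] by simp
      have fin: "b \<le> a1 + a2" if "\<nu> * b \<le> c + \<nu> * a2" "c \<le> \<nu> * a1" for a1 a2 b c :: real
      proof -
        have "\<nu> * b \<le> \<nu> * (a1 + a2)" using that by (simp add: distrib_left)
        then show ?thesis using \<nu> by simp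
      qed
      let ?s = "\<Sum>i\<in>S'. dr x S (int k) (int l) i * (z i)\<^sup>2" and ?d = "dr x S (int k) (int l) 1"
      have e1: "\<nu> * ((1 + \<delta>) * (?d * (z 1)\<^sup>2 / x 1)) = (1 + \<delta>) * (\<nu> * ?d * (z 1)\<^sup>2 / x 1)"
        and e2: "\<nu> * (2 / ((1 + \<delta>) * x 1) * ?s) = 2 / ((1 + \<delta>) * x 1) * (\<nu> * ?s)" by simp_all
      have e3: "\<nu> * (- 2 * ?F2 + K\<^sub>1' * ?F1\<^sup>2) = - 2 * ?F2 * \<nu> + K\<^sub>1' * ?F1\<^sup>2 * \<nu>" by (simp add: algebra_simps)
      show ?thesis by (rule fin[OF main[folded e1 e2] cross[folded e3]])
    qed
    then show ?thesis using C K1' by blast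
  qed
qed

end

section \<open>Partial derivatives and Hessian of the quotient\<close>

lemma esym_eq_es: "esym n m x = es x {1..n} (int m)"
  by (simp add: esym_def es_def)

lemma es_has_derivative:
  fixes x :: "nat \<Rightarrow> real"
  assumes "finite A"
  shows "((\<lambda>t. es (x(i := t)) A m) has_field_derivative (if i \<in> A then es x (A - {i}) (m - 1) else 0)) (at (x i))"
proof (cases "i \<in> A")
  case True
  have "es (x(i := t)) A m = t * es x (A - {i}) (m - 1) + es x (A - {i}) m" for t
  proof -
    have "es (x(i := t)) (A - {i}) j = es x (A - {i}) j" for j by (rule es_cong) simp
    then show ?thesis using es_remove[OF assms True, of "x(i := t)" m] by simp
  qed
  then show ?thesis using True by (auto intro!: derivative_eq_intros)
next
  case False
  have "es (x(i := t)) A m = es x A m" for t by (rule es_cong) (use False in auto)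
  then show ?thesis using False by simp
qed

lemma esym_quot_has_derivative:
  fixes x :: "nat \<Rightarrow> real"
  assumes i: "i \<in> {1..n}" and ne: "es x {1..n} (int l) \<noteq> 0"
  shows "partial_deriv i (esym_quot n k l) x = dr x {1..n} (int k) (int l) i"
proof -
  let ?S = "{1..n}"
  note d = es_has_derivative[OF finite_atLeastAtMost, where x = x and i = i]
  have "((\<lambda>t. es (x(i := t)) ?S (int k) / es (x(i := t)) ?S (int l)) has_field_derivative
      ((if i \<in> ?S then es x (?S - {i}) (int k - 1) else 0) * es (x(i := x i)) ?S (int l)
        - es (x(i := x i)) ?S (int k) * (if i \<in> ?S then es x (?S - {i}) (int l - 1) else 0))
      / (es (x(i := x i)) ?S (int l) * es (x(i := x i)) ?S (int l))) (at (x i))"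
    by (rule DERIV_divide[OF d d]) (use ne in simp)
  then have "deriv (\<lambda>t. es (x(i := t)) ?S (int k) / es (x(i := t)) ?S (int l)) (x i) = dr x ?S (int k) (int l) i"
    by (intro DERIV_imp_deriv) (use i in \<open>simp add: dr_def power2_eq_square\<close>)
  then show ?thesis by (simp add: partial_deriv_def esym_quot_def esym_eq_es)
qed

text \<open>To differentiate \<open>partial_deriv j\<close> its formula is needed in a whole
  neighbourhood along the i-th coordinate; continuity keeps sigma_l nonzero there. \<open>p2\<close>
  and \<open>r2\<close> vanish for i = j because elementary symmetric functions are affine in each
  variable.\<close>

lemma esym_quot_second_derivative:
  fixes x :: "nat \<Rightarrow> real"
  assumes i: "i \<in> {1..n}" and j: "j \<in> {1..n}" and ne: "es x {1..n} (int l) \<noteq> 0"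
    and S_def: "S = {1..n}" and p_def: "p = es x S (int k)" and r_def: "r = es x S (int l)"
    and p1_def: "p1 = (\<lambda>i. es x (S - {i}) (int k - 1))" and r1_def: "r1 = (\<lambda>i. es x (S - {i}) (int l - 1))"
    and p2_def: "p2 = (\<lambda>i j. if i \<in> S - {j} then es x (S - {j} - {i}) (int k - 2) else 0)"
    and r2_def: "r2 = (\<lambda>i j. if i \<in> S - {j} then es x (S - {j} - {i}) (int l - 2) else 0)"
  shows "partial_deriv i (partial_deriv j (esym_quot n k l)) x
    = (p2 i j * r + p1 j * r1 i - (p1 i * r1 j + p * r2 i j)) / r\<^sup>2 - 2 * (p1 j * r - p * r1 j) * r1 i / r ^ 3"
proof -
  let ?y = "\<lambda>t. x(i := t)"
  have kk: "int k - 1 - 1 = int k - 2" "int l - 1 - 1 = int l - 2" by simp_all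
  have fS: "finite S" "finite (S - {j})" by (simp_all add: S_def)
  have iS: "i \<in> S" using i by (simp add: S_def)
  have r0: "r \<noteq> 0" using ne by (simp add: r_def S_def)
  have dp: "((\<lambda>t. es (?y t) S (int k)) has_field_derivative p1 i) (at (x i))"
    and drr: "((\<lambda>t. es (?y t) S (int l)) has_field_derivative r1 i) (at (x i))"
    using es_has_derivative[OF fS(1), of x i "int k"] es_has_derivative[OF fS(1), of x i "int l"] iS
    by (simp_all add: p1_def r1_def)
  have dpj: "((\<lambda>t. es (?y t) (S - {j}) (int k - 1)) has_field_derivative p2 i j) (at (x i))"
    and drj: "((\<lambda>t. es (?y t) (S - {j}) (int l - 1)) has_field_derivative r2 i j) (at (x i))"
    using es_has_derivative[OF fS(2), of x i "int k - 1"] es_has_derivative[OF fS(2), of x i "int l - 1"]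
    unfolding kk p2_def r2_def by simp_all
  have fold1: "es x (S - {j}) (int k - 1) = p1 j" "es x (S - {j}) (int l - 1) = r1 j"
    by (simp_all add: p1_def r1_def)
  have d: "((\<lambda>t. dr (?y t) S (int k) (int l) j) has_field_derivative
      (p2 i j * r + p1 j * r1 i - (p1 i * r1 j + p * r2 i j)) / r\<^sup>2 - 2 * (p1 j * r - p * r1 j) * r1 i / r ^ 3) (at (x i))"
    unfolding dr_def
    by (rule derivative_eq_intros dp drr dpj drj refl | (use r0 in \<open>simp add: r_def; fail\<close>))+
      (use r0 in \<open>simp add: p_def[symmetric] r_def[symmetric] fold1 field_simps power2_eq_square power3_eq_cube\<close>)
  have "isCont (\<lambda>t. es (?y t) S (int l)) (x i)" by (rule DERIV_isCont[OF drr])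
  then have "eventually (\<lambda>t. es (?y t) S (int l) \<noteq> 0) (at (x i))"
    using r0 by (intro tendsto_imp_eventually_ne[OF isContD]) (auto simp: r_def)
  then have "eventually (\<lambda>t. es (?y t) S (int l) \<noteq> 0) (nhds (x i))"
    unfolding eventually_at_filter by (rule eventually_mono) (use r0 in \<open>auto simp: r_def\<close>)
  then have ev: "eventually (\<lambda>t. partial_deriv j (esym_quot n k l) (?y t) = dr (?y t) S (int k) (int l) j) (nhds (x i))"
    by (rule eventually_mono) (simp add: esym_quot_has_derivative[OF j] S_def)
  have "((\<lambda>t. partial_deriv j (esym_quot n k l) (?y t)) has_field_derivative
      (p2 i j * r + p1 j * r1 i - (p1 i * r1 j + p * r2 i j)) / r\<^sup>2 - 2 * (p1 j * r - p * r1 j) * r1 i / r ^ 3) (at (x i))"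
    using d by (subst DERIV_cong_ev[OF refl ev refl])
  then show ?thesis unfolding partial_deriv_def[of i] by (rule DERIV_imp_deriv)
qed

lemma double_quotient_eq: "y * r = u - f * v - X \<Longrightarrow> 2 * y * r = 2 * u - f * (2 * v) - 2 * X" for y r u f v X :: real
  by algebra

lemma double_sum_factor:
  "(\<Sum>i\<in>A. \<Sum>j\<in>B. f i * h j * c) = sum f A * sum h B * c" for f h :: "'i \<Rightarrow> real"
  unfolding sum_product unfolding sum_distrib_right by (rule refl)

text \<open>Link between the nested partial derivatives and the power series: both sides reduce to
  the sums \<open>P1\<close>, \<open>R1\<close>, \<open>P2\<close>, \<open>R2\<close> of first and
  second derivatives of numerator and denominator. The factor 2 appears since the coefficient of t^2
  is half the second derivative.\<close>

lemma esym_quot_hessian: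
  fixes x z :: "nat \<Rightarrow> real"
  assumes ne: "es x {1..n} (int l) \<noteq> 0"
  shows "(\<Sum>i=1..n. \<Sum>j=1..n. partial_deriv i (partial_deriv j (esym_quot n k l)) x * z i * z j)
    = 2 * Rt x z {1..n} (int k) (int l) $ 2"
proof -
  define S where "S = {1..n}"
  define p r where "p = es x S (int k)" and "r = es x S (int l)"
  define p1 r1 where "p1 = (\<lambda>i. es x (S - {i}) (int k - 1))" and "r1 = (\<lambda>i. es x (S - {i}) (int l - 1))"
  define p2 where "p2 = (\<lambda>i j. if i \<in> S - {j} then es x (S - {j} - {i}) (int k - 2) else 0)"
  define r2 where "r2 = (\<lambda>i j. if i \<in> S - {j} then es x (S - {j} - {i}) (int l - 2) else 0)"
  have fS: "finite S" by (simp add: S_def)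
  have r0: "r \<noteq> 0" using ne by (simp add: r_def S_def)
  define P1 R1 where "P1 = (\<Sum>i\<in>S. z i * p1 i)" and "R1 = (\<Sum>i\<in>S. z i * r1 i)"
  define P2 R2 where "P2 = (\<Sum>i\<in>S. \<Sum>j\<in>S. z i * z j * p2 i j)" and "R2 = (\<Sum>i\<in>S. \<Sum>j\<in>S. z i * z j * r2 i j)"
  have e1: "es (ray x z) S (int k) $ 1 = P1" "es (ray x z) S (int l) $ 1 = R1"
    using es_ray_nth_1[OF fS, of x z] by (simp_all add: P1_def R1_def p1_def r1_def One_nat_def)
  have two: "(\<Sum>i\<in>S. \<Sum>j\<in>S. z i * z j * (if i \<in> S - {j} then es x (S - {j} - {i}) u else 0))
    = (\<Sum>i\<in>S. \<Sum>j\<in>S - {i}. z i * z j * es x (S - {i} - {j}) u)" for u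
  proof (rule sum.cong[OF refl])
    fix i assume i: "i \<in> S"
    have "(\<Sum>j\<in>S. z i * z j * (if i \<in> S - {j} then es x (S - {j} - {i}) u else 0))
      = (\<Sum>j\<in>S - {i}. z i * z j * (if i \<in> S - {j} then es x (S - {j} - {i}) u else 0))"
      by (rule sum.mono_neutral_right[OF fS]) auto
    also have "\<dots> = (\<Sum>j\<in>S - {i}. z i * z j * es x (S - {i} - {j}) u)"
    proof (rule sum.cong[OF refl])
      fix j assume j: "j \<in> S - {i}"
      have "S - {j} - {i} = S - {i} - {j}" by blast
      then show "z i * z j * (if i \<in> S - {j} then es x (S - {j} - {i}) u else 0) = z i * z j * es x (S - {i} - {j}) u"
        using i j by simp
    qed
    finally show "(\<Sum>j\<in>S. z i * z j * (if i \<in> S - {j} then es x (S - {j} - {i}) u else 0))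
      = (\<Sum>j\<in>S - {i}. z i * z j * es x (S - {i} - {j}) u)" .
  qed
  have e2: "2 * es (ray x z) S (int k) $ 2 = P2" "2 * es (ray x z) S (int l) $ 2 = R2"
    unfolding P2_def R2_def p2_def r2_def two by (rule es_ray_nth_2[OF fS])+
  define H where "H i j = (p2 i j * r + p1 j * r1 i - (p1 i * r1 j + p * r2 i j)) / r\<^sup>2 - 2 * (p1 j * r - p * r1 j) * r1 i / r ^ 3" for i j
  have "(\<Sum>i=1..n. \<Sum>j=1..n. partial_deriv i (partial_deriv j (esym_quot n k l)) x * z i * z j) = (\<Sum>i\<in>S. \<Sum>j\<in>S. H i j * z i * z j)"
    unfolding S_def[symmetric]
  proof (intro sum.cong refl)
    fix i j assume ij: "i \<in> S" "j \<in> S"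
    have "partial_deriv i (partial_deriv j (esym_quot n k l)) x = H i j"
      unfolding H_def
      by (rule esym_quot_second_derivative[OF _ _ ne S_def p_def r_def p1_def r1_def p2_def r2_def]) (use ij S_def in auto)
    then show "partial_deriv i (partial_deriv j (esym_quot n k l)) x * z i * z j = H i j * z i * z j" by simp
  qed
  also have "\<dots> = (\<Sum>i\<in>S. \<Sum>j\<in>S. z i * z j * p2 i j * (1 / r) - z i * z j * r2 i j * (p / r\<^sup>2)
      - (z i * r1 i) * (z j * p1 j) * (1 / r\<^sup>2) - (z i * p1 i) * (z j * r1 j) * (1 / r\<^sup>2) + (z i * r1 i) * (z j * r1 j) * (2 * p / r ^ 3))"
    by (intro sum.cong refl) (use r0 in \<open>simp add: H_def field_simps power2_eq_square power3_eq_cube\<close>)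
  also have "\<dots> = P2 * (1 / r) - R2 * (p / r\<^sup>2) - R1 * P1 * (1 / r\<^sup>2) - P1 * R1 * (1 / r\<^sup>2) + R1 * R1 * (2 * p / r ^ 3)"
  proof -
    have A: "(\<Sum>i\<in>S. \<Sum>j\<in>S. z i * z j * p2 i j * (1 / r)) = P2 * (1 / r)"
      "(\<Sum>i\<in>S. \<Sum>j\<in>S. z i * z j * r2 i j * (p / r\<^sup>2)) = R2 * (p / r\<^sup>2)"
      by (simp_all only: P2_def R2_def sum_distrib_right)
    show ?thesis
      by (simp only: sum.distrib sum_subtractf A double_sum_factor P1_def[symmetric] R1_def[symmetric])
  qed
  also have "\<dots> = 2 * Rt x z S (int k) (int l) $ 2"
  proof -
    have "es x S (int l) \<noteq> 0" using r0 by (simp add: r_def)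
    note c = fps_mult_coeffs[OF Rt_mult[OF fS this, of z "int k"]]
    have F0: "Rt x z S (int k) (int l) $ 0 = p / r" using fS by (simp add: Rt_nth_0 p_def r_def)
    have er: "es (ray x z) S (int l) $ 0 = r" using fS by (simp add: r_def)
    have F1: "Rt x z S (int k) (int l) $ 1 = (P1 - p / r * R1) / r"
      using c(2) r0 unfolding e1 F0 er by (simp add: field_simps)
    have "Rt x z S (int k) (int l) $ 2 * r = es (ray x z) S (int k) $ 2 - p / r * es (ray x z) S (int l) $ 2
        - (P1 - p / r * R1) / r * R1" using c(3) unfolding e1 F0 F1 er by simp
    then have "2 * Rt x z S (int k) (int l) $ 2 * r = P2 - p / r * R2 - 2 * ((P1 - p / r * R1) / r * R1)"
      unfolding e2[symmetric] by (rule double_quotient_eq)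
    then have E: "2 * Rt x z S (int k) (int l) $ 2 = (P2 - p / r * R2 - 2 * ((P1 - p / r * R1) / r * R1)) / r"
      by (rule eq_divide_imp[OF r0])
    show ?thesis unfolding E using r0 by (simp add: field_simps power2_eq_square power3_eq_cube)
  qed
  finally show ?thesis by (simp only: S_def)
qed

section \<open>Homogeneity and removal of the normalization F = 1\<close>

lemma es_ray_scale:
  assumes "finite S"
  shows "es (ray (\<lambda>i. c * x i) (\<lambda>i. c * z i)) S (int m) = fps_const (c ^ m) * es (ray x z) S (int m)"
proof -
  have "ray (\<lambda>i. c * x i) (\<lambda>i. c * z i) = (\<lambda>i. fps_const c * ray x z i)"
    by (rule ext) (simp add: ray_def distrib_left flip: mult.assoc fps_const_mult)
  then show ?thesis using es_scale[OF assms, of "fps_const c" "ray x z" m] by (simp only: fps_const_power)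
qed

lemma Rt_scale:
  assumes S: "finite S" and ne: "es x S (int l) \<noteq> 0" and c: "c \<noteq> 0" and lk: "l \<le> k"
  shows "Rt (\<lambda>i. c * x i) (\<lambda>i. c * z i) S (int k) (int l) $ j = c ^ (k - l) * Rt x z S (int k) (int l) $ j"
proof -
  let ?R = "Rt (\<lambda>i. c * x i) (\<lambda>i. c * z i) S (int k) (int l)"
  let ?e = "es (ray x z) S"
  have "es (\<lambda>i. c * x i) S (int l) \<noteq> 0" using es_scale[OF S, of c x l] ne c by simp
  from Rt_mult[OF S this, of "\<lambda>i. c * z i" "int k"] have "?R * (fps_const (c ^ l) * ?e (int l)) = fps_const (c ^ k) * ?e (int k)"
    by (simp only: es_ray_scale[OF S])
  also have "\<dots> = fps_const (c ^ (k - l)) * Rt x z S (int k) (int l) * (fps_const (c ^ l) * ?e (int l))"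
  proof -
    have "fps_const (c ^ k) = fps_const (c ^ (k - l)) * fps_const (c ^ l)" using lk by (simp flip: power_add)
    then show ?thesis using Rt_mult[OF S ne, of z "int k"] by (simp only: mult_ac)
  qed
  finally have eq: "?R * (fps_const (c ^ l) * ?e (int l)) = fps_const (c ^ (k - l)) * Rt x z S (int k) (int l) * (fps_const (c ^ l) * ?e (int l))" .
  have "(fps_const (c ^ l) * ?e (int l)) $ 0 \<noteq> 0" using ne c S by simp
  then have "fps_const (c ^ l) * ?e (int l) \<noteq> 0" by (rule fps_nonzeroI)
  then have "?R = fps_const (c ^ (k - l)) * Rt x z S (int k) (int l)" using eq mult_right_cancel by blast
  then show ?thesis by simp
qed

lemma dr_scale:
  fixes x :: "nat \<Rightarrow> real"
  assumes S: "finite S" and ne: "es x S (int l) \<noteq> 0" and c: "c \<noteq> 0" and lk: "1 \<le> l" "l \<le> k"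
  shows "c * dr (\<lambda>i. c * x i) S (int k) (int l) i = c ^ (k - l) * dr x S (int k) (int l) i"
proof -
  have kk: "int k - 1 = int (k - 1)" "int l - 1 = int (l - 1)" using lk by auto
  have ck: "c ^ k = c ^ (k - l) * c ^ l" using lk by (simp flip: power_add)
  have ck1: "c * c ^ (k - 1) = c ^ (k - l) * c ^ l" "c * c ^ (l - 1) = c ^ l"
    using lk ck by (simp_all flip: power_Suc)
  let ?p = "es x S (int k)" and ?r = "es x S (int l)" and ?p1 = "es x (S - {i}) (int (k - 1))" and ?r1 = "es x (S - {i}) (int (l - 1))"
  have "c * dr (\<lambda>i. c * x i) S (int k) (int l) i
    = ((c * c ^ (k - 1)) * ?p1 * (c ^ l * ?r) - c ^ k * ?p * ((c * c ^ (l - 1)) * ?r1)) / (c ^ l * ?r)\<^sup>2"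
    unfolding dr_def kk es_scale[OF S] es_scale[OF finite_Diff[OF S]] by (simp add: algebra_simps)
  also have "\<dots> = c ^ (k - l) * ((?p1 * ?r - ?p * ?r1) / ?r\<^sup>2)"
    unfolding ck1 ck using c ne by (simp add: field_simps power2_eq_square)
  finally show ?thesis by (simp only: dr_def kk)
qed

theorem lemma1p1:
  fixes n k l :: nat and K f\<^sub>0 :: real
  assumes "1 \<le> l" and "l < k" and "k \<le> n"
    and "l = k - 1 \<or> l = k - 2"
    and "K \<ge> 0" and "f\<^sub>0 > 0"
  defines "F \<equiv> esym_quot n k l"
  shows "\<exists>K\<^sub>0 K\<^sub>1 \<delta> \<gamma> :: real. K\<^sub>0 \<ge> 1 \<and> K\<^sub>1 \<ge> 1 \<and> \<delta> > 0 \<and> \<gamma> > 0 \<and>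
    (\<forall>x :: nat \<Rightarrow> real.
       x \<in> Garding_cone n k \<longrightarrow>
       (\<forall>i\<in>{1..<n}. x (Suc i) \<le> x i) \<longrightarrow> x n \<ge> - K \<longrightarrow>
       F x \<ge> f\<^sub>0 \<longrightarrow>
       x 1 / F x powr (1 / real (k - l)) \<ge> K\<^sub>0 \<longrightarrow>
       (\<forall>\<zeta> :: nat \<Rightarrow> real.
          - (\<Sum>i=1..n. \<Sum>j=1..n. partial_deriv i (partial_deriv j F) x * \<zeta> i * \<zeta> j)
          + K\<^sub>1 / F x * (\<Sum>i=1..n. partial_deriv i F x * \<zeta> i)\<^sup>2
          + 2 / ((1 + \<delta>) * x 1) * (\<Sum>i=2..n. partial_deriv i F x * (\<zeta> i)\<^sup>2)
          \<ge> (1 + \<gamma>) * (partial_deriv 1 F x * (\<zeta> 1)\<^sup>2 / x 1)))"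
proof -
  define h where "h = 1 / real (k - l)"
  have d0: "k - l > 0" using assms(2) by simp
  then have h0: "h > 0" by (simp add: h_def)
  have k2: "2 \<le> k" using assms by simp
  \<comment> \<open>Scaling by c = F^(-h) turns the lower bound -K into -K c, and c is at most
    \<open>f\<^sub>0 powr (- h)\<close>. Thus the constants depend on f_0 only through K'.\<close>
  define K' where "K' = K * f\<^sub>0 powr (- h)"
  have K': "K' \<ge> 0" using assms by (simp add: K'_def)
  obtain L where L: "L \<ge> 1" "\<And>x. adm n k K' x \<Longrightarrow> \<forall>i\<in>{k..n}. x i \<le> L"
    using adm_upper[OF k2 assms(3) K'] by blast
  interpret quot n k K' L
    by unfold_locales (use k2 assms(3) K' L in auto)
  have lcase: "int l = int k - 1 \<or> int l = int k - 2 \<and> k \<ge> 3" using assms(1,2,4) by auto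
  obtain K\<^sub>0 K\<^sub>1 \<delta> :: real where C: "K\<^sub>0 \<ge> 1" "K\<^sub>1 \<ge> 1" "\<delta> > 0"
    and main: "\<And>x z. \<lbrakk>adm n k K' x; es x S (int k) / es x S (int l) = 1; x 1 \<ge> K\<^sub>0\<rbrakk> \<Longrightarrow>
      - 2 * Rt x z S (int k) (int l) $ 2 + K\<^sub>1 * (Rt x z S (int k) (int l) $ 1)\<^sup>2
      + 2 / ((1 + \<delta>) * x 1) * (\<Sum>i\<in>S'. dr x S (int k) (int l) i * (z i)\<^sup>2)
      \<ge> (1 + \<delta>) * (dr x S (int k) (int l) 1 * (z 1)\<^sup>2 / x 1)"
    using normalized[OF lcase] by blast
  have goal: "- (\<Sum>i=1..n. \<Sum>j=1..n. partial_deriv i (partial_deriv j F) x * \<zeta> i * \<zeta> j)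
          + K\<^sub>1 / F x * (\<Sum>i=1..n. partial_deriv i F x * \<zeta> i)\<^sup>2
          + 2 / ((1 + \<delta>) * x 1) * (\<Sum>i=2..n. partial_deriv i F x * (\<zeta> i)\<^sup>2)
          \<ge> (1 + \<delta>) * (partial_deriv 1 F x * (\<zeta> 1)\<^sup>2 / x 1)"
    if cone0: "x \<in> Garding_cone n k" and sort: "\<forall>i\<in>{1..<n}. x (Suc i) \<le> x i" and xn: "x n \<ge> - K"
      and Ff: "F x \<ge> f\<^sub>0" and x1: "x 1 / F x powr (1 / real (k - l)) \<ge> K\<^sub>0" for x \<zeta>
  proof -
    have epos: "es x S (int j) > 0" if "j \<le> k" for j
    proof (cases "j = 0")
      case False
      then show ?thesis using cone0 that by (auto simp: Garding_cone_def esym_eq_es)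
    qed simp
    have ne: "es x S (int l) \<noteq> 0" using epos[of l] assms(2) by simp
    have Fx: "F x = es x S (int k) / es x S (int l)" by (simp add: F_def esym_quot_def esym_eq_es)
    have F0: "F x > 0" using Ff assms(6) by linarith
    \<comment> \<open>F is homogeneous of degree k - l, so F (c x) = 1; moreover c * x 1 is exactly
      the ratio assumed to be at least \<open>K\<^sub>0\<close>.\<close>
    define c where "c = F x powr (- h)"
    have c0: "c > 0" using F0 by (simp add: c_def)
    have cF: "c ^ (k - l) = 1 / F x"
    proof -
      have "c ^ (k - l) = c powr real (k - l)" using c0 by (simp add: powr_realpow)
      also have "\<dots> = F x powr (- h * real (k - l))" by (simp add: c_def powr_powr)
      also have "- h * real (k - l) = - 1" using d0 by (simp add: h_def)
      finally show ?thesis using F0 by (simp add: powr_minus_divide)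
    qed
    have cle: "c \<le> f\<^sub>0 powr (- h)"
      unfolding c_def using Ff assms(6) h0 by (intro powr_mono2') auto
    define y where "y = (\<lambda>i. c * x i)"
    have esy: "es y S (int j) = c ^ j * es x S (int j)" for j
      unfolding y_def by (rule es_scale) simp
    have sorted_x: "x j \<le> x i" if "1 \<le> i" "i \<le> j" "j \<le> n" for i j
      using that(2,3)
    proof (induction j rule: dec_induct)
      case (step j)
      then have "x (Suc j) \<le> x j" using sort that(1) by auto
      then show ?case using step by simp
    qed simp
    have ec: "es y S (int k) / es y S (int l) = 1"
    proof -
      have "c ^ k = c ^ (k - l) * c ^ l" using assms(2) by (simp flip: power_add)
      then have "es y S (int k) / es y S (int l) = c ^ (k - l) * F x" unfolding esy Fx using c0 by simp
      then show ?thesis using cF F0 by simp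
    qed
    have coney: "cone y S (int k)" unfolding cone_def
    proof (intro allI impI)
      fix j :: int assume "0 \<le> j" "j \<le> int k"
      then show "0 < es y S j" using esy[of "nat j"] epos[of "nat j"] c0 by simp
    qed
    have qk: "q y S (int k) \<le> 1 \<and> q y S (int k - 1) \<ge> 1"
    proof -
      have le: "q y S (int k) \<le> q y S (int k - 1)"
        using q_Suc_le[of S y "int k - 1"] cone_mono[OF coney, of "int k - 1"] k2 by simp
      have qp: "q y S (int k) > 0" using q_pos[OF coney] k2 by simp
      show ?thesis using lcase
      proof
        assume "int l = int k - 1"
        then have "q y S (int k) = 1" using ec by (simp add: q_def)
        then show ?thesis using le by simp
      next
        assume l2: "int l = int k - 2 \<and> k \<ge> 3"
        have kk: "int k - 1 - 1 = int k - 2" by simp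
        have "es y S (int k - 1) > 0" using coneD[OF coney] k2 by simp
        then have qq: "q y S (int k) * q y S (int k - 1) = 1" using ec l2 unfolding q_def kk by simp
        have "q y S (int k) \<le> 1"
        proof (rule ccontr)
          assume "\<not> q y S (int k) \<le> 1"
          then have "1 * 1 < q y S (int k) * q y S (int k - 1)" using le by (intro mult_strict_mono) auto
          then show False using qq by simp
        qed
        moreover have "1 \<le> q y S (int k - 1)"
        proof -
          have "q y S (int k) * q y S (int k - 1) \<le> 1 * q y S (int k - 1)"
            using calculation le qp by (intro mult_right_mono) auto
          then show ?thesis using qq by simp
        qed
        ultimately show ?thesis by blast
      qed
    qed
    have lowy: "- K' \<le> y i" if i: "i \<in> S" for i
    proof -
      have "x n \<le> x i" using sorted_x[of i n] i by auto
      then have "- K \<le> x i" using xn by linarith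
      then have "c * (- K) \<le> c * x i" using c0 by (intro mult_left_mono) auto
      moreover have "K * c \<le> K'" unfolding K'_def using cle assms(5) by (rule mult_left_mono)
      ultimately show ?thesis by (simp add: y_def mult.commute)
    qed
    have sorty: "y j \<le> y i" if "1 \<le> i" "i \<le> j" "j \<le> n" for i j
      unfolding y_def using sorted_x[OF that] c0 by (intro mult_left_mono) auto
    have admy: "adm n k K' y"
      unfolding adm_def using coney sorty lowy qk by blast
    have y1: "y 1 \<ge> K\<^sub>0"
      using x1 unfolding y_def c_def h_def by (simp add: powr_minus divide_inverse mult.commute)
    \<comment> \<open>With the direction scaled as well, every term acquires the factor c^(k - l) =
      1 / F. The squared first-order term acquires it twice, which is why \<open>K\<^sub>1\<close>
      appears divided by F.\<close>
    define z where "z = (\<lambda>i. c * \<zeta> i)"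
    let ?r = "c ^ (k - l)"
    have r0: "?r > 0" using c0 by simp
    have R: "Rt y z S (int k) (int l) $ j = ?r * Rt x \<zeta> S (int k) (int l) $ j" for j
      unfolding y_def z_def by (rule Rt_scale[OF _ ne]) (use c0 assms(2) in auto)
    have D: "c * dr y S (int k) (int l) i = ?r * dr x S (int k) (int l) i" for i
      unfolding y_def by (rule dr_scale[OF _ ne]) (use c0 assms(1,2) in auto)
    have x1p: "x 1 > 0"
    proof -
      have "c * x 1 \<ge> 1" using y1 C by (simp add: y_def)
      then show ?thesis using c0 by (smt (verit) mult_nonneg_nonpos)
    qed
    have Dz: "dr y S (int k) (int l) i * (z i)\<^sup>2 = c * (?r * (dr x S (int k) (int l) i * (\<zeta> i)\<^sup>2))" for i
    proof -
      have "dr y S (int k) (int l) i * (z i)\<^sup>2 = c * (c * dr y S (int k) (int l) i) * (\<zeta> i)\<^sup>2"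
        by (simp add: z_def power2_eq_square mult_ac)
      then show ?thesis unfolding D by (simp add: mult_ac)
    qed
    have sum3: "2 / ((1 + \<delta>) * y 1) * (\<Sum>i\<in>S'. dr y S (int k) (int l) i * (z i)\<^sup>2)
      = ?r * (2 / ((1 + \<delta>) * x 1) * (\<Sum>i\<in>S'. dr x S (int k) (int l) i * (\<zeta> i)\<^sup>2))"
      unfolding Dz sum_distrib_left[symmetric] using c0 by (simp add: y_def)
    have rhs: "(1 + \<delta>) * (dr y S (int k) (int l) 1 * (z 1)\<^sup>2 / y 1) = ?r * ((1 + \<delta>) * (dr x S (int k) (int l) 1 * (\<zeta> 1)\<^sup>2 / x 1))"
      unfolding Dz using c0 by (simp add: y_def)
    have quad: "K\<^sub>1 * (?r * Rt x \<zeta> S (int k) (int l) $ 1)\<^sup>2 = ?r * (K\<^sub>1 / F x * (Rt x \<zeta> S (int k) (int l) $ 1)\<^sup>2)"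
      unfolding power_mult_distrib power2_eq_square[of ?r] by (simp add: cF)
    have scaled: "?r * ((1 + \<delta>) * (dr x S (int k) (int l) 1 * (\<zeta> 1)\<^sup>2 / x 1))
      \<le> - 2 * (?r * Rt x \<zeta> S (int k) (int l) $ 2) + ?r * (K\<^sub>1 / F x * (Rt x \<zeta> S (int k) (int l) $ 1)\<^sup>2)
        + ?r * (2 / ((1 + \<delta>) * x 1) * (\<Sum>i\<in>S'. dr x S (int k) (int l) i * (\<zeta> i)\<^sup>2))"
      using main[OF admy ec y1, of z] unfolding R quad sum3 rhs .
    have unscale: "b \<le> - (2 * a1) + a2 + a3" if "r * b \<le> - 2 * (r * a1) + r * a2 + r * a3" "r > 0" for r a1 a2 a3 b :: real
    proof -
      have "r * b \<le> r * (- (2 * a1) + a2 + a3)" using that(1) by (simp add: algebra_simps)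
      then show ?thesis using that(2) by simp
    qed
    have pd: "partial_deriv i F x = dr x S (int k) (int l) i" if "i \<in> S" for i
      unfolding F_def by (rule esym_quot_has_derivative[OF that ne])
    have s1: "(\<Sum>i=1..n. partial_deriv i F x * \<zeta> i) = Rt x \<zeta> S (int k) (int l) $ 1"
      unfolding Rt_nth_1[OF finite_atLeastAtMost ne] by (intro sum.cong refl) (simp only: pd mult.commute)
    have s2: "(\<Sum>i=2..n. partial_deriv i F x * (\<zeta> i)\<^sup>2) = (\<Sum>i\<in>S'. dr x S (int k) (int l) i * (\<zeta> i)\<^sup>2)"
    proof (rule sum.cong[OF refl])
      fix i assume "i \<in> S'"
      then have "i \<in> S" by auto
      then show "partial_deriv i F x * (\<zeta> i)\<^sup>2 = dr x S (int k) (int l) i * (\<zeta> i)\<^sup>2" by (simp only: pd)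
    qed
    have s3: "(\<Sum>i=1..n. \<Sum>j=1..n. partial_deriv i (partial_deriv j F) x * \<zeta> i * \<zeta> j) = 2 * Rt x \<zeta> S (int k) (int l) $ 2"
      unfolding F_def by (rule esym_quot_hessian[OF ne])
    show ?thesis unfolding s1 s2 s3 pd[OF oneS] by (rule unscale[OF scaled r0])
  qed
  \<comment> \<open>The witness for \<gamma> is \<delta>.\<close>
  show ?thesis using C goal by blast
qed

end
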